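(* (a) For every planar graph $G$ it holds that $\chi_{\mathrm{so}}(G)\leq \chi_{\mathrm{pfo}}(\mathcal{P})\cdot\chi(G)$. (b) For every outerplanar graph $G$ it holds that $\chi_{\mathrm{so}}(G)\leq \chi_{\mathrm{pfo}}(\mathcal{P}_o)\cdot\chi(G)$.
   Context: A strong odd coloring of a simple graph $G$ is a proper vertex coloring of $G$ such that for every non-isolated vertex $v$ and every color $c$, either no vertex of the open neighborhood $N_G(v)$ has color $c$, or color $c$ is used on an odd number of vertices of $N_G(v)$; $\chi_{\mathrm{so}}(G)$ is the minimum number of colors in such a coloring, and $\chi(G)$ is the chromatic number. For a plane (loopless) multigraph and a face $f$, let $V(f)$ denote the set of vertices on the boundary of $f$. A proper facially odd coloring of a $2$-connected plane multigraph $G$ is a proper vertex coloring such that for every face $f$ and every color $c$, the number of vertices of $V(f)$ having color $c$ is zero or odd; $\chi_{\mathrm{pfo}}(G)$ is the minimum number of colors in such a coloring. $\chi_{\mathrm{pfo}}(\mathcal{P})$ denotes the maximum of $\chi_{\mathrm{pfo}}(G)$ over all $2$-connected loopless multigraphs $G$ embedded in the plane, and $\chi_{\mathrm{pfo}}(\mathcal{P}_o)$ denotes the maximum of $\chi_{\mathrm{pfo}}(G)$ over all $2$-connected outerplanar graphs $G$ (with their outerplane embeddings). A graph is outerplanar if it has a plane embedding in which all vertices lie on the boundary of a single face. *)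

theory Defs
  imports Main "HOL-Library.Extended_Nat"
begin

definition simple_graph :: "'a set \<Rightarrow> 'a set set \<Rightarrow> bool" where
  "simple_graph V E \<longleftrightarrow> finite V \<and> (\<forall>e\<in>E. \<exists>u w. e = {u, w} \<and> u \<in> V \<and> w \<in> V \<and> u \<noteq> w)"

definition nbhd :: "'a set set \<Rightarrow> 'a \<Rightarrow> 'a set" where
  "nbhd E v = {u. {u, v} \<in> E}"

definition proper_col :: "'a set \<Rightarrow> 'a set set \<Rightarrow> ('a \<Rightarrow> nat) \<Rightarrow> nat \<Rightarrow> bool" where
  "proper_col V E c k \<longleftrightarrow> c ` V \<subseteq> {..<k} \<and> (\<forall>u\<in>V. \<forall>w\<in>V. {u, w} \<in> E \<longrightarrow> c u \<noteq> c w)"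

definition chromatic_number :: "'a set \<Rightarrow> 'a set set \<Rightarrow> nat" where
  "chromatic_number V E = (LEAST k. \<exists>c. proper_col V E c k)"

definition strong_odd_col :: "'a set \<Rightarrow> 'a set set \<Rightarrow> ('a \<Rightarrow> nat) \<Rightarrow> nat \<Rightarrow> bool" where
  "strong_odd_col V E c k \<longleftrightarrow> proper_col V E c k \<and>
     (\<forall>v\<in>V. nbhd E v \<noteq> {} \<longrightarrow>
        (\<forall>x. card {u \<in> nbhd E v. c u = x} = 0 \<or> odd (card {u \<in> nbhd E v. c u = x})))"

definition strong_odd_chromatic_number :: "'a set \<Rightarrow> 'a set set \<Rightarrow> nat" where
  "strong_odd_chromatic_number V E = (LEAST k. \<exists>c. strong_odd_col V E c k)"

text \<open>A map: vertex set V, dart (half-edge) set D, tlv d is the vertex at which dart d starts,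
  al is the fixed-point-free involution pairing the two darts of an edge, sg is the rotation
  (cyclic order of darts around each vertex).  Faces are the orbits of sg o al.\<close>

definition comb_map :: "'v set \<Rightarrow> 'd set \<Rightarrow> ('d \<Rightarrow> 'v) \<Rightarrow> ('d \<Rightarrow> 'd) \<Rightarrow> ('d \<Rightarrow> 'd) \<Rightarrow> bool" where
  "comb_map V D tlv al sg \<longleftrightarrow> finite V \<and> finite D \<and> tlv ` D \<subseteq> V \<and>
     bij_betw al D D \<and> (\<forall>d\<in>D. al (al d) = d \<and> al d \<noteq> d) \<and>
     bij_betw sg D D \<and> (\<forall>d\<in>D. tlv (sg d) = tlv d) \<and>
     (\<forall>d\<in>D. \<forall>d'\<in>D. tlv d = tlv d' \<longrightarrow> (\<exists>n. (sg ^^ n) d = d'))"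

definition map_adj :: "'d set \<Rightarrow> ('d \<Rightarrow> 'v) \<Rightarrow> ('d \<Rightarrow> 'd) \<Rightarrow> 'v \<Rightarrow> 'v \<Rightarrow> bool" where
  "map_adj D tlv al u w \<longleftrightarrow> (\<exists>d\<in>D. tlv d = u \<and> tlv (al d) = w)"

definition face_of :: "('d \<Rightarrow> 'd) \<Rightarrow> ('d \<Rightarrow> 'd) \<Rightarrow> 'd \<Rightarrow> 'd set" where
  "face_of al sg d = {((sg \<circ> al) ^^ n) d | n. True}"

definition map_faces :: "'d set \<Rightarrow> ('d \<Rightarrow> 'd) \<Rightarrow> ('d \<Rightarrow> 'd) \<Rightarrow> 'd set set" where
  "map_faces D al sg = face_of al sg ` D"

definition map_comp :: "'v set \<Rightarrow> 'd set \<Rightarrow> ('d \<Rightarrow> 'v) \<Rightarrow> ('d \<Rightarrow> 'd) \<Rightarrow> 'v \<Rightarrow> 'v set" where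
  "map_comp V D tlv al u = {w \<in> V. (map_adj D tlv al)\<^sup>*\<^sup>* u w}"

text \<open>Euler characteristic 2 on a connected piece: |V| - |E| + |F| = 2 (genus 0, i.e. spherical).\<close>
definition genus0_on :: "'v set \<Rightarrow> 'd set \<Rightarrow> ('d \<Rightarrow> 'd) \<Rightarrow> ('d \<Rightarrow> 'd) \<Rightarrow> bool" where
  "genus0_on C DC al sg \<longleftrightarrow> card C + card (map_faces DC al sg) = card DC div 2 + 2"

definition connected_on :: "'v set \<Rightarrow> ('v \<Rightarrow> 'v \<Rightarrow> bool) \<Rightarrow> bool" where
  "connected_on S r \<longleftrightarrow> (\<forall>u\<in>S. \<forall>w\<in>S. (\<lambda>x y. x \<in> S \<and> y \<in> S \<and> r x y)\<^sup>*\<^sup>* u w)"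

text \<open>2-connected (Diestel's convention): at least 3 vertices, connected, no cut vertex.\<close>
definition two_connected :: "'v set \<Rightarrow> ('v \<Rightarrow> 'v \<Rightarrow> bool) \<Rightarrow> bool" where
  "two_connected V r \<longleftrightarrow> card V \<ge> 3 \<and> connected_on V r \<and> (\<forall>x\<in>V. connected_on (V - {x}) r)"

definition loopless_map :: "'d set \<Rightarrow> ('d \<Rightarrow> 'v) \<Rightarrow> ('d \<Rightarrow> 'd) \<Rightarrow> bool" where
  "loopless_map D tlv al \<longleftrightarrow> (\<forall>d\<in>D. tlv (al d) \<noteq> tlv d)"

definition simple_map :: "'d set \<Rightarrow> ('d \<Rightarrow> 'v) \<Rightarrow> ('d \<Rightarrow> 'd) \<Rightarrow> bool" where
  "simple_map D tlv al \<longleftrightarrow> loopless_map D tlv al \<and>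
     (\<forall>d\<in>D. \<forall>d'\<in>D. tlv d = tlv d' \<and> tlv (al d) = tlv (al d') \<longrightarrow> d = d')"

definition two_conn_plane_multigraph ::
  "'v set \<Rightarrow> 'd set \<Rightarrow> ('d \<Rightarrow> 'v) \<Rightarrow> ('d \<Rightarrow> 'd) \<Rightarrow> ('d \<Rightarrow> 'd) \<Rightarrow> bool" where
  "two_conn_plane_multigraph V D tlv al sg \<longleftrightarrow> comb_map V D tlv al sg \<and> loopless_map D tlv al \<and>
     two_connected V (map_adj D tlv al) \<and> genus0_on V D al sg"

definition two_conn_outerplane_graph ::
  "'v set \<Rightarrow> 'd set \<Rightarrow> ('d \<Rightarrow> 'v) \<Rightarrow> ('d \<Rightarrow> 'd) \<Rightarrow> ('d \<Rightarrow> 'd) \<Rightarrow> bool" where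
  "two_conn_outerplane_graph V D tlv al sg \<longleftrightarrow> two_conn_plane_multigraph V D tlv al sg \<and>
     simple_map D tlv al \<and> (\<exists>f\<in>map_faces D al sg. tlv ` f = V)"

definition pfo_col ::
  "'v set \<Rightarrow> 'd set \<Rightarrow> ('d \<Rightarrow> 'v) \<Rightarrow> ('d \<Rightarrow> 'd) \<Rightarrow> ('d \<Rightarrow> 'd) \<Rightarrow> ('v \<Rightarrow> nat) \<Rightarrow> nat \<Rightarrow> bool" where
  "pfo_col V D tlv al sg c k \<longleftrightarrow> c ` V \<subseteq> {..<k} \<and> (\<forall>d\<in>D. c (tlv d) \<noteq> c (tlv (al d))) \<and>
     (\<forall>f\<in>map_faces D al sg. \<forall>x.
        card {v \<in> tlv ` f. c v = x} = 0 \<or> odd (card {v \<in> tlv ` f. c v = x}))"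

definition chi_pfo :: "'v set \<Rightarrow> 'd set \<Rightarrow> ('d \<Rightarrow> 'v) \<Rightarrow> ('d \<Rightarrow> 'd) \<Rightarrow> ('d \<Rightarrow> 'd) \<Rightarrow> nat" where
  "chi_pfo V D tlv al sg = (LEAST k. \<exists>c. pfo_col V D tlv al sg c k)"

text \<open>chi_pfo(P) and chi_pfo(P_o), as suprema in enat (vertices and darts taken from nat, w.l.o.g.).\<close>
definition chi_pfo_P :: enat where
  "chi_pfo_P = (SUP M \<in> {(V :: nat set, D :: nat set, tlv :: nat \<Rightarrow> nat, al, sg).
                        two_conn_plane_multigraph V D tlv al sg}.
                  enat (case M of (V, D, tlv, al, sg) \<Rightarrow> chi_pfo V D tlv al sg))"

definition chi_pfo_Po :: enat where
  "chi_pfo_Po = (SUP M \<in> {(V :: nat set, D :: nat set, tlv :: nat \<Rightarrow> nat, al, sg).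
                        two_conn_outerplane_graph V D tlv al sg}.
                  enat (case M of (V, D, tlv, al, sg) \<Rightarrow> chi_pfo V D tlv al sg))"

text \<open>Darts of a simple graph: ordered pairs (u,w) with {u,w} an edge; tail = fst, reversal = swap.\<close>
definition graph_darts :: "'a set set \<Rightarrow> ('a \<times> 'a) set" where
  "graph_darts E = {(u, w). {u, w} \<in> E}"

definition comp_darts :: "'v set \<Rightarrow> 'd set \<Rightarrow> ('d \<Rightarrow> 'v) \<Rightarrow> ('d \<Rightarrow> 'd) \<Rightarrow> 'v \<Rightarrow> 'd set" where
  "comp_darts V D tlv al u = {d \<in> D. tlv d \<in> map_comp V D tlv al u}"

definition planar_graph :: "'a set \<Rightarrow> 'a set set \<Rightarrow> bool" where
  "planar_graph V E \<longleftrightarrow> (\<exists>sg. comb_map V (graph_darts E) fst prod.swap sg \<and>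
     (\<forall>u\<in>V. comp_darts V (graph_darts E) fst prod.swap u \<noteq> {} \<longrightarrow>
        genus0_on (map_comp V (graph_darts E) fst prod.swap u)
                      (comp_darts V (graph_darts E) fst prod.swap u) prod.swap sg))"

definition outerplanar_graph :: "'a set \<Rightarrow> 'a set set \<Rightarrow> bool" where
  "outerplanar_graph V E \<longleftrightarrow> (\<exists>sg. comb_map V (graph_darts E) fst prod.swap sg \<and>
     (\<forall>u\<in>V. comp_darts V (graph_darts E) fst prod.swap u \<noteq> {} \<longrightarrow>
        genus0_on (map_comp V (graph_darts E) fst prod.swap u)
                  (comp_darts V (graph_darts E) fst prod.swap u) prod.swap sg \<and>
        (\<exists>f\<in>map_faces (comp_darts V (graph_darts E) fst prod.swap u) prod.swap sg.
            fst ` f = map_comp V (graph_darts E) fst prod.swap u)))"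

end

theory Submission
  imports Defs "HOL-Combinatorics.Cycles"
begin

text \<open>
  Let A be a colour class of an optimal proper colouring. If every such A can be coloured with k
  colours so that each colour occurs zero or an odd number of times on N(w) \<inter> A for every w
  outside A, then the product with the proper colouring is a strong odd colouring.

  Planar case: keep the edges between A and the vertices outside A with at least two neighbours
  in A. Deleting edges does not raise the genus, so every component of this bipartite graph is a
  spherical hypermap. A cycle through N(w) \<inter> A drawn closely around each w outside A, and a
  new vertex in each remaining face joined to all its corners, yield a 2-connected plane
  multigraph in which every N(w) \<inter> A is the vertex set of a face. Its facially odd colouring
  restricts to A.

  Outerplanar case: in the order of the vertices along the outer face the sets N(w) \<inter> A are
  pairwise noncrossing, because a crossing would produce a submap of genus one. A noncrossing
  family has a colouring as required with five colours, and the 5-cycle shows that the maximum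
  over outerplane graphs is at least five.
\<close>

section \<open>Cycles of permutations\<close>

text \<open>Permutations are used because submaps must be formed freely, one dart at a time, and a
  pair of permutations remains one after each deletion. The defect is monotone under deletion, and
  this replaces plane topology throughout: in (a) it keeps the bipartite submaps spherical, in (b)
  it stands in for the Jordan curve theorem, since two curves crossing once yield a submap of
  positive defect.

  In (a) the vertex w disappears and only the cyclic order of its neighbours in A survives, so w
  becomes a hyperedge; this is why hypermaps appear. An outside vertex with a single neighbour in A
  has to be left out because the cycle around it would be a loop.

  In (b) this construction does not stay in the required class: a cycle around two neighbours is a
  pair of parallel edges, whereas outerplane graphs are simple here, and the new face vertices need
  not lie on the outer face. Hence the outerplanar bound is proved with the constant five directly.
  The five comes from a path of five vertices whose ends have prescribed different colours; the
  5-cycle shows that the maximum is no smaller.\<close>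

definition cyc :: "('a \<Rightarrow> 'a) \<Rightarrow> 'a \<Rightarrow> 'a set" where
  "cyc p x = {(p ^^ n) x | n. True}"

definition norb :: "('a \<Rightarrow> 'a) \<Rightarrow> 'a set \<Rightarrow> nat" where
  "norb p X = card (cyc p ` X)"

lemma cyc_self [simp, intro]: "x \<in> cyc p x"
  unfolding cyc_def by (auto intro: exI[of _ 0])

lemma cyc_step: "y \<in> cyc p x \<Longrightarrow> p y \<in> cyc p x"
  unfolding cyc_def by clarsimp (metis funpow.simps(2) o_apply)

lemma cyc_pow: "(p ^^ n) x \<in> cyc p x"
  unfolding cyc_def by auto

lemma cyc_least:
  assumes "x \<in> S" "\<And>y. y \<in> S \<Longrightarrow> p y \<in> S"
  shows "cyc p x \<subseteq> S"
proof -
  have "(p ^^ n) x \<in> S" for n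
    by (induction n) (auto simp: assms)
  then show ?thesis unfolding cyc_def by auto
qed

lemma cyc_least_on:
  assumes "x \<in> S" "\<And>y. y \<in> S \<Longrightarrow> y \<in> cyc p x \<Longrightarrow> p y \<in> S"
  shows "cyc p x \<subseteq> S"
  using cyc_least[of x "S \<inter> cyc p x" p] assms by (auto intro: cyc_step)

lemma cyc_trans: "y \<in> cyc p x \<Longrightarrow> cyc p y \<subseteq> cyc p x"
  by (rule cyc_least) (auto intro: cyc_step)

lemma cyc_fixed: "p x = x \<Longrightarrow> cyc p x = {x}"
  using cyc_least[of x "{x}" p] by (auto)

lemma pow_period:
  assumes "finite X" "p permutes X"
  obtains n where "n > 0" "\<And>x. (p ^^ n) x = x"
proof -
  have "permutation p" using assms permutation_permutes by blast
  then obtain n where "(p ^^ n) = id" "n > 0"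
    using permutation_is_nilpotent by blast
  then show ?thesis using that[of n] by simp
qed

text \<open>\<open>cyc\<close> uses forward iterates only, but some positive power of a permutation
  of a finite set is the identity, so going on along the cycle leads back to \<open>x\<close>. Thus
  the sets \<open>cyc p x\<close> form a partition and \<open>norb\<close> counts cycles.\<close>

lemma cyc_eq:
  assumes "finite X" "p permutes X" "y \<in> cyc p x"
  shows "cyc p y = cyc p x"
proof
  show "cyc p y \<subseteq> cyc p x" using cyc_trans assms(3) by metis
  obtain N where N: "N > 0" "\<And>x. (p ^^ N) x = x" using pow_period assms by metis
  obtain n where n: "y = (p ^^ n) x" using assms(3) unfolding cyc_def by auto
  have Nk: "(p ^^ (N * k)) x = x" for k x
    by (induction k arbitrary: x) (auto simp: funpow_add N)
  have "(p ^^ (N * n - n)) y = (p ^^ (N * n - n + n)) x"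
    by (simp add: n funpow_add)
  also have "N * n - n + n = N * n" using N(1) by simp
  finally have "(p ^^ (N * n - n)) y = x" using Nk by simp
  then have "x \<in> cyc p y" using cyc_pow by metis
  then show "cyc p x \<subseteq> cyc p y" using cyc_trans by metis
qed

lemma cyc_eq_iff:
  assumes "finite X" "p permutes X"
  shows "cyc p y = cyc p x \<longleftrightarrow> y \<in> cyc p x"
  using cyc_eq[OF assms] cyc_self by metis

lemma cyc_sym:
  assumes "finite X" "p permutes X" "y \<in> cyc p x"
  shows "x \<in> cyc p y"
  using cyc_eq[OF assms] by auto

lemma cyc_pred:
  assumes "finite X" "p permutes X"
  obtains y where "y \<in> cyc p x" "p y = x"
proof -
  have "inj p" using assms permutes_inj by blast
  obtain n where n: "n > 0" "\<And>x. (p ^^ n) x = x" using pow_period assms by metis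
  then obtain m where m: "n = Suc m" by (cases n) auto
  have "p ((p ^^ m) x) = x" using n(2)[of x] m by simp
  then show ?thesis using that cyc_pow by metis
qed

lemma cyc_inv_step:
  assumes "finite X" "p permutes X" "y \<in> cyc p x"
  shows "inv p y \<in> cyc p x"
proof -
  obtain z where "z \<in> cyc p y" "p z = y" using cyc_pred[OF assms(1,2)] by metis
  then have "z = inv p y" using assms(2) by (metis permutes_inverses(2))
  then show ?thesis using \<open>z \<in> cyc p y\<close> cyc_eq[OF assms] by auto
qed

lemma cyc_inv:
  assumes "finite X" "p permutes X"
  shows "cyc (inv p) x = cyc p x"
proof
  show "cyc (inv p) x \<subseteq> cyc p x"
    by (rule cyc_least) (auto intro: cyc_inv_step[OF assms])
  have i: "inv p permutes X" using assms permutes_inv by blast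
  show "cyc p x \<subseteq> cyc (inv p) x"
    by (rule cyc_least)
       (use cyc_inv_step[OF assms(1) i] permutes_inv_inv[OF assms(2)] in auto)
qed

lemma cyc_subset:
  assumes "p permutes X" "x \<in> X"
  shows "cyc p x \<subseteq> X"
  by (rule cyc_least) (use assms in \<open>auto simp: permutes_in_image\<close>)

lemma cyc_cong_on:
  assumes "x \<in> S" "\<And>y. y \<in> S \<Longrightarrow> p y \<in> S" "\<And>y. y \<in> S \<Longrightarrow> q y = p y"
  shows "cyc q x = cyc p x"
proof -
  have "(q ^^ n) x = (p ^^ n) x \<and> (p ^^ n) x \<in> S" for n
    by (induction n) (auto simp: assms)
  then show ?thesis unfolding cyc_def by auto
qed

text \<open>The arrow into \<open>i\<close> is redirected to \<open>j\<close> and the arrow into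
  \<open>j\<close> to \<open>i\<close>; this joins two different cycles into one and leaves the
  others alone.\<close>

lemma transpose_compose_cyc:
  assumes fin: "finite X" and p: "p permutes X" and ij: "i \<in> X" "j \<in> X"
    and diff: "i \<notin> cyc p j"
  defines "q \<equiv> transpose i j \<circ> p"
  shows "cyc q i = cyc p i \<union> cyc p j" "cyc q j = cyc p i \<union> cyc p j"
    "\<And>x. x \<notin> cyc p i \<union> cyc p j \<Longrightarrow> cyc q x = cyc p x"
proof -
  have q: "q permutes X" unfolding q_def using p ij by (simp add: permutes_compose permutes_swap_id)
  have ne: "i \<noteq> j" using diff by auto
  have diff': "j \<notin> cyc p i" using cyc_sym[OF fin p] diff by metis
  have qi: "p y = i \<Longrightarrow> q y = j" and qj: "p y = j \<Longrightarrow> q y = i"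
    and qo: "p y \<noteq> i \<Longrightarrow> p y \<noteq> j \<Longrightarrow> q y = p y" for y
    by (auto simp: q_def)
  \<comment> \<open>If \<open>j\<close> were missed, \<open>q\<close> would follow \<open>p\<close>
    along the whole \<open>p\<close>-cycle of \<open>i\<close>, including the element that
    \<open>p\<close> sends to \<open>i\<close>; but \<open>q\<close> sends that element to
    \<open>j\<close>.\<close>
  have "j \<in> cyc q i"
  proof (rule ccontr)
    assume j: "j \<notin> cyc q i"
    have *: "q y = p y \<and> p y \<noteq> i" if "y \<in> cyc q i" "y \<in> cyc p i" for y
    proof -
      have "p y \<noteq> j" using that(2) cyc_step diff' by metis
      moreover have "q y \<noteq> j" using that(1) cyc_step j by metis
      ultimately show ?thesis using qi qo by metis
    qed
    have "cyc p i \<subseteq> cyc q i"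
      by (rule cyc_least_on) (use * cyc_step in \<open>force+\<close>)
    moreover obtain y where "y \<in> cyc p i" "p y = i" using cyc_pred[OF fin p] by metis
    ultimately show False using * by blast
  qed
  then have eq: "cyc q j = cyc q i" using cyc_eq[OF fin q] by metis
  have cl: "p y \<in> cyc q i" if "y \<in> cyc q i" for y
    using cyc_step[OF that] qi qj qo \<open>j \<in> cyc q i\<close> by (metis cyc_self)
  have 1: "cyc p i \<subseteq> cyc q i" by (rule cyc_least) (auto intro: cl)
  have 2: "cyc p j \<subseteq> cyc q i" by (rule cyc_least) (auto intro: cl \<open>j \<in> cyc q i\<close>)
  have 3: "cyc q i \<subseteq> cyc p i \<union> cyc p j"
    by (rule cyc_least) (use qi qj qo cyc_step in \<open>(metis Un_iff cyc_self)+\<close>)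
  show A: "cyc q i = cyc p i \<union> cyc p j" using 1 2 3 by blast
  show "cyc q j = cyc p i \<union> cyc p j" using A eq by simp
  fix x assume x: "x \<notin> cyc p i \<union> cyc p j"
  show "cyc q x = cyc p x"
  proof (rule cyc_cong_on[where S = "cyc p x"])
    fix y assume y: "y \<in> cyc p x"
    then have "p y \<in> cyc p x" by (rule cyc_step)
    then have "p y \<noteq> i" "p y \<noteq> j" using x cyc_sym[OF fin p] by (metis UnCI)+
    then show "q y = p y" using qo by blast
  qed (auto intro: cyc_step)
qed

lemma norb_transpose_merge:
  assumes fin: "finite X" and p: "p permutes X" and ij: "i \<in> X" "j \<in> X"
    and diff: "i \<notin> cyc p j"
  shows "norb p X = norb (transpose i j \<circ> p) X + 1"
proof -
  let ?q = "transpose i j \<circ> p"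
  let ?C = "cyc p i \<union> cyc p j"
  note c = transpose_compose_cyc[OF assms]
  have q: "?q permutes X" using p ij by (simp add: permutes_compose permutes_swap_id)
  have CX: "?C \<subseteq> X" using cyc_subset[OF p] ij by auto
  have p1: "cyc p ` X = insert (cyc p i) (insert (cyc p j) (cyc p ` (X - ?C)))"
    using CX ij cyc_eq[OF fin p] by (auto simp: image_iff)
  have q1: "cyc ?q ` X = insert ?C (cyc p ` (X - ?C))"
  proof -
    have "cyc ?q x = ?C" if "x \<in> ?C" for x
      using cyc_eq[OF fin q] c(1) that by metis
    then have "cyc ?q ` ?C = {?C}" by auto
    moreover have "cyc ?q ` (X - ?C) = cyc p ` (X - ?C)" using c(3) by (auto intro!: image_cong)
    moreover have "X = ?C \<union> (X - ?C)" using CX by auto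
    ultimately show ?thesis by (metis image_Un insert_is_Un)
  qed
  have n1: "cyc p i \<notin> insert (cyc p j) (cyc p ` (X - ?C))"
    using diff cyc_self cyc_eq_iff[OF fin p] by blast
  have n2: "cyc p j \<notin> cyc p ` (X - ?C)"
    using cyc_self cyc_eq_iff[OF fin p] by blast
  have n3: "?C \<notin> cyc p ` (X - ?C)"
    using cyc_self by (metis (no_types, lifting) DiffE imageE)
  have f: "finite (cyc p ` (X - ?C))" using fin by simp
  show ?thesis unfolding norb_def p1 q1 using n1 n2 n3 f by simp
qed

text \<open>With \<open>t\<close> the first time at which the cycle of \<open>j\<close> reaches
  \<open>i\<close>, the composition sends the point at time \<open>t - 1\<close> back to
  \<open>j\<close>. This arc is closed off and misses \<open>i\<close>.\<close>

lemma transpose_compose_split: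
  assumes fin: "finite X" and p: "p permutes X"
    and ne: "i \<noteq> j" and same: "i \<in> cyc p j"
  shows "i \<notin> cyc (transpose i j \<circ> p) j"
proof -
  obtain t0 where "(p ^^ t0) j = i" using same unfolding cyc_def by auto
  define t where "t = (LEAST t. (p ^^ t) j = i)"
  have t: "(p ^^ t) j = i" unfolding t_def by (rule LeastI) fact
  have tl: "(p ^^ s) j \<noteq> i" if "s < t" for s using not_less_Least[of s] that unfolding t_def by blast
  have t0: "t > 0" using t ne by (cases t) auto
  have noj: "(p ^^ s) j \<noteq> j" if "0 < s" "s \<le> t" for s
  proof
    assume "(p ^^ s) j = j"
    have "(p ^^ t) j = (p ^^ (t - s)) ((p ^^ s) j)"
      using that by (metis comp_apply funpow_add le_add_diff_inverse2)
    then have "(p ^^ (t - s)) j = i" using t \<open>(p ^^ s) j = j\<close> by simp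
    then show False using tl[of "t - s"] that t0 by simp
  qed
  have "cyc (transpose i j \<circ> p) j \<subseteq> {(p ^^ s) j | s. s < t}"
  proof (rule cyc_least)
    show "j \<in> {(p ^^ s) j | s. s < t}" using t0 by (auto intro!: exI[of _ 0])
    fix y assume "y \<in> {(p ^^ s) j | s. s < t}"
    then obtain s where s: "s < t" "y = (p ^^ s) j" by auto
    have py: "p y = (p ^^ Suc s) j" using s by simp
    show "(transpose i j \<circ> p) y \<in> {(p ^^ s) j | s. s < t}"
    proof (cases "Suc s = t")
      case True
      then have "(transpose i j \<circ> p) y = j" using py t by simp
      then show ?thesis using t0 by (auto intro!: exI[of _ 0])
    next
      case False
      then have "Suc s < t" using s by simp
      then have "p y \<noteq> i" "p y \<noteq> j" using tl noj[of "Suc s"] py by (metis, simp)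
      then have "(transpose i j \<circ> p) y = (p ^^ Suc s) j" using py by simp
      then show ?thesis using \<open>Suc s < t\<close> by blast
    qed
  qed
  then show ?thesis using tl by auto
qed

text \<open>A transposition is an involution, so splitting is merging read backwards.\<close>

lemma norb_transpose_split:
  assumes fin: "finite X" and p: "p permutes X" and ij: "i \<in> X" "j \<in> X"
    and ne: "i \<noteq> j" and same: "i \<in> cyc p j"
  shows "norb (transpose i j \<circ> p) X = norb p X + 1"
proof -
  let ?q = "transpose i j \<circ> p"
  have q: "?q permutes X" using p ij by (simp add: permutes_compose permutes_swap_id)
  have "transpose i j \<circ> ?q = p" by (simp add: o_assoc[symmetric] fun_eq_iff)
  then show ?thesis
    using norb_transpose_merge[OF fin q ij transpose_compose_split[OF fin p ne same]] by simp
qed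

text \<open>\<open>r\<close> conjugates \<open>t \<circ> r\<close> to \<open>r \<circ> t\<close> and
  so carries cycles onto cycles.\<close>

lemma norb_commute:
  assumes fin: "finite X" and r: "r permutes X" and t: "t permutes X"
  shows "norb (r \<circ> t) X = norb (t \<circ> r) X"
proof -
  have *: "norb (r \<circ> t) X \<le> norb (t \<circ> r) X" if r: "r permutes X" and t: "t permutes X" for r t
  proof -
    have e: "r ` cyc (t \<circ> r) x = cyc (r \<circ> t) (r x)" for x
    proof -
      have "r (((t \<circ> r) ^^ n) x) = ((r \<circ> t) ^^ n) (r x)" for n
        by (induction n) auto
      then show ?thesis unfolding cyc_def by (auto simp: image_iff) metis
    qed
    have "cyc (r \<circ> t) ` X = cyc (r \<circ> t) ` r ` X" using permutes_image[OF r] by simp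
    also have "\<dots> = (\<lambda>C. r ` C) ` cyc (t \<circ> r) ` X" by (auto simp: e image_image)
    finally show ?thesis unfolding norb_def using fin by (metis card_image_le finite_imageI)
  qed
  show ?thesis using *[OF r t] *[OF t r] by simp
qed

section \<open>Pairs of permutations and their genus defect\<close>

definition gen_orbit :: "('a \<Rightarrow> 'a) \<Rightarrow> ('a \<Rightarrow> 'a) \<Rightarrow> 'a \<Rightarrow> 'a set" where
  "gen_orbit r t x = {y. (\<lambda>a b. b = r a \<or> b = t a)\<^sup>*\<^sup>* x y}"

definition ncomp :: "('a \<Rightarrow> 'a) \<Rightarrow> ('a \<Rightarrow> 'a) \<Rightarrow> 'a set \<Rightarrow> nat" where
  "ncomp r t X = card (gen_orbit r t ` X)"

text \<open>By Euler's formula this is twice the total genus of the hypermap whose vertices, hyperedges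
  and faces are the orbits of r, t and r \<circ> t.\<close>

definition defect :: "'a set \<Rightarrow> ('a \<Rightarrow> 'a) \<Rightarrow> ('a \<Rightarrow> 'a) \<Rightarrow> int" where
  "defect X r t = int (card X) + 2 * int (ncomp r t X)
     - int (norb r X) - int (norb t X) - int (norb (r \<circ> t) X)"

lemma gen_orbit_self [simp, intro]: "x \<in> gen_orbit r t x"
  unfolding gen_orbit_def by auto

lemma gen_orbit_step1: "y \<in> gen_orbit r t x \<Longrightarrow> r y \<in> gen_orbit r t x"
  unfolding gen_orbit_def by (auto intro: rtranclp.rtrancl_into_rtrancl)

lemma gen_orbit_step2: "y \<in> gen_orbit r t x \<Longrightarrow> t y \<in> gen_orbit r t x"
  unfolding gen_orbit_def by (auto intro: rtranclp.rtrancl_into_rtrancl)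

lemma gen_orbit_commute: "gen_orbit r t = gen_orbit t r"
  unfolding gen_orbit_def by (intro ext) (simp add: disj_commute)

lemma gen_orbit_least:
  assumes "x \<in> S" "\<And>y. y \<in> S \<Longrightarrow> r y \<in> S" "\<And>y. y \<in> S \<Longrightarrow> t y \<in> S"
  shows "gen_orbit r t x \<subseteq> S"
proof
  fix y assume "y \<in> gen_orbit r t x"
  then have "(\<lambda>a b. b = r a \<or> b = t a)\<^sup>*\<^sup>* x y" unfolding gen_orbit_def by simp
  then show "y \<in> S" by (induction) (use assms in auto)
qed

lemma gen_orbit_trans: "y \<in> gen_orbit r t x \<Longrightarrow> gen_orbit r t y \<subseteq> gen_orbit r t x"
  by (rule gen_orbit_least) (auto intro: gen_orbit_step1 gen_orbit_step2)

lemma cyc_subset_gen_orbit: "cyc r x \<subseteq> gen_orbit r t x"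
  by (rule cyc_least) (auto intro: gen_orbit_step1)

lemma cyc_compose_subset_gen_orbit: "cyc (r \<circ> t) x \<subseteq> gen_orbit r t x"
  by (rule cyc_least) (auto intro: gen_orbit_step1 gen_orbit_step2)

lemma gen_orbit_sym:
  assumes "finite X" "r permutes X" "t permutes X" "y \<in> gen_orbit r t x"
  shows "x \<in> gen_orbit r t y"
proof -
  have "gen_orbit r t x \<subseteq> {y. x \<in> gen_orbit r t y}"
  proof (rule gen_orbit_least)
    fix y assume "y \<in> {y. x \<in> gen_orbit r t y}"
    then have x: "x \<in> gen_orbit r t y" by simp
    have "y \<in> cyc r (r y)" "y \<in> cyc t (t y)"
      using cyc_sym[OF assms(1,2)] cyc_sym[OF assms(1,3)] cyc_step cyc_self by metis+
    then have "y \<in> gen_orbit r t (r y)" "y \<in> gen_orbit r t (t y)"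
      using cyc_subset_gen_orbit[of r "r y" t] cyc_subset_gen_orbit[of t "t y" r] by (auto simp: gen_orbit_commute)
    then show "r y \<in> {y. x \<in> gen_orbit r t y}" "t y \<in> {y. x \<in> gen_orbit r t y}"
      using x gen_orbit_trans by fast+
  qed auto
  then show ?thesis using assms(4) by auto
qed

lemma gen_orbit_eq:
  assumes "finite X" "r permutes X" "t permutes X" "y \<in> gen_orbit r t x"
  shows "gen_orbit r t y = gen_orbit r t x"
  using gen_orbit_trans gen_orbit_sym[OF assms(1-3)] assms(4) by (metis subset_antisym)

lemma gen_orbit_subset:
  assumes "r permutes X" "t permutes X" "x \<in> X"
  shows "gen_orbit r t x \<subseteq> X"
  by (rule gen_orbit_least) (use assms in \<open>auto simp: permutes_in_image\<close>)

lemma card_image_le_of_factor: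
  assumes "finite X" "\<And>x y. x \<in> X \<Longrightarrow> y \<in> X \<Longrightarrow> g x = g y \<Longrightarrow> f x = f y"
  shows "card (f ` X) \<le> card (g ` X)"
proof -
  have "f x = f (inv_into X g (g x))" if "x \<in> X" for x
    using assms(2)[OF that, of "inv_into X g (g x)"] that
    by (metis f_inv_into_f imageI inv_into_into)
  then have "f ` X = (\<lambda>C. f (inv_into X g C)) ` g ` X" by (auto simp: image_image)
  then show ?thesis using assms(1) by (metis card_image_le finite_imageI)
qed

text \<open>\<open>r\<close> and \<open>r'\<close> differ only where they take the values
  \<open>i\<close> and \<open>j\<close>. Hence an orbit of \<open>r\<close>, \<open>t\<close> lies
  in a single orbit of \<open>r'\<close>, \<open>t\<close> or in the union of the orbits of
  \<open>i\<close> and \<open>j\<close>. At most one component is gained, and none if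
  \<open>i\<close> and \<open>j\<close> stay together.\<close>

lemma ncomp_transpose:
  assumes fin: "finite X" and r: "r permutes X" and t: "t permutes X"
    and ij: "i \<in> X" "j \<in> X"
  defines "r' \<equiv> transpose i j \<circ> r"
  shows "ncomp r' t X \<le> ncomp r t X + 1"
    and "i \<in> gen_orbit r' t j \<Longrightarrow> ncomp r' t X \<le> ncomp r t X"
proof -
  have r': "r' permutes X" unfolding r'_def using r ij by (simp add: permutes_compose permutes_swap_id)
  note e' = gen_orbit_eq[OF fin r' t]
  have rr: "r y = i \<and> r' y = j \<or> r y = j \<and> r' y = i \<or> r y = r' y" for y
    by (auto simp: r'_def transpose_def)
  let ?C = "gen_orbit r' t i \<union> gen_orbit r' t j"
  have sub: "gen_orbit r t x \<subseteq> (if x \<in> ?C then ?C else gen_orbit r' t x)" for x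
  proof (cases "x \<in> ?C")
    case True
    have "gen_orbit r t x \<subseteq> ?C"
    proof (rule gen_orbit_least)
      fix y assume "y \<in> ?C"
      then show "r y \<in> ?C" using rr[of y] gen_orbit_step1[of y r' t] by auto
    qed (use True gen_orbit_step2 in fast)+
    then show ?thesis using True by simp
  next
    case False
    have n: "i \<notin> gen_orbit r' t x" "j \<notin> gen_orbit r' t x" using False e' by auto
    have "gen_orbit r t x \<subseteq> gen_orbit r' t x"
    proof (rule gen_orbit_least)
      fix y assume "y \<in> gen_orbit r' t x"
      then show "r y \<in> gen_orbit r' t x" using rr[of y] gen_orbit_step1[of y r' t] n by metis
    qed (use gen_orbit_step2 in fast)+
    then show ?thesis using False by simp
  qed
  show "ncomp r' t X \<le> ncomp r t X" if "i \<in> gen_orbit r' t j"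
    unfolding ncomp_def
  proof (rule card_image_le_of_factor[OF fin])
    fix x y assume "gen_orbit r t x = gen_orbit r t y"
    then have "y \<in> gen_orbit r t x" by auto
    then have "y \<in> (if x \<in> ?C then ?C else gen_orbit r' t x)" using sub[of x] by blast
    moreover have "?C = gen_orbit r' t j" using e'[OF that] by blast
    ultimately have "y \<in> gen_orbit r' t x" using e'[of x j] by (metis (full_types))
    then show "gen_orbit r' t x = gen_orbit r' t y" using e' by metis
  qed
  have "card (gen_orbit r' t ` (X - gen_orbit r' t j)) \<le> card (gen_orbit r t ` (X - gen_orbit r' t j))"
  proof (rule card_image_le_of_factor)
    fix x y assume xy: "x \<in> X - gen_orbit r' t j" "y \<in> X - gen_orbit r' t j" "gen_orbit r t x = gen_orbit r t y"
    then have "y \<in> gen_orbit r t x" by auto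
    then have y: "y \<in> (if x \<in> ?C then ?C else gen_orbit r' t x)" using sub[of x] by blast
    have "y \<in> gen_orbit r' t x"
    proof (cases "x \<in> ?C")
      case True
      then have "x \<in> gen_orbit r' t i" "y \<in> gen_orbit r' t i" using y xy by auto
      then show ?thesis using e' by blast
    next
      case False
      then show ?thesis using y by simp
    qed
    then show "gen_orbit r' t x = gen_orbit r' t y" using e' by metis
  qed (use fin in simp)
  also have "\<dots> \<le> card (gen_orbit r t ` X)" by (rule card_mono) (use fin in auto)
  finally have 1: "card (gen_orbit r' t ` (X - gen_orbit r' t j)) \<le> card (gen_orbit r t ` X)" .
  have "gen_orbit r' t ` X \<subseteq> insert (gen_orbit r' t j) (gen_orbit r' t ` (X - gen_orbit r' t j))"
    using e' by auto
  then have "card (gen_orbit r' t ` X) \<le> card (insert (gen_orbit r' t j) (gen_orbit r' t ` (X - gen_orbit r' t j)))"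
    by (rule card_mono[rotated]) (use fin in auto)
  also have "\<dots> \<le> card (gen_orbit r' t ` (X - gen_orbit r' t j)) + 1"
    using fin by (simp add: card_insert_if)
  finally show "ncomp r' t X \<le> ncomp r t X + 1" unfolding ncomp_def using 1 by simp
qed

text \<open>Cutting an \<open>r\<close>-cycle gains one cycle of \<open>r\<close>. If a cycle of
  \<open>r \<circ> t\<close> is cut too, the two gains pay for a possible new component, which
  counts twice. If instead two cycles of \<open>r \<circ> t\<close> merge, then \<open>i\<close> and
  \<open>j\<close> remain connected, and the lost cycle is balanced by the gained one.\<close>

lemma defect_transpose:
  assumes fin: "finite X" and r: "r permutes X" and t: "t permutes X"
    and ij: "i \<in> X" "j \<in> X" "i \<in> cyc r j"
  shows "defect X (transpose i j \<circ> r) t \<le> defect X r t"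
proof (cases "i = j")
  case False
  let ?r = "transpose i j \<circ> r"
  have rt: "(r \<circ> t) permutes X" using r t by (rule permutes_compose[rotated])
  have r': "?r permutes X" using r ij by (simp add: permutes_compose permutes_swap_id)
  have eq: "?r \<circ> t = transpose i j \<circ> (r \<circ> t)" by (simp add: o_assoc)
  have 1: "norb ?r X = norb r X + 1" using norb_transpose_split[OF fin r] False ij by blast
  show ?thesis
  proof (cases "i \<in> cyc (r \<circ> t) j")
    case True
    then have "norb (?r \<circ> t) X = norb (r \<circ> t) X + 1"
      using norb_transpose_split[OF fin rt] False ij eq by metis
    moreover have "ncomp ?r t X \<le> ncomp r t X + 1"
      using ncomp_transpose(1)[OF fin r t ij(1,2)] .
    ultimately show ?thesis unfolding defect_def using 1 by simp
  next
    case F: False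
    then have "norb (r \<circ> t) X = norb (?r \<circ> t) X + 1"
      using norb_transpose_merge[OF fin rt ij(1,2)] eq by metis
    moreover have "i \<in> cyc (?r \<circ> t) j"
      using transpose_compose_cyc(2)[OF fin rt ij(1,2) F] by (simp add: eq)
    then have "i \<in> gen_orbit ?r t j" using cyc_compose_subset_gen_orbit by fast
    then have "ncomp ?r t X \<le> ncomp r t X" using ncomp_transpose(2)[OF fin r t ij(1,2)] by simp
    ultimately show ?thesis unfolding defect_def using 1 by simp
  qed
qed simp

lemma defect_commute:
  assumes fin: "finite X" and r: "r permutes X" and t: "t permutes X"
  shows "defect X r t = defect X t r"
  unfolding defect_def ncomp_def using norb_commute[OF assms] by (simp add: gen_orbit_commute)

lemma norb_remove_fixed:
  assumes fin: "finite X" and r: "r permutes X" and a: "a \<in> X" "r a = a"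
  shows "norb r X = norb r (X - {a}) + 1"
proof -
  have "cyc r ` X = insert {a} (cyc r ` (X - {a}))"
    using cyc_fixed[of r a] a by auto
  moreover have "{a} \<notin> cyc r ` (X - {a})" using cyc_self by fastforce
  ultimately show ?thesis unfolding norb_def using fin by simp
qed

text \<open>An isolated point contributes one element, one component and one cycle to each of the
  three permutations: 1 + 2 - 3 = 0.\<close>

lemma defect_remove_fixed:
  assumes fin: "finite X" and r: "r permutes X" and t: "t permutes X"
    and a: "a \<in> X" "r a = a" "t a = a"
  shows "defect (X - {a}) r t = defect X r t"
proof -
  have rt: "(r \<circ> t) permutes X" using r t by (rule permutes_compose[rotated])
  have "gen_orbit r t a \<subseteq> {a}" by (rule gen_orbit_least) (use a in auto)
  then have "gen_orbit r t a = {a}" using gen_orbit_self[of a r t] by blast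
  then have "gen_orbit r t ` X = insert {a} (gen_orbit r t ` (X - {a}))" using a by auto
  moreover have "{a} \<notin> gen_orbit r t ` (X - {a})" using gen_orbit_self by fastforce
  ultimately have "ncomp r t X = ncomp r t (X - {a}) + 1"
    unfolding ncomp_def using fin by simp
  moreover have "card X = card (X - {a}) + 1" using card.remove[OF fin a(1)] by simp
  ultimately show ?thesis unfolding defect_def
    using norb_remove_fixed[OF fin r] norb_remove_fixed[OF fin t] norb_remove_fixed[OF fin rt] a
    by simp
qed

section \<open>Deleting elements and first return maps\<close>

definition skip :: "'a \<Rightarrow> ('a \<Rightarrow> 'a) \<Rightarrow> 'a \<Rightarrow> 'a" where
  "skip a p = transpose a (p a) \<circ> p"

lemma skip_self [simp]: "skip a p a = a"
  by (simp add: skip_def)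

lemma skip_permutes:
  assumes "p permutes X" "a \<in> X"
  shows "skip a p permutes X"
  unfolding skip_def using assms
  by (simp add: permutes_compose permutes_swap_id permutes_in_image)

lemma skip_permutes_remove:
  assumes "p permutes X" "a \<in> X"
  shows "skip a p permutes (X - {a})"
proof -
  have "skip a p permutes X" using skip_permutes[OF assms] .
  then show ?thesis by (rule permutes_superset) auto
qed

lemma skip_apply:
  assumes "p permutes X" "y \<noteq> a"
  shows "skip a p y = (if p y = a then p a else p y)"
  using assms by (auto simp: skip_def transpose_def dest: permutes_inj injD)

lemma defect_skip1:
  assumes fin: "finite X" and r: "r permutes X" and t: "t permutes X" and a: "a \<in> X"
  shows "defect X (skip a r) t \<le> defect X r t"
  unfolding skip_def
proof (rule defect_transpose[OF fin r t])
  show "r a \<in> X" using r a by (simp add: permutes_in_image)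
  show "a \<in> cyc r (r a)" by (metis cyc_self cyc_step cyc_sym fin r)
qed (use a in auto)

lemma defect_skip:
  assumes fin: "finite X" and r: "r permutes X" and t: "t permutes X" and a: "a \<in> X"
  shows "defect (X - {a}) (skip a r) (skip a t) \<le> defect X r t"
proof -
  note s = skip_permutes[OF r a] skip_permutes[OF t a]
  have "defect (X - {a}) (skip a r) (skip a t) = defect X (skip a r) (skip a t)"
    using defect_remove_fixed[OF fin s a] by simp
  also have "\<dots> = defect X (skip a t) (skip a r)" using defect_commute[OF fin s] .
  also have "\<dots> \<le> defect X t (skip a r)" using defect_skip1[OF fin t s(1) a] .
  also have "\<dots> = defect X (skip a r) t" using defect_commute[OF fin t s(1)] .
  also have "\<dots> \<le> defect X r t" using defect_skip1[OF fin r t a] .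
  finally show ?thesis .
qed

text \<open>Describes the outcome of skipping elements one after another without mentioning the
  order in which they were skipped.\<close>

definition first_return :: "('a \<Rightarrow> 'a) \<Rightarrow> 'a set \<Rightarrow> ('a \<Rightarrow> 'a) \<Rightarrow> bool" where
  "first_return p Y q \<longleftrightarrow> q permutes Y \<and>
     (\<forall>y\<in>Y. \<exists>m>0. q y = (p ^^ m) y \<and> (\<forall>l. 0 < l \<and> l < m \<longrightarrow> (p ^^ l) y \<notin> Y))"

lemma first_return_refl: "p permutes X \<Longrightarrow> first_return p X p"
  unfolding first_return_def by (auto intro!: exI[of _ 1])

lemma first_return_skip:
  assumes q: "first_return p Y q" and a: "a \<in> Y"
  shows "first_return p (Y - {a}) (skip a q)"
  unfolding first_return_def
proof (intro conjI ballI)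
  have qY: "q permutes Y" using q unfolding first_return_def by simp
  show "skip a q permutes (Y - {a})" using skip_permutes_remove[OF qY a] .
  fix y assume y: "y \<in> Y - {a}"
  obtain m where m: "m > 0" "q y = (p ^^ m) y" "\<And>l. 0 < l \<Longrightarrow> l < m \<Longrightarrow> (p ^^ l) y \<notin> Y"
    using q y unfolding first_return_def by blast
  obtain n where n: "n > 0" "q a = (p ^^ n) a" "\<And>l. 0 < l \<Longrightarrow> l < n \<Longrightarrow> (p ^^ l) a \<notin> Y"
    using q a unfolding first_return_def by blast
  show "\<exists>m>0. skip a q y = (p ^^ m) y \<and> (\<forall>l. 0 < l \<and> l < m \<longrightarrow> (p ^^ l) y \<notin> Y - {a})"
  proof (cases "q y = a")
    case False
    then show ?thesis using m y skip_apply[OF qY, of y a] by (intro exI[of _ m]) auto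
  next
    case True
    have e: "(p ^^ (m + l)) y = (p ^^ l) a" for l
      using True m(2) by (simp add: add.commute funpow_add)
    have "skip a q y = (p ^^ (m + n)) y" using True y n(2) skip_apply[OF qY, of y a] e by auto
    moreover have "(p ^^ l) y \<notin> Y - {a}" if "0 < l" "l < m + n" for l
    proof (cases "l < m")
      case False
      then obtain k where k: "l = m + k" using le_Suc_ex not_less by blast
      then have "(p ^^ l) y = (p ^^ k) a" using e by simp
      then show ?thesis using n(3)[of k] that k by (cases "k = 0") auto
    qed (use m that in auto)
    ultimately show ?thesis using m(1) by (intro exI[of _ "m + n"]) auto
  qed
qed

text \<open>The monotonicity of the genus under passing to a submap: the elements outside
  \<open>Y\<close> are skipped one by one.\<close>

lemma defect_restrict:
  assumes fin: "finite X" and r: "r permutes X" and t: "t permutes X" and Y: "Y \<subseteq> X"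
  obtains r' t' where "first_return r Y r'" "first_return t Y t'" "defect Y r' t' \<le> defect X r t"
proof -
  have "finite (X - Y)" using fin by simp
  then have "\<exists>r' t'. first_return r (X - Z) r' \<and> first_return t (X - Z) t' \<and>
      defect (X - Z) r' t' \<le> defect X r t" if "Z = X - Y" "Z \<subseteq> X" for Z
    using that(2) unfolding that(1)[symmetric]
  proof (induction Z rule: finite_induct)
    case empty
    then show ?case using first_return_refl r t by auto
  next
    case (insert a Z)
    then obtain r' t' where IH: "first_return r (X - Z) r'" "first_return t (X - Z) t'"
      "defect (X - Z) r' t' \<le> defect X r t" by auto
    have a: "a \<in> X - Z" using insert by auto
    have e: "X - insert a Z = X - Z - {a}" by auto
    have "r' permutes (X - Z)" "t' permutes (X - Z)" using IH unfolding first_return_def by auto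
    then have "defect (X - insert a Z) (skip a r') (skip a t') \<le> defect X r t"
      using defect_skip[of "X - Z" r' t' a] a fin IH(3) e by fastforce
    then show ?case using first_return_skip[OF IH(1) a] first_return_skip[OF IH(2) a] e by metis
  qed
  moreover have "X - (X - Y) = Y" using Y by auto
  ultimately show ?thesis using that by (metis Diff_subset)
qed

lemma first_return_cyc:
  assumes fin: "finite X" and p: "p permutes X" and Y: "Y \<subseteq> X" and q: "first_return p Y q"
    and y: "y \<in> Y"
  shows "cyc q y = cyc p y \<inter> Y"
proof
  have qY: "q permutes Y" using q unfolding first_return_def by simp
  show "cyc q y \<subseteq> cyc p y \<inter> Y"
  proof (rule cyc_least)
    fix z assume z: "z \<in> cyc p y \<inter> Y"
    then obtain m where "q z = (p ^^ m) z" using q unfolding first_return_def by blast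
    moreover have "(p ^^ m) z \<in> cyc p y" using z cyc_trans[of z p y] cyc_pow[of m p z] by blast
    moreover have "q z \<in> Y" using z permutes_in_image[OF qY] by auto
    ultimately show "q z \<in> cyc p y \<inter> Y" by simp
  qed (use y in auto)
  have "(p ^^ n) y \<in> Y \<longrightarrow> (p ^^ n) y \<in> cyc q y" if "y \<in> Y" for n y
    using that
  proof (induction n arbitrary: y rule: less_induct)
    case (less n)
    obtain m where m: "m > 0" "q y = (p ^^ m) y" "\<And>l. 0 < l \<Longrightarrow> l < m \<Longrightarrow> (p ^^ l) y \<notin> Y"
      using q less.prems unfolding first_return_def by blast
    have qy: "q y \<in> Y" using less.prems permutes_in_image[OF qY] by auto
    show ?case
    proof (cases "n < m")
      case True
      then show ?thesis using m(3)[of n] by (cases "n = 0") auto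
    next
      case False
      then have e: "(p ^^ n) y = (p ^^ (n - m)) (q y)"
        using m(2) by (metis comp_apply funpow_add le_add_diff_inverse2 not_less)
      have "n - m < n" using m(1) False by simp
      then have "(p ^^ n) y \<in> Y \<longrightarrow> (p ^^ n) y \<in> cyc q (q y)" using less.IH qy e by metis
      moreover have "cyc q (q y) \<subseteq> cyc q y" by (intro cyc_trans cyc_step cyc_self)
      ultimately show ?thesis by blast
    qed
  qed
  then show "cyc p y \<inter> Y \<subseteq> cyc q y" using y unfolding cyc_def[of p] by blast
qed

text \<open>Deleting everything leaves defect 0, and deletion never raises the defect.\<close>

lemma defect_nonneg:
  assumes "finite X" "r permutes X" "t permutes X"
  shows "defect X r t \<ge> 0"
proof -
  obtain r' t' where "first_return r {} r'" "defect {} r' t' \<le> defect X r t"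
    by (rule defect_restrict[OF assms empty_subsetI]) blast
  then show ?thesis by (simp add: defect_def norb_def ncomp_def)
qed

section \<open>Odd colorings of noncrossing set families\<close>

definition odd_on :: "('a \<Rightarrow> nat) \<Rightarrow> 'a set \<Rightarrow> bool" where
  "odd_on c S \<longleftrightarrow> (\<forall>x. card {v \<in> S. c v = x} = 0 \<or> odd (card {v \<in> S. c v = x}))"

lemma odd_on_inj:
  assumes "inj_on c S"
  shows "odd_on c S"
  unfolding odd_on_def
proof
  fix x
  have "is_singleton {v \<in> S. c v = x}" if "{v \<in> S. c v = x} \<noteq> {}"
    using assms that by (intro is_singletonI') (auto simp: inj_on_def)
  then show "card {v \<in> S. c v = x} = 0 \<or> odd (card {v \<in> S. c v = x})"
    by (metis card.empty is_singleton_altdef odd_one)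
qed

lemma odd_on_cong: "(\<And>v. v \<in> S \<Longrightarrow> c v = c' v) \<Longrightarrow> odd_on c S = odd_on c' S"
  unfolding odd_on_def by (simp cong: conj_cong)

lemma odd_on_bij_betw:
  assumes "bij_betw f S T"
  shows "odd_on c T \<longleftrightarrow> odd_on (c \<circ> f) S"
proof -
  have "card {v \<in> T. c v = x} = card {v \<in> S. (c \<circ> f) v = x}" for x
  proof -
    have "bij_betw f {v \<in> S. (c \<circ> f) v = x} {v \<in> T. c v = x}"
      using assms unfolding bij_betw_def by (auto simp: inj_on_def)
    then show ?thesis using bij_betw_same_card by fastforce
  qed
  then show ?thesis unfolding odd_on_def by simp
qed

text \<open>Up to length 5 all entries can be chosen distinct. A longer list arises from one of
  length \<open>m - 4\<close> by putting its first two entries in front twice: both colours occur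
  already, and each count grows by 2.\<close>

lemma odd_path_coloring:
  fixes a b :: nat
  assumes ab: "a \<noteq> b" "a < 5" "b < 5"
  shows "m \<ge> 2 \<Longrightarrow> \<exists>xs. length xs = m \<and> hd xs = a \<and> last xs = b \<and> set xs \<subseteq> {..<5} \<and>
    successively (\<noteq>) xs \<and> (\<forall>x. count_list xs x = 0 \<or> odd (count_list xs x))"
proof (induction m rule: less_induct)
  case (less m)
  have "card ({..<5} - {a, b}) = 3" using ab by simp
  then obtain x y z where xyz: "{..<5} - {a, b} = {x, y, z}" "x \<noteq> y" "y \<noteq> z" "x \<noteq> z"
    by (auto simp: card_3_iff)
  then have i: "x \<in> {..<5} - {a, b}" "y \<in> {..<5} - {a, b}" "z \<in> {..<5} - {a, b}" by auto
  show ?case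
  proof (cases "m \<le> 5")
    case True
    then consider "m = 2" | "m = 3" | "m = 4" | "m = 5" using less.prems by linarith
    then show ?thesis
    proof cases
      case 1
      then show ?thesis using ab by (intro exI[of _ "[a, b]"]) auto
    next
      case 2
      then show ?thesis using ab i by (intro exI[of _ "[a, x, b]"]) auto
    next
      case 3
      then show ?thesis using ab i xyz(2-4) by (intro exI[of _ "[a, x, y, b]"]) auto
    next
      case 4
      then show ?thesis using ab i xyz(2-4) by (intro exI[of _ "[a, x, y, z, b]"]) auto
    qed
  next
    case False
    then obtain xs where xs: "length xs = m - 4" "hd xs = a" "last xs = b" "set xs \<subseteq> {..<5}"
      "successively (\<noteq>) xs" "\<forall>x. count_list xs x = 0 \<or> odd (count_list xs x)"
      using less.IH[of "m - 4"] False less.prems by fastforce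
    obtain q ys where q: "xs = a # q # ys"
      using xs(1,2) False by (cases xs; cases "tl xs") auto
    let ?zs = "a # q # a # q # xs"
    have "count_list ?zs x = 0 \<or> odd (count_list ?zs x)" for x
      using xs(6)[rule_format, of x] q by (auto split: if_splits)
    moreover have "length ?zs = m" using xs(1) False by simp
    ultimately show ?thesis using xs q by (intro exI[of _ ?zs]) auto
  qed
qed

text \<open>Prescribing two different colours at the ends allows adjacent intervals to be coloured
  independently and glued at their common point. The second premise, that a set with a point
  strictly inside the interval lies in it, is inherited by the subintervals at which the induction
  cuts.\<close>

lemma noncrossing_interval_coloring:
  fixes F :: "nat set set"
  assumes nc: "\<And>S S' p q r s. S \<in> F \<Longrightarrow> S' \<in> F \<Longrightarrow> S \<noteq> S' \<Longrightarrow> p \<in> S \<Longrightarrow> r \<in> S \<Longrightarrow>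
      q \<in> S' \<Longrightarrow> s \<in> S' \<Longrightarrow> p < q \<Longrightarrow> q < r \<Longrightarrow> r < s \<Longrightarrow> False"
  shows "i < j \<Longrightarrow> (\<And>S x. S \<in> F \<Longrightarrow> x \<in> S \<Longrightarrow> i < x \<Longrightarrow> x < j \<Longrightarrow> S \<subseteq> {i..j}) \<Longrightarrow>
    a \<noteq> b \<Longrightarrow> a < 5 \<Longrightarrow> b < 5 \<Longrightarrow>
    \<exists>c. c i = a \<and> c j = b \<and> (\<forall>x\<in>{i..j}. c x < (5::nat)) \<and> (\<forall>S\<in>F. S \<subseteq> {i..j} \<longrightarrow> odd_on c S)"
proof (induction "j - i" arbitrary: i j a b rule: less_induct)
  case less
  note ij = less.prems(1) and closed = less.prems(2) and ab = less.prems(3-5)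
  show ?case
  \<comment> \<open>First case: a set contains both ends and an interior point. Its points receive
    the colours of an odd path; consecutive ones differ, so the shorter gaps between them are
    coloured by induction.\<close>
  proof (cases "\<exists>S0\<in>F. i \<in> S0 \<and> j \<in> S0 \<and> S0 \<subseteq> {i..j} \<and> (\<exists>x\<in>S0. i < x \<and> x < j)")
    case True
    then obtain S0 x0 where S0: "S0 \<in> F" "i \<in> S0" "j \<in> S0" "S0 \<subseteq> {i..j}" "x0 \<in> S0" "i < x0" "x0 < j"
      by blast
    have fin: "finite S0" using S0(4) finite_subset by blast
    define L where "L = sorted_list_of_set S0"
    define m where "m = length L"
    have setL: "set L = S0" and sL: "sorted_wrt (<) L" unfolding L_def using fin by auto
    have less_L: "L ! t < L ! u" if "t < u" "u < m" for t u
      using sL that unfolding m_def by (simp add: sorted_wrt_iff_nth_less)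
    have L_in: "L ! t \<in> S0" if "t < m" for t using that setL unfolding m_def by auto
    have "card {i, x0, j} \<le> card S0" by (rule card_mono) (use fin S0 in auto)
    then have m3: "m \<ge> 3" using S0(6,7) unfolding m_def L_def by simp
    have ex_L: "\<exists>t<m. L ! t = x" if "x \<in> S0" for x
      using that setL unfolding m_def by (auto simp: in_set_conv_nth)
    have le_L: "L ! t \<le> L ! u" if "t \<le> u" "u < m" for t u
      using less_L[of t u] that by (cases "t = u") auto
    have L0: "L ! 0 = i"
    proof -
      obtain t where "t < m" "L ! t = i" using ex_L S0(2) by blast
      then have "L ! 0 \<le> i" using le_L[of 0 t] by simp
      then show ?thesis using L_in[of 0] m3 S0(4) by fastforce
    qed
    have Lm: "L ! (m - 1) = j"
    proof -
      obtain t where "t < m" "L ! t = j" using ex_L S0(3) by blast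
      then have "j \<le> L ! (m - 1)" using le_L[of t "m - 1"] by simp
      then show ?thesis using L_in[of "m - 1"] m3 S0(4) by fastforce
    qed
    obtain xs where xs: "length xs = m" "hd xs = a" "last xs = b" "set xs \<subseteq> {..<5}"
      "successively (\<noteq>) xs" "\<forall>x. count_list xs x = 0 \<or> odd (count_list xs x)"
      using odd_path_coloring[OF ab, of m] m3 by auto
    have xs_ne: "xs ! t \<noteq> xs ! Suc t" if "Suc t < m" for t
      using xs(1,5) that by (simp add: successively_conv_nth)
    have xs5: "xs ! t < 5" if "t < m" for t using xs(1,4) that by (metis lessThan_iff nth_mem subsetD)
    define gap where "gap t x \<longleftrightarrow> Suc t < m \<and> L ! t \<le> x \<and> x \<le> L ! Suc t" for t x
    have ex_gap: "\<exists>t. gap t x" if "i \<le> x" "x \<le> j" for x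
    proof -
      define T where "T = {t. Suc t < m \<and> L ! t \<le> x}"
      have T: "finite T" "0 \<in> T"
        unfolding T_def using m3 L0 that by (auto intro: finite_subset[of _ "{..<m}"])
      define t where "t = Max T"
      have t: "t \<in> T" unfolding t_def using T Max_in by blast
      have "x \<le> L ! Suc t"
      proof (cases "Suc (Suc t) < m")
        case True
        have "Suc t \<notin> T" using Max_ge[OF T(1), of "Suc t"] t_def by auto
        then show ?thesis using True unfolding T_def by simp
      next
        case False
        then have "Suc t = m - 1" using t unfolding T_def by auto
        then show ?thesis using Lm that by simp
      qed
      then show ?thesis using t unfolding T_def gap_def by blast
    qed
    \<comment> \<open>A set with a point strictly inside a gap cannot leave the gap, since it would
      cross \<open>S0\<close> at one of the ends of the gap.\<close>
    have strict_gap: "S \<subseteq> {L ! t..L ! Suc t}"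
      if S: "S \<in> F" "x \<in> S" and t: "Suc t < m" "L ! t < x" "x < L ! Suc t" for S x t
    proof
      fix y assume y: "y \<in> S"
      have "x \<notin> S0"
      proof
        assume "x \<in> S0"
        then obtain u where u: "u < m" "L ! u = x" using ex_L by blast
        then show False using le_L[of u t] le_L[of "Suc t" u] t by (cases "u \<le> t") auto
      qed
      then have ne: "S \<noteq> S0" using S by blast
      have in0: "L ! t \<in> S0" "L ! Suc t \<in> S0" using L_in t by auto
      have "\<not> y < L ! t"
        using nc[OF S(1) S0(1) ne y S(2) in0] t by blast
      moreover have "\<not> y > L ! Suc t"
        using nc[OF S0(1) S(1) ne[symmetric] in0 S(2) y] t by blast
      ultimately show "y \<in> {L ! t..L ! Suc t}" by simp
    qed
    have "\<exists>c. c (L ! t) = xs ! t \<and> c (L ! Suc t) = xs ! Suc t \<and>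
        (\<forall>x\<in>{L ! t..L ! Suc t}. c x < 5) \<and> (\<forall>S\<in>F. S \<subseteq> {L ! t..L ! Suc t} \<longrightarrow> odd_on c S)"
      if t: "Suc t < m" for t
    proof (rule less.hyps)
      have "i \<le> L ! t" "L ! Suc t \<le> j" using L_in[of t] L_in[of "Suc t"] t S0(4) by auto
      moreover have "L ! t \<noteq> i \<or> L ! Suc t \<noteq> j"
      proof (cases "t = 0")
        case True
        then have "Suc t < m - 1" using m3 by linarith
        then show ?thesis using less_L[of "Suc t" "m - 1"] Lm by simp
      next
        case False
        then show ?thesis using less_L[of 0 t] L0 t by simp
      qed
      moreover show lt: "L ! t < L ! Suc t" using less_L t by simp
      ultimately show "L ! Suc t - L ! t < j - i" by linarith
    qed (use strict_gap xs_ne xs5 t in auto)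
    then obtain cs where cs: "\<And>t. Suc t < m \<Longrightarrow> cs t (L ! t) = xs ! t"
      "\<And>t. Suc t < m \<Longrightarrow> cs t (L ! Suc t) = xs ! Suc t"
      "\<And>t x. Suc t < m \<Longrightarrow> x\<in>{L ! t..L ! Suc t} \<Longrightarrow> cs t x < 5"
      "\<And>t S. Suc t < m \<Longrightarrow> S \<in> F \<Longrightarrow> S \<subseteq> {L ! t..L ! Suc t} \<Longrightarrow> odd_on (cs t) S"
      by metis
    define c where "c x = cs (SOME t. gap t x) x" for x
    \<comment> \<open>Two gaps share at most an endpoint, where both colourings take the value from
      \<open>xs\<close>.\<close>
    have cs_eq: "cs t x = cs u x" if "gap t x" "gap u x" "t < u" for t u x
    proof -
      have g: "Suc t < m" "Suc u < m" "x \<le> L ! Suc t" "L ! u \<le> x"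
        using that unfolding gap_def by auto
      have "Suc t = u"
        using less_L[of "Suc t" u] g that(3) by (cases "Suc t = u") auto
      moreover have "x = L ! u" using g \<open>Suc t = u\<close> by simp
      ultimately show ?thesis using cs(1)[of u] cs(2)[of t] g by simp
    qed
    have c_eq: "c x = cs t x" if "gap t x" for t x
    proof -
      have "gap (SOME t. gap t x) x" using that by (rule someI)
      then show ?thesis unfolding c_def using cs_eq that by (metis linorder_neqE_nat)
    qed
    have cL: "c (L ! t) = xs ! t" if "t < m" for t
    proof (cases "Suc t < m")
      case True
      then have "gap t (L ! t)" using less_L[of t "Suc t"] unfolding gap_def by simp
      then show ?thesis using c_eq cs(1) True by simp
    next
      case False
      then obtain u where u: "t = Suc u" using that m3 by (cases t) auto
      then have "gap u (L ! t)" using less_L[of u t] that unfolding gap_def by simp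
      then show ?thesis using c_eq cs(2)[of u] that u by simp
    qed
    have ci: "c i = a" using cL[of 0] L0 xs(1,2) m3 by (metis hd_conv_nth length_greater_0_conv less_le_trans zero_less_numeral)
    have cj: "c j = b" using cL[of "m - 1"] Lm xs(1,3) m3
      by (metis diff_less last_conv_nth length_greater_0_conv less_le_trans zero_less_numeral zero_less_one)
    have "c x < 5" if x: "x \<in> {i..j}" for x
    proof -
      obtain t where "gap t x" using ex_gap[of x] x by auto
      then show ?thesis using c_eq cs(3) unfolding gap_def by auto
    qed
    moreover have "odd_on c S" if S: "S \<in> F" "S \<subseteq> {i..j}" for S
    proof (cases "S = S0")
      case True
      have "bij_betw ((!) L) {..<m} S0"
        using setL sL unfolding m_def
        by (intro bij_betw_nth) (auto simp: L_def)
      then have "odd_on c S0 = odd_on (c \<circ> (!) L) {..<m}" by (rule odd_on_bij_betw)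
      also have "\<dots> = odd_on ((!) xs) {..<m}" by (rule odd_on_cong) (use cL in auto)
      also have "\<dots>"
      proof -
        have "card {v \<in> {..<m}. xs ! v = x} = count_list xs x" for x
          using xs(1) by (simp add: count_list_eq_length_filter length_filter_conv_card eq_commute)
        then show ?thesis using xs(6) unfolding odd_on_def by simp
      qed
      finally show ?thesis using True by simp
    next
      case ne: False
      show ?thesis
      proof (cases "S \<subseteq> S0")
        case False
        then obtain x where x: "x \<in> S" "x \<notin> S0" by blast
        then obtain t where t: "gap t x" using ex_gap[of x] S(2) by fastforce
        then have "Suc t < m" unfolding gap_def by simp
        moreover have "L ! t \<noteq> x" "L ! Suc t \<noteq> x" using L_in x(2) \<open>Suc t < m\<close> by force+
        ultimately have sub: "S \<subseteq> {L ! t..L ! Suc t}"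
          using strict_gap[OF S(1) x(1)] t unfolding gap_def by simp
        have "odd_on c S = odd_on (cs t) S"
          by (rule odd_on_cong) (use sub c_eq \<open>Suc t < m\<close> in \<open>force simp: gap_def\<close>)
        then show ?thesis using cs(4) sub S(1) \<open>Suc t < m\<close> by simp
      next
        case True
        \<comment> \<open>Two points of \<open>S\<close> that are not consecutive in
          \<open>S0\<close> have a point of \<open>S0\<close> between them, and noncrossing then
          leaves only \<open>x = i\<close> and \<open>y = j\<close>. In either case the colours
          differ, so \<open>S\<close> is coloured injectively.\<close>
        have "c x \<noteq> c y" if xy: "x \<in> S" "y \<in> S" "x < y" for x y
        proof -
          obtain t u where t: "t < m" "L ! t = x" and u: "u < m" "L ! u = y"
            using ex_L xy True by (meson subsetD)
          have tu: "t < u" using t u xy le_L[of u t] by (cases "t < u") auto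
          show ?thesis
          proof (cases "Suc t = u")
            case True
            then show ?thesis using xs_ne[of t] cL t u by auto
          next
            case False
            let ?v = "L ! Suc t"
            have v: "?v \<in> S0" "x < ?v" "?v < y" using tu False t u less_L[of t "Suc t"] less_L[of "Suc t" u] L_in by auto
            have "\<not> i < x" using nc[OF S0(1) S(1) ne[symmetric] S0(2) v(1) xy(1,2)] v by blast
            moreover have "\<not> y < j" using nc[OF S(1) S0(1) ne xy(1,2) v(1) S0(3)] v by blast
            ultimately have "x = i" "y = j" using S(2) xy by force+
            then show ?thesis using ci cj ab by simp
          qed
        qed
        then have "inj_on c S" by (intro linorder_inj_onI) auto
        then show ?thesis by (rule odd_on_inj)
      qed
    qed
    ultimately show ?thesis using ci cj by blast
  next
    case noS0: False
    \<comment> \<open>Second case: no set joins \<open>i\<close>, \<open>j\<close> and an interior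
      point. The interval is cut at the largest interior point that shares a set with
      \<open>i\<close>; if there is none, \<open>i + 1\<close> serves as the cut.\<close>
    define M where "M = {m. i < m \<and> m < j \<and> (\<exists>S\<in>F. i \<in> S \<and> m \<in> S \<and> S \<subseteq> {i..j})}"
    show ?thesis
    proof (cases "j = Suc i")
      case True
      have "odd_on (\<lambda>x. if x = i then a else b) S" if "S \<subseteq> {i..j}" for S
      proof (rule odd_on_inj)
        have "S \<subseteq> {i, j}" using that True by force
        then show "inj_on (\<lambda>x. if x = i then a else b) S" using ab(1) by (auto simp: inj_on_def)
      qed
      then show ?thesis using True ab by (intro exI[of _ "\<lambda>x. if x = i then a else b"]) auto
    next
      case False
      define m where "m = (if M = {} then Suc i else Max M)"
      have finM: "finite M" unfolding M_def by (rule finite_subset[of _ "{..j}"]) auto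
      have mM: "m \<in> M" if "M \<noteq> {}" using Max_in[OF finM that] that unfolding m_def by simp
      have "i < m \<and> m < j"
      proof (cases "M = {}")
        case True
        then show ?thesis using ij False by (simp add: m_def)
      next
        case False
        then show ?thesis using mM unfolding M_def by blast
      qed
      then have m: "i < m" "m < j" by auto
      have Mm: "x \<le> m" if "x \<in> M" for x using Max_ge[OF finM that] that unfolding m_def by auto
      \<comment> \<open>A set that leaves on the right would cross the set through \<open>i\<close>
        and \<open>m\<close>, unless it is that set; but then it would contain a larger element of
        \<open>M\<close>, or both \<open>i\<close> and \<open>j\<close>.\<close>
      have sub1: "S \<subseteq> {i..m}" if S: "S \<in> F" "x \<in> S" "i < x" "x < m" for S x
      proof -
        have Sij: "S \<subseteq> {i..j}" using closed S m by auto
        have "M \<noteq> {}" using S m_def by (auto split: if_splits)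
        then obtain S1 where S1: "S1 \<in> F" "i \<in> S1" "m \<in> S1" "S1 \<subseteq> {i..j}"
          using mM unfolding M_def by blast
        have "y \<le> m" if y: "y \<in> S" for y
        proof (rule ccontr)
          assume "\<not> y \<le> m"
          then have ym: "m < y" by simp
          have "S1 = S" using nc[OF S1(1) S(1) _ S1(2,3) S(2) y S(3,4) ym] by blast
          have "y \<le> j" using y Sij by auto
          moreover have "y \<noteq> j" using noS0 S1 \<open>S1 = S\<close> y m by blast
          ultimately have "y \<in> M" using ym m S1 y \<open>S1 = S\<close> unfolding M_def by auto
          then show False using Mm ym by force
        qed
        then show ?thesis using Sij by force
      qed
      have sub2: "S \<subseteq> {m..j}" if S: "S \<in> F" "x \<in> S" "m < x" "x < j" for S x
      proof -
        have Sij: "S \<subseteq> {i..j}" using closed S m by auto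
        have xM: "x \<notin> M" using Mm S by force
        then have iS: "i \<notin> S" using S Sij m unfolding M_def by auto
        have "m \<le> y" if y: "y \<in> S" for y
        proof (rule ccontr)
          assume "\<not> m \<le> y"
          then have ym: "y < m" by simp
          have iy: "i < y" using y Sij iS by (metis atLeastAtMost_iff le_neq_implies_less subsetD)
          then have "S \<subseteq> {i..m}" using sub1 S(1) y ym by blast
          then show False using S by force
        qed
        then show ?thesis using Sij by force
      qed
      \<comment> \<open>The cut point needs a colour different from those of both ends, since both
        halves demand distinct end colours.\<close>
      have "card {a, b} < card {..<5::nat}" using card_insert_le_m1[of 2 "{b}" a] by simp
      then have "\<not> {..<5} \<subseteq> {a, b}" using card_mono[of "{a, b}" "{..<5}"] by auto
      then obtain d where d: "d < 5" "d \<noteq> a" "d \<noteq> b" by auto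
      obtain c1 where c1: "c1 i = a" "c1 m = d" "\<And>x. x\<in>{i..m} \<Longrightarrow> c1 x < 5"
        "\<And>S. S \<in> F \<Longrightarrow> S \<subseteq> {i..m} \<Longrightarrow> odd_on c1 S"
        using less.hyps[of m i a d] m sub1 d ab by (metis diff_less_mono less_imp_le)
      have ex2: "\<exists>c. c m = d \<and> c j = b \<and> (\<forall>x\<in>{m..j}. c x < 5) \<and> (\<forall>S\<in>F. S \<subseteq> {m..j} \<longrightarrow> odd_on c S)"
      proof (rule less.hyps)
        show "j - m < j - i" using m by simp
      qed (use sub2 m d ab in auto)
      obtain c2 where c2: "c2 m = d" "c2 j = b" "\<And>x. x\<in>{m..j} \<Longrightarrow> c2 x < 5"
        "\<And>S. S \<in> F \<Longrightarrow> S \<subseteq> {m..j} \<Longrightarrow> odd_on c2 S"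
        using ex2 by blast
      define c where "c x = (if x \<le> m then c1 x else c2 x)" for x
      have e2: "c x = c2 x" if "x \<ge> m" for x
        using that c1(2) c2(1) unfolding c_def by auto
      have "odd_on c S" if S: "S \<in> F" "S \<subseteq> {i..j}" for S
      proof -
        consider "S \<subseteq> {i..m}" | "S \<subseteq> {m..j}" | x y where "x \<in> S" "y \<in> S" "x < m" "m < y"
          using S(2) by (metis atLeastAtMost_iff not_le subsetD subsetI)
        then show ?thesis
        proof cases
          case 1
          then have "odd_on c S = odd_on c1 S" by (intro odd_on_cong) (auto simp: c_def)
          then show ?thesis using c1(4) S 1 by simp
        next
          case 2
          then have "odd_on c S = odd_on c2 S" by (intro odd_on_cong) (use e2 in auto)
          then show ?thesis using c2(4) S 2 by simp
        next
          case 3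
          \<comment> \<open>\<open>S\<close> has points on both sides of \<open>m\<close>. An
            interior point would confine it to one side, so only \<open>i\<close> and
            \<open>j\<close> remain, and these have different colours.\<close>
          have no1: "\<not> (i < z \<and> z < m)" if "z \<in> S" for z using sub1[OF S(1) that] 3 by force
          have no2: "\<not> (m < z \<and> z < j)" if "z \<in> S" for z using sub2[OF S(1) that] 3 by force
          have xi: "x = i" and yj: "y = j" using no1[OF 3(1)] no2[OF 3(2)] 3 S(2) by force+
          have "m \<notin> S" using noS0 S 3 xi yj m by blast
          have "z = i \<or> z = j" if z: "z \<in> S" for z
          proof -
            have "i \<le> z" "z \<le> j" "z \<noteq> m" using S(2) z \<open>m \<notin> S\<close> by auto
            then show ?thesis using no1[OF z] no2[OF z] by linarith
          qed
          then have sub: "S \<subseteq> {i, j}" by blast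
          have "c i \<noteq> c j" using c1(1) e2[of j] c2(2) m ab unfolding c_def by auto
          then have "inj_on c {i, j}" by auto
          then have "inj_on c S" using sub by (rule inj_on_subset)
          then show ?thesis by (rule odd_on_inj)
        qed
      qed
      moreover have "c i = a" "c j = b" using c1(1) e2[of j] c2(2) m unfolding c_def by auto
      moreover have "c x < 5" if "x \<in> {i..j}" for x using that c1(3) c2(3) unfolding c_def by auto
      ultimately show ?thesis by blast
    qed
  qed
qed

text \<open>The interval is extended to \<open>Suc N\<close>, a position outside every set, so that
  it has two different ends even for \<open>N = 0\<close>.\<close>

lemma noncrossing_coloring:
  fixes F :: "nat set set"
  assumes nc: "\<And>S S' p q r s. S \<in> F \<Longrightarrow> S' \<in> F \<Longrightarrow> S \<noteq> S' \<Longrightarrow> p \<in> S \<Longrightarrow> r \<in> S \<Longrightarrow>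
      q \<in> S' \<Longrightarrow> s \<in> S' \<Longrightarrow> p < q \<Longrightarrow> q < r \<Longrightarrow> r < s \<Longrightarrow> False"
    and bd: "\<And>S. S \<in> F \<Longrightarrow> S \<subseteq> {..<N}"
  obtains c :: "nat \<Rightarrow> nat" where "\<And>x. x < N \<Longrightarrow> c x < 5" "\<And>S. S \<in> F \<Longrightarrow> odd_on c S"
proof -
  have "\<exists>c. c 0 = 0 \<and> c (Suc N) = 1 \<and> (\<forall>x\<in>{0..Suc N}. c x < (5::nat)) \<and>
      (\<forall>S\<in>F. S \<subseteq> {0..Suc N} \<longrightarrow> odd_on c S)"
    by (rule noncrossing_interval_coloring[OF nc]) (use bd in fastforce)+
  then obtain c where c: "\<forall>x\<in>{0..Suc N}. c x < (5::nat)" "\<forall>S\<in>F. S \<subseteq> {0..Suc N} \<longrightarrow> odd_on c S"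
    by blast
  have "S \<subseteq> {0..Suc N}" if "S \<in> F" for S using bd[OF that] by force
  then show ?thesis using c that[of c] by auto
qed

section \<open>A 2-connected plane multigraph from a spherical hypermap\<close>

text \<open>The least element names a cycle by a natural number; the multigraph built below needs
  natural numbers as vertices.\<close>

definition lab :: "(nat \<Rightarrow> nat) \<Rightarrow> nat \<Rightarrow> nat" where
  "lab p e = Min (cyc p e)"

lemma lab_eq_iff:
  assumes "finite X" "p permutes X" "e \<in> X" "e' \<in> X"
  shows "lab p e = lab p e' \<longleftrightarrow> e' \<in> cyc p e"
proof
  have fin: "finite (cyc p x)" if "x \<in> X" for x
    using cyc_subset[OF assms(2) that] assms(1) finite_subset by blast
  assume l: "lab p e = lab p e'"
  have "lab p e \<in> cyc p e" "lab p e' \<in> cyc p e'"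
    unfolding lab_def using Min_in[OF fin[OF assms(3)]] Min_in[OF fin[OF assms(4)]] cyc_self
    by (metis empty_iff)+
  then have "cyc p e = cyc p e'" using cyc_eq[OF assms(1,2)] l by metis
  then show "e' \<in> cyc p e" by simp
next
  assume "e' \<in> cyc p e"
  then show "lab p e = lab p e'" unfolding lab_def using cyc_eq[OF assms(1,2)] by metis
qed

lemma card_image_eq_of_iff:
  assumes "finite X" "\<And>x y. x \<in> X \<Longrightarrow> y \<in> X \<Longrightarrow> f x = f y \<longleftrightarrow> g x = g y"
  shows "card (f ` X) = card (g ` X)"
  using card_image_le_of_factor[OF assms(1), of f g] card_image_le_of_factor[OF assms(1), of g f] assms(2)
  by (simp add: le_antisym)

lemma permutes_inv_o_apply [simp]:
  assumes "p permutes X"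
  shows "p (inv p x) = x" "inv p (p x) = x"
  using assms by (simp_all add: permutes_inverses)

text \<open>The vertex U e is the r-orbit of e, and W e is the new vertex in the face containing the corner
  after e. The dart hp e, with reverse hm e, is the segment from e to t e of the cycle around the
  t-orbit of e; the dart rp e, with reverse rm e, joins the corner after e to W e.\<close>

locale spherical_hypermap =
  fixes X :: "nat set" and r t :: "nat \<Rightarrow> nat"
  assumes fin: "finite X" and ne: "X \<noteq> {}" and r: "r permutes X" and t: "t permutes X"
    and conn: "\<And>x. x \<in> X \<Longrightarrow> gen_orbit r t x = X"
    and sph: "defect X r t = 0"
    and simple: "\<And>x y. x \<in> X \<Longrightarrow> y \<in> cyc t x \<Longrightarrow> y \<noteq> x \<Longrightarrow> y \<notin> cyc r x"
    and nontriv: "\<And>x. x \<in> X \<Longrightarrow> t x \<noteq> x"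
begin

text \<open>The inverse of \<open>t \<circ> r\<close>, so it has as many cycles as
  \<open>r \<circ> t\<close>. In this direction it is the rotation at the new face vertices.\<close>

definition f :: "nat \<Rightarrow> nat" where "f = inv r \<circ> inv t"

definition U :: "nat \<Rightarrow> nat" where "U e = 2 * lab r e"
definition W :: "nat \<Rightarrow> nat" where "W e = 2 * lab f e + 1"

definition hp :: "nat \<Rightarrow> nat" where "hp e = 4 * e"
definition hm :: "nat \<Rightarrow> nat" where "hm e = 4 * e + 1"
definition rp :: "nat \<Rightarrow> nat" where "rp e = 4 * e + 2"
definition rm :: "nat \<Rightarrow> nat" where "rm e = 4 * e + 3"

definition darts :: "nat set" where "darts = hp ` X \<union> hm ` X \<union> rp ` X \<union> rm ` X"

definition tl :: "nat \<Rightarrow> nat" where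
  "tl d = (let e = d div 4 in if d mod 4 = 0 then U e else if d mod 4 = 1 then U (t e)
     else if d mod 4 = 2 then U e else W e)"

definition al :: "nat \<Rightarrow> nat" where
  "al d = (let e = d div 4 in if d mod 4 = 0 then hm e else if d mod 4 = 1 then hp e
     else if d mod 4 = 2 then rm e else rp e)"

text \<open>Around \<open>U e\<close> the order is \<open>hp e\<close>, \<open>hm (inv t e)\<close>,
  \<open>rp e\<close>, \<open>hp (r e)\<close>, and so on. At each \<open>e\<close> the vertex thus
  sees the outgoing and the incoming segment of the cycle around the \<open>t\<close>-orbit of
  \<open>e\<close>, and then the spoke into the following corner.\<close>

definition sg :: "nat \<Rightarrow> nat" where
  "sg d = (let e = d div 4 in if d mod 4 = 0 then hm (inv t e) else if d mod 4 = 1 then rp (t e)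
     else if d mod 4 = 2 then hp (r e) else rm (f e))"

definition verts :: "nat set" where "verts = tl ` darts"

lemma dart_eq [simp]:
  "hp e = hp e' \<longleftrightarrow> e = e'" "hm e = hm e' \<longleftrightarrow> e = e'" "rp e = rp e' \<longleftrightarrow> e = e'" "rm e = rm e' \<longleftrightarrow> e = e'"
  "hp e \<noteq> hm e'" "hp e \<noteq> rp e'" "hp e \<noteq> rm e'" "hm e \<noteq> hp e'" "hm e \<noteq> rp e'" "hm e \<noteq> rm e'"
  "rp e \<noteq> hp e'" "rp e \<noteq> hm e'" "rp e \<noteq> rm e'" "rm e \<noteq> hp e'" "rm e \<noteq> hm e'" "rm e \<noteq> rp e'"
  unfolding hp_def hm_def rp_def rm_def by presburger+

lemma dart_simps [simp]:
  "tl (hp e) = U e" "tl (hm e) = U (t e)" "tl (rp e) = U e" "tl (rm e) = W e"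
  "al (hp e) = hm e" "al (hm e) = hp e" "al (rp e) = rm e" "al (rm e) = rp e"
  "sg (hp e) = hm (inv t e)" "sg (hm e) = rp (t e)" "sg (rp e) = hp (r e)" "sg (rm e) = rm (f e)"
proof -
  have "(4 * e + 1) div 4 = e" "(4 * e + 2) div 4 = e" "(4 * e + 3) div 4 = e"
    "(4 * e + 1) mod 4 = 1" "(4 * e + 2) mod 4 = 2" "(4 * e + 3) mod 4 = 3"
    by presburger+
  note * = this
  show "tl (hp e) = U e" "tl (hm e) = U (t e)" "tl (rp e) = U e" "tl (rm e) = W e"
    "al (hp e) = hm e" "al (hm e) = hp e" "al (rp e) = rm e" "al (rm e) = rp e"
    "sg (hp e) = hm (inv t e)" "sg (hm e) = rp (t e)" "sg (rp e) = hp (r e)" "sg (rm e) = rm (f e)"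
    unfolding tl_def al_def sg_def Let_def by (simp_all only: hp_def hm_def rp_def rm_def *) simp_all
qed

lemma f: "f permutes X"
  unfolding f_def using r t by (intro permutes_compose permutes_inv)

lemma perm_in [simp]:
  "r e \<in> X \<longleftrightarrow> e \<in> X" "t e \<in> X \<longleftrightarrow> e \<in> X" "f e \<in> X \<longleftrightarrow> e \<in> X" "inv r e \<in> X \<longleftrightarrow> e \<in> X"
  "inv t e \<in> X \<longleftrightarrow> e \<in> X"
  using permutes_in_image[OF r] permutes_in_image[OF t] permutes_in_image[OF f]
    permutes_in_image[OF permutes_inv[OF r]] permutes_in_image[OF permutes_inv[OF t]] by auto

lemmas inv_simps [simp] = permutes_inv_o_apply[OF r] permutes_inv_o_apply[OF t]

lemma f_apply: "f e = inv r (inv t e)"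
  by (simp add: f_def)

lemma dart_in [simp]:
  "hp e \<in> darts \<longleftrightarrow> e \<in> X" "hm e \<in> darts \<longleftrightarrow> e \<in> X" "rp e \<in> darts \<longleftrightarrow> e \<in> X" "rm e \<in> darts \<longleftrightarrow> e \<in> X"
  unfolding darts_def by auto

lemma dart_cases [consumes 1]:
  assumes "d \<in> darts"
  obtains e where "e \<in> X" "d = hp e" | e where "e \<in> X" "d = hm e"
    | e where "e \<in> X" "d = rp e" | e where "e \<in> X" "d = rm e"
  using assms unfolding darts_def by blast

lemma U_eq_iff: "e \<in> X \<Longrightarrow> e' \<in> X \<Longrightarrow> U e = U e' \<longleftrightarrow> e' \<in> cyc r e"
  unfolding U_def using lab_eq_iff[OF fin r] by simp

lemma W_eq_iff: "e \<in> X \<Longrightarrow> e' \<in> X \<Longrightarrow> W e = W e' \<longleftrightarrow> e' \<in> cyc f e"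
  unfolding W_def using lab_eq_iff[OF fin f] by simp

lemma U_neq_W [simp]: "U e \<noteq> W e'" "W e' \<noteq> U e"
  unfolding U_def W_def by presburger+

lemma U_r [simp]: "e \<in> X \<Longrightarrow> U (r e) = U e"
  using U_eq_iff[of e "r e"] by (simp add: cyc_step)

lemma U_inv_r [simp]: "e \<in> X \<Longrightarrow> U (inv r e) = U e"
  using U_r[of "inv r e"] by simp

lemma W_f [simp]: "e \<in> X \<Longrightarrow> W (f e) = W e"
  using W_eq_iff[of e "f e"] by (simp add: cyc_step)

lemma U_t_neq:
  assumes "x \<in> X" "y \<in> cyc t x" "y \<noteq> x"
  shows "U y \<noteq> U x"
  using simple[OF assms] U_eq_iff[of x y] assms cyc_subset[OF t assms(1)] by auto

lemma verts_eq: "verts = U ` X \<union> W ` X"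
proof -
  have "(\<lambda>e. U (t e)) ` X = U ` X" using permutes_image[OF t] by (metis image_image)
  then show ?thesis unfolding verts_def darts_def by (auto simp: image_Un image_image)
qed

lemma finite_darts: "finite darts"
  unfolding darts_def using fin by simp

lemma card_darts: "card darts = 4 * card X"
proof -
  have "card (hp ` X) = card X" "card (hm ` X) = card X" "card (rp ` X) = card X" "card (rm ` X) = card X"
    by (auto intro!: card_image inj_onI)
  then show ?thesis unfolding darts_def
    using fin by (subst card_Un_disjoint; auto)+
qed

lemma inj_sg: "inj_on sg darts"
proof (rule inj_onI)
  fix x y assume "x \<in> darts" "y \<in> darts" "sg x = sg y"
  then show "x = y"
    using permutes_inj[OF r] permutes_inj[OF t] permutes_inj[OF f] permutes_inj[OF permutes_inv[OF t]]
    by (elim dart_cases) (auto dest: injD)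
qed

lemma sg_in: "d \<in> darts \<Longrightarrow> sg d \<in> darts"
  by (elim dart_cases) auto

lemma al_in: "d \<in> darts \<Longrightarrow> al d \<in> darts"
  by (elim dart_cases) auto

lemma al_al: "d \<in> darts \<Longrightarrow> al (al d) = d \<and> al d \<noteq> d"
  by (elim dart_cases) auto

lemma hp_reach:
  assumes "e \<in> X" "e' \<in> cyc r e"
  shows "hp e' \<in> cyc sg (hp e)" "hm (inv t e') \<in> cyc sg (hp e)" "rp e' \<in> cyc sg (hp e)"
proof -
  have X: "cyc r e \<subseteq> X" using cyc_subset[OF r assms(1)] .
  have *: "hm (inv t e') \<in> cyc sg (hp e) \<and> rp e' \<in> cyc sg (hp e) \<and> hp (r e') \<in> cyc sg (hp e)"
    if "hp e' \<in> cyc sg (hp e)" for e'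
    using cyc_step[OF that] cyc_step[OF cyc_step[OF that]] cyc_step[OF cyc_step[OF cyc_step[OF that]]]
    by simp
  have "cyc r e \<subseteq> {e'. hp e' \<in> cyc sg (hp e)}"
    by (rule cyc_least) (use * in auto)
  then show "hp e' \<in> cyc sg (hp e)" using assms(2) by auto
  then show "hm (inv t e') \<in> cyc sg (hp e)" "rp e' \<in> cyc sg (hp e)" using * by auto
qed

lemma rm_reach: "e' \<in> cyc f e \<Longrightarrow> rm e' \<in> cyc sg (rm e)"
proof -
  have "cyc f e \<subseteq> {e'. rm e' \<in> cyc sg (rm e)}"
    by (rule cyc_least) (use cyc_step in force)+
  then show "e' \<in> cyc f e \<Longrightarrow> rm e' \<in> cyc sg (rm e)" by auto
qed

lemma sg_reach:
  assumes d: "d \<in> darts" "d' \<in> darts" "tl d = tl d'"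
  shows "d' \<in> cyc sg d"
proof -
  have hub: "\<exists>e0\<in>X. U e0 = U e \<and> hp e0 \<in> cyc sg d" if "e \<in> X" "d \<in> darts" "tl d = U e" for e d
    using that(2)
  proof (cases rule: dart_cases)
    case (1 x) then show ?thesis using that by auto
  next
    case (2 x)
    have "hp (r (t x)) \<in> cyc sg d" using cyc_step[OF cyc_step[OF cyc_self[of d sg]]] 2 by simp
    then show ?thesis using that 2 by (intro bexI[of _ "r (t x)"]) auto
  next
    case (3 x)
    have "hp (r x) \<in> cyc sg d" using cyc_step[OF cyc_self[of d sg]] 3 by simp
    then show ?thesis using that 3 by (intro bexI[of _ "r x"]) auto
  next
    case (4 x) then show ?thesis using that by auto
  qed
  have *: "d' \<in> cyc sg d" if e: "e \<in> X" "tl d = U e" and d': "\<And>e0. e0 \<in> X \<Longrightarrow> U e0 = U e \<Longrightarrow> d' \<in> cyc sg (hp e0)" for e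
  proof -
    obtain e0 where "e0 \<in> X" "U e0 = U e" "hp e0 \<in> cyc sg d" using hub[OF e(1) d(1) e(2)] by blast
    then show ?thesis using d'[of e0] cyc_trans[of "hp e0" sg d] by blast
  qed
  show ?thesis using d(2)
  proof (cases rule: dart_cases)
    case (1 e)
    have "hp e \<in> cyc sg (hp e0)" if "e0 \<in> X" "U e0 = U e" for e0
      using hp_reach(1)[of e0 e] U_eq_iff[of e0 e] that 1 by auto
    then show ?thesis using d(3) 1 by (intro *[of e]) auto
  next
    case (2 e)
    have "hm (inv t (t e)) \<in> cyc sg (hp e0)" if "e0 \<in> X" "U e0 = U (t e)" for e0
      using hp_reach(2)[of e0 "t e"] U_eq_iff[of e0 "t e"] that 2 by auto
    then show ?thesis using d(3) 2 by (intro *[of "t e"]) auto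
  next
    case (3 e)
    have "rp e \<in> cyc sg (hp e0)" if "e0 \<in> X" "U e0 = U e" for e0
      using hp_reach(3)[of e0 e] U_eq_iff[of e0 e] that 3 by auto
    then show ?thesis using d(3) 3 by (intro *[of e]) auto
  next
    case (4 e)
    then have "tl d = W e" using d(3) by simp
    with d(1) obtain x where "x \<in> X" "d = rm x" "W x = W e" by (cases rule: dart_cases) auto
    then show ?thesis using rm_reach W_eq_iff 4 by auto
  qed
qed

lemma comb_map: "comb_map verts darts tl al sg"
proof -
  have "bij_betw al darts darts"
    by (rule bij_betw_byWitness[where f' = al]) (use al_al al_in in auto)
  moreover have "bij_betw sg darts darts"
    using inj_sg sg_in finite_darts by (simp add: bij_betw_def endo_inj_surj image_subset_iff)
  moreover have "tl (sg d) = tl d" if "d \<in> darts" for d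
    using that by (cases rule: dart_cases) auto
  moreover have "\<exists>n. (sg ^^ n) d = d'" if "d \<in> darts" "d' \<in> darts" "tl d = tl d'" for d d'
    using sg_reach[OF that] unfolding cyc_def by auto
  ultimately show ?thesis unfolding comb_map_def using finite_darts al_al
    by (auto simp: verts_def)
qed

lemma loopless: "loopless_map darts tl al"
  unfolding loopless_map_def
proof
  fix d assume "d \<in> darts"
  moreover have "U (t e) \<noteq> U e" if "e \<in> X" for e
    using U_t_neq[OF that, of "t e"] nontriv[OF that] by (simp add: cyc_step)
  ultimately show "tl (al d) \<noteq> tl d" by (elim dart_cases) (auto dest: sym)
qed

text \<open>This is the inside of the cycle drawn around a \<open>t\<close>-orbit. Its corners are
  exactly the orbit, so facial oddness there is the condition wanted for one outside vertex.\<close>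

lemma face_hm: "cyc (sg \<circ> al) (hm e) = hm ` cyc t e"
proof -
  have "((sg \<circ> al) ^^ n) (hm e) = hm ((inv t ^^ n) e)" for n
    by (induction n) auto
  then have "cyc (sg \<circ> al) (hm e) = hm ` cyc (inv t) e" unfolding cyc_def by auto
  then show ?thesis using cyc_inv[OF fin t] by simp
qed

text \<open>Outside the cycles, the spokes cut the faces of the hypermap into triangles, one for
  each cycle segment.\<close>

lemma face_triangle:
  assumes "d \<in> {hp e, rp (t e), rm (inv r e)}"
  shows "cyc (sg \<circ> al) d = {hp e, rp (t e), rm (inv r e)}"
proof -
  have s: "(sg \<circ> al) (hp e) = rp (t e)" "(sg \<circ> al) (rp (t e)) = rm (inv r e)"
    "(sg \<circ> al) (rm (inv r e)) = hp e"
    by (simp_all add: f_apply)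
  have "cyc (sg \<circ> al) d \<subseteq> {hp e, rp (t e), rm (inv r e)}"
    by (rule cyc_least) (use s assms in auto)
  moreover have "{hp e, rp (t e), rm (inv r e)} \<subseteq> cyc (sg \<circ> al) d"
    using assms s cyc_self[of d "sg \<circ> al"] cyc_step[of _ "sg \<circ> al" d]
    by (metis (no_types, lifting) empty_subsetI insert_iff insert_subset singletonD)
  ultimately show ?thesis by blast
qed

lemma faces_eq:
  "map_faces darts al sg = (\<lambda>e. hm ` cyc t e) ` X \<union> (\<lambda>e. {hp e, rp (t e), rm (inv r e)}) ` X"
proof -
  let ?T = "\<lambda>e. {hp e, rp (t e), rm (inv r e)}"
  let ?F = "cyc (sg \<circ> al)"
  have "map_faces darts al sg = ?F ` darts" by (simp add: map_faces_def face_of_def cyc_def)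
  also have "\<dots> = ?F ` hp ` X \<union> ?F ` hm ` X \<union> ?F ` rp ` X \<union> ?F ` rm ` X"
    unfolding darts_def by (simp add: image_Un)
  also have "?F ` hp ` X = ?T ` X"
    using face_triangle by (simp add: image_image)
  also have "?F ` hm ` X = (\<lambda>e. hm ` cyc t e) ` X"
    by (simp add: image_image face_hm)
  also have "?F ` rp ` X = ?T ` X"
  proof -
    have "?F ` rp ` X = ?F ` rp ` t ` X" using permutes_image[OF t] by simp
    also have "\<dots> = ?T ` X" using face_triangle by (simp add: image_image)
    finally show ?thesis .
  qed
  also have "?F ` rm ` X = ?T ` X"
  proof -
    have "?F ` rm ` X = ?F ` rm ` inv r ` X" using permutes_image[OF permutes_inv[OF r]] by simp
    also have "\<dots> = ?T ` X" using face_triangle by (simp add: image_image)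
    finally show ?thesis .
  qed
  finally show ?thesis by auto
qed

text \<open>There are \<open>norb r X + norb f X\<close> vertices, \<open>2 * card X\<close> edges
  and \<open>norb t X + card X\<close> faces. With a single component, Euler's formula becomes the
  equation \<open>defect X r t = 0\<close>.\<close>

lemma genus0: "genus0_on verts darts al sg"
proof -
  have 1: "card (U ` X) = norb r X" unfolding norb_def
    by (rule card_image_eq_of_iff[OF fin]) (metis U_eq_iff cyc_eq_iff[OF fin r])
  have 2: "card (W ` X) = norb f X" unfolding norb_def
    by (rule card_image_eq_of_iff[OF fin]) (metis W_eq_iff cyc_eq_iff[OF fin f])
  have "U ` X \<inter> W ` X = {}" by auto
  then have V: "card verts = norb r X + norb f X"
    unfolding verts_eq using fin 1 2 by (simp add: card_Un_disjoint)
  have 3: "card ((\<lambda>e. hm ` cyc t e) ` X) = norb t X" unfolding norb_def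
    by (rule card_image_eq_of_iff[OF fin]) (simp add: inj_image_eq_iff inj_def)
  have 4: "card ((\<lambda>e. {hp e, rp (t e), rm (inv r e)}) ` X) = card X"
    by (rule card_image, rule inj_onI, drule equalityD1) simp
  have "(\<lambda>e. hm ` cyc t e) ` X \<inter> (\<lambda>e. {hp e, rp (t e), rm (inv r e)}) ` X = {}"
  proof -
    have "hm ` cyc t e \<noteq> {hp e', rp (t e'), rm (inv r e')}" for e e' by (metis dart_eq(5) imageE insertI1)
    then show ?thesis by blast
  qed
  then have F: "card (map_faces darts al sg) = norb t X + card X"
    unfolding faces_eq using fin 3 4 by (simp add: card_Un_disjoint)
  have "f = inv (t \<circ> r)" unfolding f_def
    using permutes_bij[OF r] permutes_bij[OF t] by (simp add: o_inv_distrib)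
  then have "norb f X = norb (t \<circ> r) X"
    unfolding norb_def using cyc_inv[OF fin permutes_compose[OF r t]] by simp
  then have 5: "norb f X = norb (r \<circ> t) X" using norb_commute[OF fin r t] by simp
  have "gen_orbit r t ` X = {X}" using conn ne by auto
  then have "ncomp r t X = 1" unfolding ncomp_def by simp
  then have "int (card X) + 2 = int (norb r X + norb t X + norb f X)"
    using sph 5 unfolding defect_def by simp
  then show ?thesis unfolding genus0_on_def V F card_darts by linarith
qed

lemma adj:
  assumes "e \<in> X"
  shows "map_adj darts tl al (U e) (U (t e))" "map_adj darts tl al (U e) (W e)" "map_adj darts tl al (W e) (U e)"
  unfolding map_adj_def using assms
  by (auto intro: bexI[of _ "hp e"] bexI[of _ "rp e"] bexI[of _ "rm e"])

lemma adj_sym: "map_adj darts tl al x y \<Longrightarrow> map_adj darts tl al y x"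
  unfolding map_adj_def using al_al al_in by metis

lemma connected_onI_hub:
  assumes "h \<in> S" "\<And>x. x \<in> S \<Longrightarrow> (\<lambda>x y. x \<in> S \<and> y \<in> S \<and> map_adj darts tl al x y)\<^sup>*\<^sup>* h x"
  shows "connected_on S (map_adj darts tl al)"
proof -
  let ?R = "\<lambda>x y. x \<in> S \<and> y \<in> S \<and> map_adj darts tl al x y"
  have "symp ?R" using adj_sym by (auto intro: sympI)
  then have "?R\<^sup>*\<^sup>* x h" if "x \<in> S" for x using assms(2)[OF that] by (metis symp_rtranclp sympD)
  then show ?thesis unfolding connected_on_def using assms(2) rtranclp_trans by fast
qed

text \<open>Stated for every \<open>S\<close> that contains all the \<open>U\<close> vertices, so
  that it covers the whole graph as well as the removal of a face vertex.\<close>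

lemma connected_U:
  assumes "U ` X \<subseteq> S" "S \<subseteq> verts"
  shows "connected_on S (map_adj darts tl al)"
proof -
  let ?R = "\<lambda>x y. x \<in> S \<and> y \<in> S \<and> map_adj darts tl al x y"
  obtain e where e: "e \<in> X" using ne by blast
  have "gen_orbit r t e \<subseteq> {x \<in> X. ?R\<^sup>*\<^sup>* (U e) (U x)}"
  proof (rule gen_orbit_least)
    fix y assume y: "y \<in> {x \<in> X. ?R\<^sup>*\<^sup>* (U e) (U x)}"
    then show "r y \<in> {x \<in> X. ?R\<^sup>*\<^sup>* (U e) (U x)}" by simp
    have "?R (U y) (U (t y))" using y adj assms by auto
    then show "t y \<in> {x \<in> X. ?R\<^sup>*\<^sup>* (U e) (U x)}" using y by (auto intro: rtranclp.rtrancl_into_rtrancl)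
  qed (use e in simp)
  then have Ux: "?R\<^sup>*\<^sup>* (U e) (U x)" if "x \<in> X" for x using conn[OF e] that by auto
  show ?thesis
  proof (rule connected_onI_hub[of "U e"])
    fix x assume x: "x \<in> S"
    then consider y where "y \<in> X" "x = U y" | y where "y \<in> X" "x = W y" using assms verts_eq by auto
    then show "?R\<^sup>*\<^sup>* (U e) x"
    proof cases
      case (2 y)
      then have "?R (U y) x" using adj x assms(1) by auto
      with Ux[OF 2(1)] show ?thesis by (rule rtranclp.rtrancl_into_rtrancl)
    qed (use Ux in auto)
  qed (use e assms in auto)
qed

text \<open>With \<open>U e0\<close> gone, the face vertices hold the graph together. Faces at
  consecutive corners of the removed vertex are separated there by one \<open>t\<close>-orbit, and
  the rest of the cycle around this orbit is a detour between them. By \<open>simple\<close> the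
  orbit visits \<open>U e0\<close> only once, so the detour survives.\<close>

lemma connected_remove_U:
  assumes e0: "e0 \<in> X"
  shows "connected_on (verts - {U e0}) (map_adj darts tl al)"
proof -
  define S where "S = verts - {U e0}"
  define R where "R x y \<longleftrightarrow> x \<in> S \<and> y \<in> S \<and> map_adj darts tl al x y" for x y
  have sym: "R\<^sup>*\<^sup>* x y \<Longrightarrow> R\<^sup>*\<^sup>* y x" for x y
  proof -
    have "symp R" unfolding R_def using adj_sym by (auto intro: sympI)
    then show "R\<^sup>*\<^sup>* x y \<Longrightarrow> R\<^sup>*\<^sup>* y x" by (metis symp_rtranclp sympD)
  qed
  have WS: "W e \<in> S" if "e \<in> X" for e using that unfolding S_def verts_eq by auto
  have US: "U e \<in> S" if "e \<in> X" "U e \<noteq> U e0" for e using that unfolding S_def verts_eq by auto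
  have RUW: "R (U e) (W e)" "R (W e) (U e)" if "e \<in> X" "U e \<noteq> U e0" for e
    using that adj WS US unfolding R_def by auto
  have RUU: "R (U e) (U (t e))" if "e \<in> X" "U e \<noteq> U e0" "U (t e) \<noteq> U e0" for e
    using that adj US unfolding R_def by auto
  have step_r: "R\<^sup>*\<^sup>* (W e) (W (r e))" if e: "e \<in> X" for e
  proof (cases "U e = U e0")
    case False
    then show ?thesis using RUW(2)[of e] RUW(1)[of "r e"] e
      by (metis U_r converse_rtranclp_into_rtranclp perm_in(1) r_into_rtranclp)
  next
    case True
    define x where "x = r e"
    have x: "x \<in> X" "U x = U e0" using e True unfolding x_def by auto
    obtain n0 where n0: "n0 > 0" "(t ^^ n0) x = x" using pow_period[OF fin t] by metis
    define N where "N = (LEAST n. n > 0 \<and> (t ^^ n) x = x)"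
    have N: "N > 0" "(t ^^ N) x = x" unfolding N_def using LeastI[of "\<lambda>n. n > 0 \<and> (t ^^ n) x = x"] n0 by auto
    have Nl: "(t ^^ n) x \<noteq> x" if "n > 0" "n < N" for n
      using not_less_Least[of n "\<lambda>n. n > 0 \<and> (t ^^ n) x = x"] that unfolding N_def by auto
    have N2: "N \<ge> 2" using N nontriv[OF x(1)] by (cases "N = 1") auto
    have inX: "(t ^^ n) x \<in> X" for n by (induction n) (use x in auto)
    have Un: "U ((t ^^ n) x) \<noteq> U e0" if "n > 0" "n < N" for n
      using U_t_neq[OF x(1) cyc_pow Nl[OF that]] x(2) by simp
    have path: "n < N - 1 \<Longrightarrow> R\<^sup>*\<^sup>* (U (t x)) (U ((t ^^ Suc n) x))" for n
    proof (induction n)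
      case (Suc n)
      have "R (U ((t ^^ Suc n) x)) (U (t ((t ^^ Suc n) x)))"
        using RUU[OF inX Un[of "Suc n"]] Un[of "Suc (Suc n)"] Suc.prems by simp
      then show ?case using Suc by (auto intro: rtranclp.rtrancl_into_rtrancl)
    qed simp
    have "t ((t ^^ (N - 1)) x) = x" using N by (metis Suc_diff_1 funpow.simps(2) o_apply)
    then have it: "inv t x = (t ^^ (N - 1)) x" by (metis inv_simps(4))
    have "R\<^sup>*\<^sup>* (U (t x)) (U (inv t x))" using path[of "N - 2"] N2 it
      by (metis (no_types, lifting) Suc_1 Suc_diff_Suc Suc_le_lessD diff_less_mono2 lessI)
    moreover have "f (t x) = e" by (simp add: f_apply x_def)
    then have "W (t x) = W e" using W_f[of "t x"] x by simp
    then have "R (W e) (U (t x))" using RUW(2)[of "t x"] x Un[of 1] N2 by simp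
    \<comment> \<open>The corner after \<open>f x\<close> belongs to the vertex
      \<open>U (inv t x)\<close> and lies in the same face as the corner after \<open>x\<close>; its
      spoke is the last edge of the detour.\<close>
    moreover have "R (U (inv t x)) (W x)"
    proof -
      have "U (f x) = U (inv t x)" using x by (simp add: f_apply)
      moreover have "W (f x) = W x" using x by simp
      ultimately have "U (f x) = U (inv t x)" "W (f x) = W x" by auto
      then show ?thesis using RUW(1)[of "f x"] x Un[of "N - 1"] it N2 by simp
    qed
    ultimately show ?thesis unfolding x_def
      by (meson converse_rtranclp_into_rtranclp rtranclp.rtrancl_into_rtrancl)
  qed
  have step_t: "R\<^sup>*\<^sup>* (W e) (W (t e))" if e: "e \<in> X" for e
  proof -
    have "r (f (t e)) = e" by (simp add: f_apply)
    then have "R\<^sup>*\<^sup>* (W (f (t e))) (W e)" using step_r[of "f (t e)"] e by simp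
    then show ?thesis using sym e by simp
  qed
  have "gen_orbit r t e0 \<subseteq> {x \<in> X. R\<^sup>*\<^sup>* (W e0) (W x)}"
  proof (rule gen_orbit_least)
    fix y assume y: "y \<in> {x \<in> X. R\<^sup>*\<^sup>* (W e0) (W x)}"
    then show "r y \<in> {x \<in> X. R\<^sup>*\<^sup>* (W e0) (W x)}" "t y \<in> {x \<in> X. R\<^sup>*\<^sup>* (W e0) (W x)}"
      using step_r[of y] step_t[of y] by auto
  qed (use e0 in simp)
  then have Wx: "R\<^sup>*\<^sup>* (W e0) (W x)" if "x \<in> X" for x using conn[OF e0] that by auto
  have "connected_on S (map_adj darts tl al)"
  proof (rule connected_onI_hub[of "W e0"])
    fix x assume x: "x \<in> S"
    then consider y where "y \<in> X" "x = U y" | y where "y \<in> X" "x = W y"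
      unfolding S_def verts_eq by auto
    then have "R\<^sup>*\<^sup>* (W e0) x"
    proof cases
      case (1 y)
      then have "R (W y) x" using RUW x unfolding S_def by auto
      with Wx[OF 1(1)] show ?thesis by (rule rtranclp.rtrancl_into_rtrancl)
    qed (use Wx in auto)
    then show "(\<lambda>x y. x \<in> S \<and> y \<in> S \<and> map_adj darts tl al x y)\<^sup>*\<^sup>* (W e0) x"
      unfolding R_def .
  qed (use e0 WS in auto)
  then show ?thesis unfolding S_def .
qed

lemma two_connected: "two_connected verts (map_adj darts tl al)"
  unfolding two_connected_def
proof (intro conjI ballI)
  obtain e where e: "e \<in> X" using ne by blast
  have "U (t e) \<noteq> U e" using U_t_neq[OF e, of "t e"] nontriv[OF e] by (simp add: cyc_step)
  then have "card {U (t e), U e, W e} = 3" by simp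
  moreover have "{U (t e), U e, W e} \<subseteq> verts" using e verts_eq by auto
  moreover have "finite verts" using verts_eq fin by simp
  ultimately show "3 \<le> card verts" by (metis card_mono)
  show "connected_on verts (map_adj darts tl al)" using connected_U verts_eq by auto
  fix x assume "x \<in> verts"
  then consider y where "y \<in> X" "x = U y" | y where "y \<in> X" "x = W y" using verts_eq by auto
  then show "connected_on (verts - {x}) (map_adj darts tl al)"
  proof cases
    case (1 y) then show ?thesis using connected_remove_U by simp
  next
    case (2 y) then show ?thesis using verts_eq by (intro connected_U) auto
  qed
qed

lemma plane: "two_conn_plane_multigraph verts darts tl al sg"
  unfolding two_conn_plane_multigraph_def using comb_map loopless two_connected genus0 by blast

text \<open>By \<open>simple\<close>, \<open>U\<close> is injective on a \<open>t\<close>-orbit, so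
  counting colours on the vertices of its face is the same as counting them on the orbit.\<close>

lemma coloring_of_pfo_col:
  assumes "pfo_col verts darts tl al sg c k"
  shows "(\<forall>x\<in>X. c (U x) < k \<and> odd_on (c \<circ> U) (cyc t x))"
proof
  fix x assume x: "x \<in> X"
  have "U x \<in> verts" using x verts_eq by auto
  then have "c (U x) < k" using assms unfolding pfo_col_def by auto
  moreover have "hm ` cyc t x \<in> map_faces darts al sg" using faces_eq x by auto
  then have "odd_on c (tl ` hm ` cyc t x)" using assms unfolding pfo_col_def odd_on_def by blast
  moreover have "tl ` hm ` cyc t x = U ` cyc t x"
  proof -
    have "t ` cyc t x = cyc t x"
    proof (intro equalityI subsetI)
      fix y assume "y \<in> cyc t x"
      then have "inv t y \<in> cyc t x" by (rule cyc_inv_step[OF fin t])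
      then have "t (inv t y) \<in> t ` cyc t x" by (rule imageI)
      then show "y \<in> t ` cyc t x" by simp
    qed (use cyc_step in fast)
    then show ?thesis by (simp add: image_image) (metis image_image)
  qed
  moreover have "bij_betw U (cyc t x) (U ` cyc t x)"
    unfolding bij_betw_def
  proof
    show "inj_on U (cyc t x)"
    proof (rule inj_onI)
      fix a b assume ab: "a \<in> cyc t x" "b \<in> cyc t x" "U a = U b"
      have "a \<in> X" using ab cyc_subset[OF t x] by auto
      moreover have "b \<in> cyc t a" using ab cyc_eq[OF fin t] by metis
      ultimately show "a = b" using U_t_neq ab by metis
    qed
  qed simp
  ultimately show "c (U x) < k \<and> odd_on (c \<circ> U) (cyc t x)" using odd_on_bij_betw by metis
qed

end

section \<open>Transport to maps on the natural numbers\<close>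

lemma cyc_transport:
  assumes r: "r permutes X" and r': "\<And>x. x \<in> X \<Longrightarrow> r' (g x) = g (r x)" and x: "x \<in> X"
  shows "cyc r' (g x) = g ` cyc r x"
proof -
  have "(r' ^^ n) (g x) = g ((r ^^ n) x) \<and> (r ^^ n) x \<in> X" for n
    by (induction n) (use x r' permutes_in_image[OF r] in auto)
  then show ?thesis unfolding cyc_def by auto
qed

lemma norb_transport:
  assumes fin: "finite X" and r: "r permutes X" and g: "inj_on g X"
    and r': "\<And>x. x \<in> X \<Longrightarrow> r' (g x) = g (r x)"
  shows "norb r' (g ` X) = norb r X"
proof -
  have "norb r' (g ` X) = card ((\<lambda>x. g ` cyc r x) ` X)"
    unfolding norb_def image_image 
    using cyc_transport[where g = g and r' = r' and r = r, OF r r'] by (simp cong: image_cong)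
  also have "\<dots> = norb r X" unfolding norb_def
    by (rule card_image_eq_of_iff[OF fin]) (simp add: inj_on_image_eq_iff[OF g] cyc_subset[OF r])
  finally show ?thesis .
qed

text \<open>An injective colouring is facially odd, so the \<open>LEAST\<close> in
  \<open>chi_pfo\<close> is attained.\<close>

lemma pfo_col_exists:
  fixes V :: "nat set"
  assumes "comb_map V D tlv al sg" "loopless_map D tlv al"
  shows "\<exists>c. pfo_col V D tlv al sg c (chi_pfo V D tlv al sg)"
  unfolding chi_pfo_def
proof (rule LeastI_ex)
  have fin: "finite V" "tlv ` D \<subseteq> V" using assms(1) unfolding comb_map_def by auto
  have "c \<in> V \<Longrightarrow> c < Suc (Max V)" for c using fin(1) by (simp add: le_imp_less_Suc)
  moreover have "odd_on (\<lambda>x. x) S" for S :: "nat set" by (rule odd_on_inj) simp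
  ultimately have "pfo_col V D tlv al sg (\<lambda>x. x) (Suc (Max V))"
    using assms(2) unfolding pfo_col_def loopless_map_def odd_on_def by (auto dest: not_sym)
  then show "\<exists>k c. pfo_col V D tlv al sg c k" by blast
qed

lemma chi_pfo_le_P:
  fixes V D :: "nat set"
  assumes "two_conn_plane_multigraph V D tlv al sg"
  shows "enat (chi_pfo V D tlv al sg) \<le> chi_pfo_P"
  unfolding chi_pfo_P_def by (rule SUP_upper2[of "(V, D, tlv, al, sg)"]) (use assms in auto)

lemma chi_pfo_le_Po:
  fixes V D :: "nat set"
  assumes "two_conn_outerplane_graph V D tlv al sg"
  shows "enat (chi_pfo V D tlv al sg) \<le> chi_pfo_Po"
  unfolding chi_pfo_Po_def by (rule SUP_upper2[of "(V, D, tlv, al, sg)"]) (use assms in auto)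

context spherical_hypermap
begin

lemma coloring:
  assumes k: "chi_pfo_P = enat k"
  obtains c :: "nat \<Rightarrow> nat" where "\<And>x. x \<in> X \<Longrightarrow> c x < k"
    "\<And>x y. x \<in> X \<Longrightarrow> y \<in> cyc r x \<Longrightarrow> c y = c x" "\<And>x. x \<in> X \<Longrightarrow> odd_on c (cyc t x)"
proof -
  obtain c where c: "pfo_col verts darts tl al sg c (chi_pfo verts darts tl al sg)"
    using pfo_col_exists comb_map loopless by blast
  have le: "chi_pfo verts darts tl al sg \<le> k" using chi_pfo_le_P[OF plane] unfolding k by simp
  note * = coloring_of_pfo_col[OF c]
  show ?thesis
  proof (rule that[of "c \<circ> U"])
    fix x y assume x: "x \<in> X" and y: "y \<in> cyc r x"
    then have "U y = U x" using U_eq_iff[of x y] cyc_subset[OF r x] by auto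
    then show "(c \<circ> U) y = (c \<circ> U) x" by simp
  next
    fix x assume "x \<in> X"
    then show "(c \<circ> U) x < k" "odd_on (c \<circ> U) (cyc t x)" using *[rule_format, of x] le by auto
  qed
qed

end

text \<open>\<open>chi_pfo_P\<close> ranges over maps on natural numbers only. The permutations are
  therefore copied along an injection into \<open>nat\<close>, and the colouring is pulled
  back.\<close>

lemma spherical_coloring:
  fixes X :: "'a set"
  assumes fin: "finite X" and ne: "X \<noteq> {}" and r: "r permutes X" and t: "t permutes X"
    and conn: "\<And>x. x \<in> X \<Longrightarrow> gen_orbit r t x = X"
    and sph: "defect X r t = 0"
    and simple: "\<And>x y. x \<in> X \<Longrightarrow> y \<in> cyc t x \<Longrightarrow> y \<noteq> x \<Longrightarrow> y \<notin> cyc r x"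
    and nontriv: "\<And>x. x \<in> X \<Longrightarrow> t x \<noteq> x"
    and k: "chi_pfo_P = enat k"
  obtains c :: "'a \<Rightarrow> nat" where "\<And>x. x \<in> X \<Longrightarrow> c x < k"
    "\<And>x y. x \<in> X \<Longrightarrow> y \<in> cyc r x \<Longrightarrow> c y = c x" "\<And>x. x \<in> X \<Longrightarrow> odd_on c (cyc t x)"
proof -
  obtain g :: "'a \<Rightarrow> nat" where g: "inj_on g X"
    using finite_imp_inj_to_nat_seg[OF fin] by metis
  define r' t' where "r' = map_permutation X g r" and "t' = map_permutation X g t"
  have r': "r' permutes g ` X" and t': "t' permutes g ` X"
    unfolding r'_def t'_def using map_permutation_permutes r t g by (auto simp: bij_betw_def)
  have r'x: "r' (g x) = g (r x)" and t'x: "t' (g x) = g (t x)" if "x \<in> X" for x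
    unfolding r'_def t'_def using map_permutation_apply g that by metis+
  note rX = permutes_in_image[OF r] and tX = permutes_in_image[OF t]
  have g_eq: "g x = g y \<longleftrightarrow> x = y" if "x \<in> X" "y \<in> X" for x y using g that by (auto simp: inj_on_def)
  have cr: "cyc r' (g x) = g ` cyc r x" and ct: "cyc t' (g x) = g ` cyc t x" if "x \<in> X" for x
    
    using cyc_transport[where g = g and r' = r', OF r r'x that]
      cyc_transport[where g = g and r' = t', OF t t'x that] by auto
  have conn': "gen_orbit r' t' (g x) = g ` X" if x: "x \<in> X" for x
  proof
    show "gen_orbit r' t' (g x) \<subseteq> g ` X" using gen_orbit_subset[OF r' t'] x by auto
    have "gen_orbit r t x \<subseteq> {y \<in> X. g y \<in> gen_orbit r' t' (g x)}"
    proof (rule gen_orbit_least)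
      fix y assume "y \<in> {y \<in> X. g y \<in> gen_orbit r' t' (g x)}"
      then show "r y \<in> {y \<in> X. g y \<in> gen_orbit r' t' (g x)}" "t y \<in> {y \<in> X. g y \<in> gen_orbit r' t' (g x)}"
        using gen_orbit_step1[of "g y" r' t' "g x"] gen_orbit_step2[of "g y" r' t' "g x"] r'x t'x rX tX by auto
    qed (use x in auto)
    then show "g ` X \<subseteq> gen_orbit r' t' (g x)" using conn[OF x] by auto
  qed
  have sph': "defect (g ` X) r' t' = 0"
  proof -
    have "gen_orbit r t ` X = {X}" "gen_orbit r' t' ` g ` X = {g ` X}"
      using conn conn' ne by (simp_all add: image_image image_constant_conv)
    then have "ncomp r' t' (g ` X) = ncomp r t X" unfolding ncomp_def by simp
    moreover have "norb (r' \<circ> t') (g ` X) = norb (r \<circ> t) X"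
      by (rule norb_transport[OF fin permutes_compose[OF t r] g]) (use r'x t'x tX in auto)
    moreover have "norb r' (g ` X) = norb r X" "norb t' (g ` X) = norb t X"
      using norb_transport[where r' = r', OF fin r g r'x] norb_transport[where r' = t', OF fin t g t'x] by auto
    ultimately show ?thesis using sph card_image[OF g] unfolding defect_def by simp
  qed
  have bij: "bij_betw g (cyc t x) (cyc t' (g x))" if x: "x \<in> X" for x
    unfolding ct[OF x] bij_betw_def using inj_on_subset[OF g cyc_subset[OF t x]] by simp
  interpret spherical_hypermap "g ` X" r' t'
  proof
    fix x y assume x: "x \<in> g ` X" and y: "y \<in> cyc t' x" "y \<noteq> x"
    obtain x0 where x0: "x0 \<in> X" "x = g x0" using x by auto
    obtain y0 where y0: "y0 \<in> cyc t x0" "y = g y0" using y ct x0 by auto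
    have "y0 \<in> X" using y0 cyc_subset[OF t x0(1)] by auto
    have "y0 \<notin> cyc r x0" using simple[OF x0(1) y0(1)] y x0 y0 by auto
    then show "y \<notin> cyc r' x" using cr[OF x0(1)] x0 y0 \<open>y0 \<in> X\<close> cyc_subset[OF r x0(1)] g_eq by auto
  next
    fix x assume "x \<in> g ` X"
    then show "t' x \<noteq> x" using nontriv t'x tX g_eq by auto
  qed (use fin ne r' t' conn' sph' in auto)
  obtain c where c: "\<And>x. x \<in> g ` X \<Longrightarrow> c x < k"
    "\<And>x y. x \<in> g ` X \<Longrightarrow> y \<in> cyc r' x \<Longrightarrow> c y = c x" "\<And>x. x \<in> g ` X \<Longrightarrow> odd_on c (cyc t' x)"
    using coloring[OF k] by blast
  show ?thesis
  proof (rule that[of "c \<circ> g"])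
    fix x assume x: "x \<in> X"
    then show "odd_on (c \<circ> g) (cyc t x)" using c(3)[of "g x"] odd_on_bij_betw[OF bij] by blast
  next
    fix x assume "x \<in> X"
    then show "(c \<circ> g) x < k" using c(1)[of "g x"] by simp
  next
    fix x y assume "x \<in> X" "y \<in> cyc r x"
    then show "(c \<circ> g) y = (c \<circ> g) x" using c(2)[of "g x" "g y"] cr[of x] by simp
  qed
qed

section \<open>The 5-cycle as a lower bound for outerplane graphs\<close>

lemma connected_on_path:
  assumes r: "symp r" and xs: "successively r xs"
  shows "connected_on (set xs) r"
proof -
  define R where "R x y \<longleftrightarrow> x \<in> set xs \<and> y \<in> set xs \<and> r x y" for x y
  have *: "y \<in> set ys \<Longrightarrow> set ys \<subseteq> set xs \<Longrightarrow> successively r ys \<Longrightarrow> R\<^sup>*\<^sup>* (hd ys) y" for y ys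
  proof (induction ys rule: induct_list012)
    case (3 a b zs)
    show ?case
    proof (cases "y = a")
      case False
      then have "R\<^sup>*\<^sup>* b y" using 3 by auto
      moreover have "R a b" using 3 unfolding R_def by auto
      ultimately show ?thesis by (simp add: converse_rtranclp_into_rtranclp)
    qed simp
  qed auto
  have "symp R" unfolding R_def using r by (auto intro!: sympI dest: sympD)
  then have "R\<^sup>*\<^sup>* x y" if "x \<in> set xs" "y \<in> set xs" for x y
    using *[OF that(1) _ xs] *[OF that(2) _ xs] by (metis rtranclp_trans subset_refl symp_rtranclp sympD)
  then show ?thesis unfolding connected_on_def R_def by blast
qed

text \<open>The 5-cycle: dart 2i leads from i to i+1, dart 2i+1 leads back.\<close>

definition pentagon_al :: "nat \<Rightarrow> nat" where
  "pentagon_al d = (if even d then d + 1 else d - 1)"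

definition pentagon_sg :: "nat \<Rightarrow> nat" where
  "pentagon_sg d = (if even d then (d + 9) mod 10 else (d + 1) mod 10)"

definition pentagon_tl :: "nat \<Rightarrow> nat" where
  "pentagon_tl d = ((d + 1) div 2) mod 5"

lemmas pentagon_defs = pentagon_al_def pentagon_sg_def pentagon_tl_def

lemma pentagon_sets: "{..<5} = {0, 1, 2, 3, 4::nat}" "{..<10} = {0, 1, 2, 3, 4, 5, 6, 7, 8, 9::nat}"
  by auto

lemma pentagon_comb_map: "comb_map {..<5} {..<10} pentagon_tl pentagon_al pentagon_sg"
proof -
  have "bij_betw pentagon_al {..<10} {..<10}"
    by (rule bij_betw_byWitness[where f' = pentagon_al]) (auto simp: pentagon_sets pentagon_al_def)
  moreover have "bij_betw pentagon_sg {..<10} {..<10}"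
    by (rule bij_betw_byWitness[where f' = pentagon_sg]) (auto simp: pentagon_sets pentagon_sg_def)
  moreover have "\<forall>d\<in>{..<10}. \<forall>d'\<in>{..<10}. pentagon_tl d = pentagon_tl d' \<longrightarrow> d' = d \<or> d' = pentagon_sg d"
    unfolding pentagon_sets by (simp add: pentagon_defs)
  then have "\<forall>d\<in>{..<10}. \<forall>d'\<in>{..<10}. pentagon_tl d = pentagon_tl d' \<longrightarrow> (\<exists>n. (pentagon_sg ^^ n) d = d')"
    by (metis funpow_0 funpow.simps(2) One_nat_def o_apply)
  moreover have "\<forall>d\<in>{..<10}. pentagon_tl (pentagon_sg d) = pentagon_tl d"
    "\<forall>d\<in>{..<10}. pentagon_al (pentagon_al d) = d \<and> pentagon_al d \<noteq> d"
    unfolding pentagon_sets by (simp_all add: pentagon_defs)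
  moreover have "pentagon_tl ` {..<10} \<subseteq> {..<5}" by (auto simp: pentagon_tl_def)
  ultimately show ?thesis unfolding comb_map_def by blast
qed

lemma pentagon_simple: "simple_map {..<10} pentagon_tl pentagon_al"
  unfolding simple_map_def loopless_map_def pentagon_sets by (simp add: pentagon_defs)

lemma pentagon_faces:
  "map_faces {..<10} pentagon_al pentagon_sg = {{0, 2, 4, 6, 8}, {1, 3, 5, 7, 9}}"
proof -
  let ?F = "pentagon_sg \<circ> pentagon_al"
  have F: "?F 0 = 2" "?F 2 = 4" "?F 4 = 6" "?F 6 = 8" "?F 8 = 0"
    "?F 1 = 9" "?F 9 = 7" "?F 7 = 5" "?F 5 = 3" "?F 3 = 1"
    by (simp_all add: pentagon_defs)
  note st = cyc_step[of _ ?F]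
  have even: "cyc ?F d = {0, 2, 4, 6, 8}" if "d \<in> {0, 2, 4, 6, 8}" for d
  proof
    show "cyc ?F d \<subseteq> {0, 2, 4, 6, 8}"
      by (rule cyc_least) (use that F in auto)
    have "(0 \<in> cyc ?F d \<longrightarrow> 2 \<in> cyc ?F d) \<and> (2 \<in> cyc ?F d \<longrightarrow> 4 \<in> cyc ?F d) \<and> (4 \<in> cyc ?F d \<longrightarrow> 6 \<in> cyc ?F d)
      \<and> (6 \<in> cyc ?F d \<longrightarrow> 8 \<in> cyc ?F d) \<and> (8 \<in> cyc ?F d \<longrightarrow> 0 \<in> cyc ?F d)"
      using st[of 0 d] st[of 2 d] st[of 4 d] st[of 6 d] st[of 8 d] F by simp
    then show "{0, 2, 4, 6, 8} \<subseteq> cyc ?F d" using cyc_self[of d ?F] that by blast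
  qed
  have odd: "cyc ?F d = {1, 3, 5, 7, 9}" if "d \<in> {1, 3, 5, 7, 9}" for d
  proof
    show "cyc ?F d \<subseteq> {1, 3, 5, 7, 9}"
      by (rule cyc_least) (use that F in auto)
    have "(1 \<in> cyc ?F d \<longrightarrow> 9 \<in> cyc ?F d) \<and> (9 \<in> cyc ?F d \<longrightarrow> 7 \<in> cyc ?F d) \<and> (7 \<in> cyc ?F d \<longrightarrow> 5 \<in> cyc ?F d)
      \<and> (5 \<in> cyc ?F d \<longrightarrow> 3 \<in> cyc ?F d) \<and> (3 \<in> cyc ?F d \<longrightarrow> 1 \<in> cyc ?F d)"
      using st[of 1 d] st[of 3 d] st[of 5 d] st[of 7 d] st[of 9 d] F by simp
    then show "{1, 3, 5, 7, 9} \<subseteq> cyc ?F d" using cyc_self[of d ?F] that by blast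
  qed
  have "map_faces {..<10} pentagon_al pentagon_sg = cyc ?F ` {..<10}"
    by (simp add: map_faces_def face_of_def cyc_def)
  also have "\<dots> = cyc ?F ` {0, 2, 4, 6, 8} \<union> cyc ?F ` {1, 3, 5, 7, 9}"
    unfolding pentagon_sets image_Un[symmetric] by (rule arg_cong[where f = "image _"]) auto
  also have "cyc ?F ` {0, 2, 4, 6, 8} = {{0, 2, 4, 6, 8}}" using even by (simp del: o_apply)
  also have "cyc ?F ` {1, 3, 5, 7, 9} = {{1, 3, 5, 7, 9}}" using odd by (simp del: o_apply)
  finally show ?thesis by auto
qed

lemma pentagon_two_connected:
  "two_connected {..<5} (map_adj {..<10} pentagon_tl pentagon_al)"
proof -
  let ?r = "map_adj {..<10} pentagon_tl pentagon_al"
  have a: "?r 0 1" "?r 1 2" "?r 2 3" "?r 3 4" "?r 4 0"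
    unfolding map_adj_def pentagon_sets by (simp_all add: pentagon_defs)
  have sym: "symp ?r"
    unfolding map_adj_def using pentagon_comb_map unfolding comb_map_def
    by (intro sympI) (metis bij_betwE)
  have "connected_on {..<5} ?r"
    using connected_on_path[OF sym, of "[0, 1, 2, 3, 4]"] a by (simp add: pentagon_sets)
  moreover have "connected_on ({..<5} - {x}) ?r" if "x \<in> {..<5}" for x
  proof -
    have "{..<5::nat} - {0} = {1, 2, 3, 4}" "{..<5::nat} - {1} = {2, 3, 4, 0}" "{..<5::nat} - {2} = {3, 4, 0, 1}"
      "{..<5::nat} - {3} = {4, 0, 1, 2}" "{..<5::nat} - {4} = {0, 1, 2, 3}"
      unfolding pentagon_sets by auto
    then have "connected_on ({..<5} - {0}) ?r" "connected_on ({..<5} - {1}) ?r" "connected_on ({..<5} - {2}) ?r"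
      "connected_on ({..<5} - {3}) ?r" "connected_on ({..<5} - {4}) ?r"
      using connected_on_path[OF sym, of "[1, 2, 3, 4]"] connected_on_path[OF sym, of "[2, 3, 4, 0]"]
        connected_on_path[OF sym, of "[3, 4, 0, 1]"] connected_on_path[OF sym, of "[4, 0, 1, 2]"]
        connected_on_path[OF sym, of "[0, 1, 2, 3]"] a by simp_all
    then show ?thesis using that unfolding pentagon_sets by blast
  qed
  ultimately show ?thesis unfolding two_connected_def by simp
qed

lemma pentagon_outerplane:
  "two_conn_outerplane_graph {..<5} {..<10} pentagon_tl pentagon_al pentagon_sg"
proof -
  have "{0, 2, 4, 6, 8} \<noteq> {1, 3, 5, 7, 9::nat}" by (metis insertI1 insert_iff one_neq_zero singletonD zero_neq_numeral)
  then have "genus0_on {..<5::nat} {..<10} pentagon_al pentagon_sg"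
    unfolding genus0_on_def pentagon_faces by simp
  moreover have "pentagon_tl ` {0, 2, 4, 6, 8} = {..<5}"
    unfolding pentagon_sets by (auto simp: pentagon_tl_def)
  ultimately show ?thesis
    using pentagon_comb_map pentagon_simple pentagon_two_connected pentagon_faces
    unfolding two_conn_outerplane_graph_def two_conn_plane_multigraph_def simple_map_def by blast
qed

lemma odd_on_no_pair:
  assumes "odd_on c S" "a \<noteq> b" "{v \<in> S. c v = c a} = {a, b}"
  shows False
  using assms(1)[unfolded odd_on_def, rule_format, of "c a"] assms(2,3) by simp

text \<open>A colour class of the 5-cycle is independent, so it has at most two vertices: any third
  vertex is adjacent to one of two nonadjacent ones. The face through all five vertices forbids
  classes of size two, hence all colours are distinct.\<close>

lemma chi_pfo_Po_ge_5: "enat 5 \<le> chi_pfo_Po"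
proof -
  let ?k = "chi_pfo {..<5} {..<10} pentagon_tl pentagon_al pentagon_sg"
  have loopless: "loopless_map {..<10} pentagon_tl pentagon_al"
    using pentagon_simple unfolding simple_map_def by simp
  obtain c where c: "pfo_col {..<5} {..<10} pentagon_tl pentagon_al pentagon_sg c ?k"
    using pfo_col_exists[OF pentagon_comb_map loopless] by blast
  have "\<forall>d\<in>{..<10}. c (pentagon_tl d) \<noteq> c (pentagon_tl (pentagon_al d))" using c unfolding pfo_col_def by simp
  then have n: "c 0 \<noteq> c 1" "c 1 \<noteq> c 2" "c 2 \<noteq> c 3" "c 3 \<noteq> c 4" "c 4 \<noteq> c 0"
    unfolding pentagon_sets by (auto simp: pentagon_defs)
  have "odd_on c (pentagon_tl ` {0, 2, 4, 6, 8})"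
    using c unfolding pfo_col_def pentagon_faces odd_on_def by simp
  moreover have "pentagon_tl ` {0, 2, 4, 6, 8} = {..<5}"
    unfolding pentagon_sets by (auto simp: pentagon_tl_def)
  ultimately have odd: "odd_on c {0, 1, 2, 3, 4}" by (simp add: pentagon_sets)
  have no: "c a \<noteq> c b" if "a \<noteq> b" "c a = c b \<Longrightarrow> {v \<in> {0, 1, 2, 3, 4}. c v = c a} = {a, b}" for a b
    by (rule notI) (rule odd_on_no_pair[OF odd that(1) that(2)])
  have "c 0 \<noteq> c 2" by (rule no) (use n n[symmetric] in auto)
  moreover have "c 1 \<noteq> c 3" by (rule no) (use n n[symmetric] in auto)
  moreover have "c 2 \<noteq> c 4" by (rule no) (use n n[symmetric] in auto)
  moreover have "c 3 \<noteq> c 0" by (rule no) (use n n[symmetric] in auto)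
  moreover have "c 4 \<noteq> c 1" by (rule no) (use n n[symmetric] in auto)
  ultimately have "inj_on c {..<5}" unfolding pentagon_sets using n by (simp add: eq_commute)
  moreover have "c ` {..<5} \<subseteq> {..<?k}" using c unfolding pfo_col_def by simp
  ultimately have "card {..<5::nat} \<le> card {..<?k}" by (metis card_inj_on_le finite_lessThan)
  then have "5 \<le> ?k" by simp
  then have "enat 5 \<le> enat ?k" by simp
  also have "\<dots> \<le> chi_pfo_Po" using chi_pfo_le_Po[OF pentagon_outerplane] .
  finally show ?thesis .
qed

section \<open>Crossing curves in the stellated map\<close>

lemma cyc_apply:
  assumes "finite X" "p permutes X"
  shows "cyc p (p x) = cyc p x"
  using cyc_eq[OF assms cyc_step[OF cyc_self]] .

lemma first_return_next:
  assumes "first_return p Y q" "y \<in> Y" "m > 0" "(p ^^ m) y \<in> Y"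
    "\<And>l. 0 < l \<Longrightarrow> l < m \<Longrightarrow> (p ^^ l) y \<notin> Y"
  shows "q y = (p ^^ m) y"
proof -
  obtain n where n: "n > 0" "q y = (p ^^ n) y" "\<And>l. 0 < l \<Longrightarrow> l < n \<Longrightarrow> (p ^^ l) y \<notin> Y"
    using assms(1,2) unfolding first_return_def by blast
  have "q y \<in> Y" using assms(1,2) unfolding first_return_def by (simp add: permutes_in_image)
  then have "\<not> n < m" using assms(5)[of n] n by auto
  moreover have "\<not> m < n" using n(3)[of m] assms by auto
  ultimately show ?thesis using n(2) by (metis linorder_neqE_nat)
qed

lemma first_return_pair:
  assumes "finite X" "p permutes X" "Y \<subseteq> X" "first_return p Y q" "y \<in> Y" "y' \<noteq> y"
    "cyc p y \<inter> Y = {y, y'}"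
  shows "q y = y'" "q y' = y"
proof -
  have q: "q permutes Y" using assms(4) unfolding first_return_def by simp
  have c: "cyc q y = {y, y'}" using first_return_cyc[OF assms(1-5)] assms(7) by simp
  have "q y \<in> {y, y'}" using c cyc_step[OF cyc_self] by metis
  moreover have "q y \<noteq> y" using cyc_fixed[of q y] c assms(6) by auto
  ultimately show 1: "q y = y'" by simp
  have "q y' \<in> {y, y'}" using c cyc_step[of y' q y] by simp
  moreover have "q y' \<noteq> y'"
  proof
    assume "q y' = y'"
    then have "q y' = q y" using 1 by simp
    then show False using q assms(6) by (meson injD permutes_inj)
  qed
  ultimately show "q y' = y" by simp
qed

lemma card_le_length: "A \<subseteq> set xs \<Longrightarrow> card A \<le> length xs"
  by (meson card_length card_mono finite_set order_trans)

text \<open>Two closed curves through a common vertex z that cross there: the map with six further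
  vertices has a single face, hence genus 1.\<close>

lemma crossing_defect:
  assumes dist: "distinct [za, zb, zc, zd, aw, wa, wc, cw, bv, vb, vd, dv]"
  defines "Y \<equiv> {za, zb, zc, zd, aw, wa, wc, cw, bv, vb, vd, dv}"
  assumes r: "r permutes Y" and t: "t permutes Y"
    and r_eq: "r za = aw" "r aw = za" "r wa = wc" "r wc = wa" "r zc = cw" "r cw = zc"
      "r zb = bv" "r bv = zb" "r vb = vd" "r vd = vb" "r zd = dv" "r dv = zd"
    and t_eq: "t za = zb" "t zb = zc" "t zc = zd" "t zd = za"
      "t aw = wa" "t wa = aw" "t wc = cw" "t cw = wc" "t bv = vb" "t vb = bv" "t vd = dv" "t dv = vd"
  shows "defect Y r t > 0"
proof -
  have fin: "finite Y" unfolding Y_def by simp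
  have cY: "card Y = 12" unfolding Y_def using dist by simp
  have rt: "(r \<circ> t) permutes Y" using permutes_compose[OF t r] .
  note cr = cyc_apply[OF fin r] and ct = cyc_apply[OF fin t] and crt = cyc_apply[OF fin rt]
  have "cyc r aw = cyc r za" "cyc r wc = cyc r wa" "cyc r cw = cyc r zc" "cyc r bv = cyc r zb"
    "cyc r vd = cyc r vb" "cyc r dv = cyc r zd"
    using cr[of za] cr[of wa] cr[of zc] cr[of zb] cr[of vb] cr[of zd] r_eq by simp_all
  then have "cyc r ` Y \<subseteq> set [cyc r za, cyc r wa, cyc r zc, cyc r zb, cyc r vb, cyc r zd]"
    unfolding Y_def by simp
  from card_le_length[OF this] have 1: "norb r Y \<le> 6" unfolding norb_def by simp
  have "cyc t zb = cyc t za" "cyc t zc = cyc t za" "cyc t zd = cyc t za" "cyc t wa = cyc t aw"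
    "cyc t cw = cyc t wc" "cyc t vb = cyc t bv" "cyc t dv = cyc t vd"
    using ct[of za] ct[of zb] ct[of zc] ct[of aw] ct[of wc] ct[of bv] ct[of vd] t_eq by simp_all
  then have "cyc t ` Y \<subseteq> set [cyc t za, cyc t aw, cyc t wc, cyc t bv, cyc t vd]"
    unfolding Y_def by simp
  from card_le_length[OF this] have 2: "norb t Y \<le> 5" unfolding norb_def by simp
  let ?c = "cyc (r \<circ> t)"
  have "?c bv = ?c za" "?c vd = ?c bv" "?c zd = ?c vd" "?c aw = ?c zd" "?c wc = ?c aw" "?c zc = ?c wc"
    "?c dv = ?c zc" "?c vb = ?c dv" "?c zb = ?c vb" "?c cw = ?c zb" "?c wa = ?c cw"
    using crt[of za] crt[of bv] crt[of vd] crt[of zd] crt[of aw] crt[of wc] crt[of zc] crt[of dv]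
      crt[of vb] crt[of zb] crt[of cw] r_eq t_eq by simp_all
  then have "?c ` Y \<subseteq> set [?c za]" unfolding Y_def by simp
  from card_le_length[OF this] have 3: "norb (r \<circ> t) Y \<le> 1" unfolding norb_def by simp
  have "gen_orbit r t ` Y \<noteq> {}" unfolding Y_def by simp
  then have 4: "ncomp r t Y \<ge> 1" unfolding ncomp_def using fin by (simp add: Suc_le_eq card_gt_0_iff)
  show ?thesis unfolding defect_def using 1 2 3 4 cY by linarith
qed

text \<open>Stellation: a new vertex is placed into every face and joined to all its corners, the
  corner after x being represented by Inr x. As a bipartite map (vertices versus edges and
  faces) it has the same defect.\<close>

definition hat_r :: "'a set \<Rightarrow> ('a \<Rightarrow> 'a) \<Rightarrow> 'a + 'a \<Rightarrow> 'a + 'a" where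
  "hat_r X r z = (case z of Inl x \<Rightarrow> if x \<in> X then Inr (r x) else Inl x
     | Inr x \<Rightarrow> if x \<in> X then Inl x else Inr x)"

definition hat_t :: "('a \<Rightarrow> 'a) \<Rightarrow> ('a \<Rightarrow> 'a) \<Rightarrow> 'a + 'a \<Rightarrow> 'a + 'a" where
  "hat_t q t z = (case z of Inl x \<Rightarrow> Inl (t x) | Inr x \<Rightarrow> Inr (q x))"

lemma hat_t_simps [simp]:
  "hat_t q t (Inl x) = Inl (t x)" "hat_t q t (Inr x) = Inr (q x)"
  by (simp_all add: hat_t_def)

lemma hat_r_simps [simp]:
  "hat_r X r (Inl x) = (if x \<in> X then Inr (r x) else Inl x)"
  "hat_r X r (Inr x) = (if x \<in> X then Inl x else Inr x)"
  by (simp_all add: hat_r_def)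

locale connected_hypermap =
  fixes X :: "'a set" and r t :: "'a \<Rightarrow> 'a"
  assumes fin: "finite X" and ne: "X \<noteq> {}" and r: "r permutes X" and t: "t permutes X"
    and conn: "\<And>x. x \<in> X \<Longrightarrow> gen_orbit r t x = X"
begin

text \<open>Corners of a face are traversed against \<open>r \<circ> t\<close>. Then
  \<open>hr \<circ> ht\<close> sends \<open>Inl x\<close> to \<open>Inr (r (t x))\<close> and back,
  so the stellated map has one face of length two for each element of \<open>X\<close>.\<close>

definition q :: "'a \<Rightarrow> 'a" where "q = inv (r \<circ> t)"

abbreviation "H \<equiv> X <+> X"
abbreviation "hr \<equiv> hat_r X r"
abbreviation "ht \<equiv> hat_t q t"

lemma rt: "(r \<circ> t) permutes X"
  using permutes_compose[OF t r] .

lemma q: "q permutes X"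
  unfolding q_def using permutes_inv[OF rt] .

lemma q_rt [simp]: "q (r (t x)) = x"
  using permutes_inverses(2)[OF rt, of x] unfolding q_def by simp

lemma finite_H: "finite H"
  using fin by simp

lemmas rX = permutes_in_image[OF r] and tX = permutes_in_image[OF t]
  and irX = permutes_in_image[OF permutes_inv[OF r]] and qX = permutes_in_image[OF q]

lemma hr_permutes: "hr permutes H"
proof (rule bij_imp_permutes)
  have "inj_on hr H"
    using permutes_inj[OF r] by (auto simp: inj_on_def dest: injD)
  moreover have "hr ` H \<subseteq> H" using rX by auto
  ultimately show "bij_betw hr H H" using finite_H by (simp add: bij_betw_def endo_inj_surj)
qed (auto simp: hat_r_def split: sum.splits)

lemma ht_permutes: "ht permutes H"
proof (rule bij_imp_permutes)
  have "inj_on ht H"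
    by (auto simp: inj_on_def inj_eq[OF permutes_inj[OF t]] inj_eq[OF permutes_inj[OF q]])
  moreover have "ht ` H \<subseteq> H" using tX qX by auto
  ultimately show "bij_betw ht H H" using finite_H by (simp add: bij_betw_def endo_inj_surj)
  show "ht z = z" if "z \<notin> H" for z
    using that permutes_not_in[OF t] permutes_not_in[OF q]
    by (cases z) auto
qed

lemma cyc_hr:
  assumes "x \<in> X"
  shows "cyc hr (Inl x) = Inl ` cyc r x \<union> Inr ` cyc r x"
proof
  have X: "cyc r x \<subseteq> X" using cyc_subset[OF r assms] .
  show "cyc hr (Inl x) \<subseteq> Inl ` cyc r x \<union> Inr ` cyc r x"
    by (rule cyc_least) (use X cyc_step in \<open>fastforce split: if_splits\<close>)+
  let ?C = "cyc hr (Inl x)"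
  have "hr (Inr x) = Inl x" using assms by simp
  then have "Inr x \<in> ?C"
    using cyc_sym[OF finite_H hr_permutes cyc_step[OF cyc_self[of "Inr x" hr]]] by simp
  have step: "Inr (r z) \<in> ?C \<and> Inl (r z) \<in> ?C" if "Inl z \<in> ?C" "z \<in> X" for z
  proof -
    have "Inr (r z) \<in> ?C" using cyc_step[OF that(1)] that(2) by simp
    moreover from cyc_step[OF this] have "Inl (r z) \<in> ?C" using that(2) rX by simp
    ultimately show ?thesis by simp
  qed
  have "cyc r x \<subseteq> {z \<in> X. Inl z \<in> ?C \<and> Inr z \<in> ?C}"
    by (rule cyc_least) (use assms \<open>Inr x \<in> ?C\<close> step rX in auto)
  then show "Inl ` cyc r x \<union> Inr ` cyc r x \<subseteq> ?C" by auto
qed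

lemma ht_pow_Inr: "(ht ^^ n) (Inr x) = Inr ((q ^^ n) x)"
  by (induction n) simp_all

lemma cyc_ht_Inl: "cyc ht (Inl x) = Inl ` cyc t x"
proof -
  have "(ht ^^ n) (Inl x) = Inl ((t ^^ n) x)" for n
    by (induction n) simp_all
  then show ?thesis unfolding cyc_def by auto
qed

lemma cyc_ht_Inr: "cyc ht (Inr x) = Inr ` cyc (r \<circ> t) x"
proof -
  have "cyc ht (Inr x) = Inr ` cyc q x" unfolding cyc_def ht_pow_Inr by auto
  then show ?thesis unfolding q_def cyc_inv[OF fin rt] .
qed

text \<open>The stellated map has \<open>2 * card X\<close> elements and one component. It has at
  least \<open>norb r X\<close> vertices and \<open>card X\<close> faces, and its hyperedges are the
  edges and faces of the original. The count collapses to \<open>defect X r t\<close>.\<close>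

lemma hat_defect: "defect H hr ht \<le> defect X r t"
proof -
  have "norb r X \<le> card ((\<lambda>x. cyc hr (Inl x)) ` X)" unfolding norb_def
  proof (rule card_image_le_of_factor[OF fin])
    fix x y assume xy: "x \<in> X" "y \<in> X" "cyc hr (Inl x) = cyc hr (Inl y)"
    then have "Inl y \<in> cyc hr (Inl x)" by simp
    then have "y \<in> cyc r x" using cyc_hr[OF xy(1)] by auto
    then show "cyc r x = cyc r y" using cyc_eq[OF fin r] by simp
  qed
  also have "\<dots> \<le> norb hr H" unfolding norb_def by (rule card_mono) (use fin in auto)
  finally have 1: "norb r X \<le> norb hr H" .
  have "cyc ht ` H = (\<lambda>C. Inl ` C) ` cyc t ` X \<union> (\<lambda>C. Inr ` C) ` cyc (r \<circ> t) ` X"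
    by (auto simp: Plus_def image_Un image_image cyc_ht_Inl cyc_ht_Inr)
  moreover have "(\<lambda>C. Inl ` C) ` cyc t ` X \<inter> (\<lambda>C. Inr ` C) ` cyc (r \<circ> t) ` X = {}"
    using cyc_self by (auto simp: image_iff set_eq_iff)
  moreover have "card ((\<lambda>C. (Inl :: 'a \<Rightarrow> 'a + 'a) ` C) ` cyc t ` X) = norb t X"
    "card ((\<lambda>C. (Inr :: 'a \<Rightarrow> 'a + 'a) ` C) ` cyc (r \<circ> t) ` X) = norb (r \<circ> t) X"
    unfolding norb_def by (auto intro!: card_image inj_onI simp: inj_image_eq_iff)
  ultimately have 2: "norb ht H = norb t X + norb (r \<circ> t) X"
    unfolding norb_def[of ht] using fin by (simp add: card_Un_disjoint)
  have "card X = card ((\<lambda>x. x) ` X)" by simp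
  also have "\<dots> \<le> card ((\<lambda>x. cyc (hr \<circ> ht) (Inl x)) ` X)"
  proof (rule card_image_le_of_factor[OF fin])
    fix x y assume xy: "x \<in> X" "y \<in> X" "cyc (hr \<circ> ht) (Inl x) = cyc (hr \<circ> ht) (Inl y)"
    have "cyc (hr \<circ> ht) (Inl x) \<subseteq> {Inl x, Inr (r (t x))}"
    proof (rule cyc_least)
      show "(hr \<circ> ht) y \<in> {Inl x, Inr (r (t x))}" if "y \<in> {Inl x, Inr (r (t x))}" for y
        using that xy(1) tX by (auto split: if_splits)
    qed simp
    then show "x = y" using xy(3) cyc_self[of "Inl y" "hr \<circ> ht"] by auto
  qed
  also have "\<dots> \<le> norb (hr \<circ> ht) H" unfolding norb_def by (rule card_mono) (use fin in auto)
  finally have 3: "card X \<le> norb (hr \<circ> ht) H" .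
  obtain x0 where x0: "x0 \<in> X" using ne by blast
  let ?C = "gen_orbit hr ht (Inl x0)"
  have Inl: "Inl y \<in> ?C" if "y \<in> X" for y
  proof -
    have "gen_orbit r t x0 \<subseteq> {y \<in> X. Inl y \<in> ?C}"
    proof (rule gen_orbit_least)
      fix y assume y: "y \<in> {y \<in> X. Inl y \<in> ?C}"
      then have "Inl y \<in> ?C" by simp
      then have "hr (hr (Inl y)) \<in> ?C" "ht (Inl y) \<in> ?C" by (intro gen_orbit_step1 gen_orbit_step2, assumption)+
      then show "r y \<in> {y \<in> X. Inl y \<in> ?C}" "t y \<in> {y \<in> X. Inl y \<in> ?C}"
        using y rX tX by (auto split: if_splits)
    qed (use x0 in auto)
    then show ?thesis using conn[OF x0] that by auto
  qed
  have Inr: "Inr y \<in> ?C" if "y \<in> X" for y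
  proof -
    have "inv r y \<in> X" "r (inv r y) = y" using irX that permutes_inverses(1)[OF r] by auto
    then show ?thesis using gen_orbit_step1[OF Inl[of "inv r y"]] by simp
  qed
  have "gen_orbit hr ht ` H \<subseteq> {?C}"
    using gen_orbit_eq[OF finite_H hr_permutes ht_permutes] Inl Inr by (auto simp: Plus_def)
  then have "ncomp hr ht H \<le> card {?C}" unfolding ncomp_def by (intro card_mono) auto
  then have 4: "ncomp hr ht H \<le> 1" by simp
  have "gen_orbit r t ` X = {X}" using conn ne by auto
  then have 5: "ncomp r t X = 1" unfolding ncomp_def by simp
  have "card H = 2 * card X" using fin by (simp add: card_Plus)
  then show ?thesis unfolding defect_def using 1 2 3 4 5 by linarith
qed

text \<open>The corners at \<open>na\<close>, \<open>nb\<close>, \<open>nc\<close>,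
  \<open>nd\<close> follow each other along one face. A path of length two joins the first to the
  third, another joins the second to the fourth. Closed up through the new vertex in that face, the
  two curves cross there and meet nowhere else. Restricting the stellated map to their twelve darts
  gives the configuration of genus 1, which a map of defect 0 cannot contain.\<close>

lemma no_crossing:
  fixes tl :: "'a \<Rightarrow> 'v"
  assumes sph: "defect X r t \<le> 0"
    and tl: "\<And>x y. x \<in> X \<Longrightarrow> y \<in> X \<Longrightarrow> tl x = tl y \<longleftrightarrow> y \<in> cyc r x"
    and tt: "\<And>x. x \<in> X \<Longrightarrow> t (t x) = x"
    and d: "d \<in> X"
  defines "s n \<equiv> (q ^^ n) d"
  assumes L: "s L = d" "inj_on s {..<L}" "na < nb" "nb < nc" "nc < nd" "nd < L"
    and X: "aw \<in> X" "wc \<in> X" "bv \<in> X" "vd \<in> X"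
    and tls: "tl aw = tl (s na)" "tl (t wc) = tl (s nc)" "tl wc = tl (t aw)"
      "tl bv = tl (s nb)" "tl (t vd) = tl (s nd)" "tl vd = tl (t bv)"
    and dist: "distinct [tl (s na), tl (s nb), tl (s nc), tl (s nd), tl wc, tl vd]"
  shows False
proof -
  define z where "z n = (Inr (s n) :: 'a + 'a)" for n
  define Y where "Y = {z na, z nb, z nc, z nd, Inl aw, Inl (t aw), Inl wc, Inl (t wc),
    Inl bv, Inl (t bv), Inl vd, Inl (t vd)}"
  define tlh where "tlh = case_sum tl tl"
  have sX: "s n \<in> X" for n unfolding s_def by (induction n) (use d qX in auto)
  have YH: "Y \<subseteq> H" unfolding Y_def z_def using X sX tX by auto
  have tlh: "v \<in> cyc hr u \<longleftrightarrow> tlh u = tlh v" if uv: "u \<in> H" "v \<in> H" for u v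
  proof -
    define x where "x = case_sum (\<lambda>x. x) (\<lambda>x. x) u"
    have x: "x \<in> X" "tlh u = tl x" "u = Inl x \<or> u = Inr x"
      using uv unfolding x_def tlh_def by auto
    then have "u \<in> cyc hr (Inl x)" using cyc_hr[OF x(1)] by auto
    from cyc_eq[OF finite_H hr_permutes this] have e: "cyc hr u = Inl ` cyc r x \<union> Inr ` cyc r x"
      using cyc_hr[OF x(1)] by simp
    define y where "y = case_sum (\<lambda>x. x) (\<lambda>x. x) v"
    have y: "y \<in> X" "tlh v = tl y" "v = Inl y \<or> v = Inr y"
      using uv unfolding y_def tlh_def by auto
    show ?thesis unfolding e x(2) y(2) tl[OF x(1) y(1)] using y(3) by auto
  qed
  have dY: "distinct [z na, z nb, z nc, z nd, Inl aw, Inl (t aw), Inl wc, Inl (t wc),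
    Inl bv, Inl (t bv), Inl vd, Inl (t vd)]"
  proof -
    have "aw \<noteq> t wc" "bv \<noteq> t vd" using tls dist by auto
    then have "t aw \<noteq> wc" "t bv \<noteq> vd" using tt X by metis+
    then show ?thesis using tls dist unfolding z_def by auto
  qed
  obtain r' t' where r't': "first_return hr Y r'" "first_return ht Y t'"
    "defect Y r' t' \<le> defect H hr ht"
    by (rule defect_restrict[OF finite_H hr_permutes ht_permutes YH]) blast
  \<comment> \<open>Each of the six vertices other than the face centre keeps exactly two darts in
    \<open>Y\<close>, so the first return of \<open>hr\<close> swaps them.\<close>
  have rp: "r' u = v \<and> r' v = u" if "u \<in> Y" "v \<in> Y" "v \<noteq> u" "{y \<in> Y. tlh y = tlh u} = {u, v}" for u v
  proof -
    have "cyc hr u \<inter> Y = {u, v}" using tlh[of u] that YH by fastforce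
    then show ?thesis using first_return_pair[OF finite_H hr_permutes YH r't'(1) that(1,3)] by simp
  qed
  have tp: "t' (Inl x) = Inl (t x) \<and> t' (Inl (t x)) = Inl x"
    if "x \<in> X" "Inl x \<in> Y" "Inl (t x) \<in> Y" "t x \<noteq> x" for x
  proof -
    have "cyc t x \<subseteq> {x, t x}" by (rule cyc_least) (use tt that in auto)
    then have "cyc t x = {x, t x}" using cyc_self[of x t] cyc_step[OF cyc_self[of x t]] by auto
    then have "cyc ht (Inl x) \<inter> Y = {Inl x, Inl (t x)}" using that unfolding cyc_ht_Inl by auto
    then show ?thesis using first_return_pair[OF finite_H ht_permutes YH r't'(2) that(2)] that by simp
  qed
  have z_pow: "(ht ^^ m) (z n) = z (n + m)" for m n
    unfolding z_def ht_pow_Inr s_def by (simp add: funpow_add add.commute)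
  have zY: "m \<in> {na, nb, nc, nd}" if "z m \<in> Y" "m < L" for m
  proof -
    have "z m \<in> {z na, z nb, z nc, z nd}" using that(1) unfolding Y_def z_def by auto
    then have "\<exists>k\<in>{na, nb, nc, nd}. s m = s k" unfolding z_def by auto
    then obtain k where k: "k \<in> {na, nb, nc, nd}" "s m = s k" by blast
    then have "k < L" using L by auto
    then have "m = k" using L(2) k(2) that(2) by (auto dest: inj_onD)
    then show ?thesis using k by simp
  qed
  have zL: "z (L + n) = z n" for n
    using L(1) unfolding z_def s_def by (simp add: add.commute[of L] funpow_add)
  have nxt: "t' (z m) = z n"
    if "m \<in> {na, nb, nc, nd}" "n \<in> {na, nb, nc, nd}" "m < n" "\<And>k. m < k \<Longrightarrow> k < n \<Longrightarrow> k \<notin> {na, nb, nc, nd}" for m n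
  proof -
    have "t' (z m) = (ht ^^ (n - m)) (z m)"
    proof (rule first_return_next[OF r't'(2)])
      show "(ht ^^ (n - m)) (z m) \<in> Y" using z_pow[of "n - m" m] that by (auto simp: Y_def)
      fix l assume l: "0 < l" "l < n - m"
      have "m + l < L" using l that(2) L by auto
      then show "(ht ^^ l) (z m) \<notin> Y" using that(4)[of "m + l"] l zY[of "m + l"] unfolding z_pow by auto
    qed (use that in \<open>auto simp: Y_def\<close>)
    then show ?thesis using z_pow[of "n - m" m] that by simp
  qed
  \<comment> \<open>From the fourth corner the walk passes the end \<open>L\<close> of the face and
    comes round to the first one, which takes \<open>L - nd + na\<close> steps.\<close>
  have last: "t' (z nd) = z na"
  proof -
    have "t' (z nd) = (ht ^^ (L - nd + na)) (z nd)"
    proof (rule first_return_next[OF r't'(2)])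
      have e: "(ht ^^ (L - nd + na)) (z nd) = z na" using z_pow zL[of na] L by (simp add: add.assoc[symmetric])
      then show "(ht ^^ (L - nd + na)) (z nd) \<in> Y" by (simp add: Y_def)
      fix l assume l: "0 < l" "l < L - nd + na"
      show "(ht ^^ l) (z nd) \<notin> Y"
      proof (cases "nd + l < L")
        case True
        then show ?thesis using zY[of "nd + l"] l L unfolding z_pow by auto
      next
        case False
        then obtain k where k: "nd + l = L + k" using le_Suc_ex not_less by blast
        then have "k < na" using l L by linarith
        then show ?thesis using zY[of k] zL[of k] L unfolding z_pow k by auto
      qed
    qed (use L in \<open>auto simp: Y_def\<close>)
    then show ?thesis using z_pow zL[of na] L by (simp add: add.assoc[symmetric])
  qed
  have "defect Y r' t' > 0"
    unfolding Y_def
  proof (rule crossing_defect[OF dY])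
    show "r' permutes {z na, z nb, z nc, z nd, Inl aw, Inl (t aw), Inl wc, Inl (t wc),
      Inl bv, Inl (t bv), Inl vd, Inl (t vd)}" "t' permutes {z na, z nb, z nc, z nd, Inl aw, Inl (t aw), Inl wc, Inl (t wc),
      Inl bv, Inl (t bv), Inl vd, Inl (t vd)}"
      using r't' unfolding first_return_def Y_def by auto
    have "r' (z na) = Inl aw \<and> r' (Inl aw) = z na"
      by (rule rp) (use dist tls in \<open>auto simp: Y_def z_def tlh_def\<close>)
    moreover have "r' (Inl (t aw)) = Inl wc \<and> r' (Inl wc) = Inl (t aw)"
      by (rule rp) (use dist tls dY in \<open>auto simp: Y_def z_def tlh_def\<close>)
    moreover have "r' (z nc) = Inl (t wc) \<and> r' (Inl (t wc)) = z nc"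
      by (rule rp) (use dist tls in \<open>auto simp: Y_def z_def tlh_def\<close>)
    moreover have "r' (z nb) = Inl bv \<and> r' (Inl bv) = z nb"
      by (rule rp) (use dist tls in \<open>auto simp: Y_def z_def tlh_def\<close>)
    moreover have "r' (Inl (t bv)) = Inl vd \<and> r' (Inl vd) = Inl (t bv)"
      by (rule rp) (use dist tls dY in \<open>auto simp: Y_def z_def tlh_def\<close>)
    moreover have "r' (z nd) = Inl (t vd) \<and> r' (Inl (t vd)) = z nd"
      by (rule rp) (use dist tls in \<open>auto simp: Y_def z_def tlh_def\<close>)
    ultimately show "r' (z na) = Inl aw" "r' (Inl aw) = z na" "r' (Inl (t aw)) = Inl wc" "r' (Inl wc) = Inl (t aw)"
      "r' (z nc) = Inl (t wc)" "r' (Inl (t wc)) = z nc" "r' (z nb) = Inl bv" "r' (Inl bv) = z nb"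
      "r' (Inl (t bv)) = Inl vd" "r' (Inl vd) = Inl (t bv)" "r' (z nd) = Inl (t vd)" "r' (Inl (t vd)) = z nd"
      by blast+
    have "t' (Inl aw) = Inl (t aw) \<and> t' (Inl (t aw)) = Inl aw" "t' (Inl wc) = Inl (t wc) \<and> t' (Inl (t wc)) = Inl wc"
      "t' (Inl bv) = Inl (t bv) \<and> t' (Inl (t bv)) = Inl bv" "t' (Inl vd) = Inl (t vd) \<and> t' (Inl (t vd)) = Inl vd"
      using tp[of aw] tp[of wc] tp[of bv] tp[of vd] X dY unfolding Y_def by auto
    then show "t' (Inl aw) = Inl (t aw)" "t' (Inl (t aw)) = Inl aw" "t' (Inl wc) = Inl (t wc)" "t' (Inl (t wc)) = Inl wc"
      "t' (Inl bv) = Inl (t bv)" "t' (Inl (t bv)) = Inl bv" "t' (Inl vd) = Inl (t vd)" "t' (Inl (t vd)) = Inl vd"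
      by blast+
    show "t' (z na) = z nb" "t' (z nb) = z nc" "t' (z nc) = z nd"
      using nxt[of na nb] nxt[of nb nc] nxt[of nc nd] L by auto
    show "t' (z nd) = z na" by (rule last)
  qed
  then show False using r't'(3) hat_defect sph by linarith
qed

end

section \<open>Planar components as spherical maps\<close>

locale plane_component =
  fixes V :: "'v set" and D :: "'d set" and tlv :: "'d \<Rightarrow> 'v" and al sg :: "'d \<Rightarrow> 'd" and u :: 'v
  assumes cmap: "comb_map V D tlv al sg"
    and ne: "comp_darts V D tlv al u \<noteq> {}"
    and genus0: "genus0_on (map_comp V D tlv al u) (comp_darts V D tlv al u) al sg"
begin

abbreviation "K \<equiv> map_comp V D tlv al u"
abbreviation "DK \<equiv> comp_darts V D tlv al u"
abbreviation "adj \<equiv> map_adj D tlv al"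

text \<open>Rotation and reversal are cut down to one component and continued by the identity, which
  makes them permutations of \<open>DK\<close> in the sense of \<open>permutes\<close>.\<close>

definition rot :: "'d \<Rightarrow> 'd" where "rot d = (if d \<in> DK then sg d else d)"
definition rev :: "'d \<Rightarrow> 'd" where "rev d = (if d \<in> DK then al d else d)"

lemma cm: "finite V" "finite D" "\<And>d. d \<in> D \<Longrightarrow> tlv d \<in> V" "\<And>d. d \<in> D \<Longrightarrow> al d \<in> D"
  "\<And>d. d \<in> D \<Longrightarrow> al (al d) = d" "\<And>d. d \<in> D \<Longrightarrow> al d \<noteq> d" "inj_on sg D" "\<And>d. d \<in> D \<Longrightarrow> sg d \<in> D"
  "\<And>d. d \<in> D \<Longrightarrow> tlv (sg d) = tlv d"
  "\<And>d d'. d \<in> D \<Longrightarrow> d' \<in> D \<Longrightarrow> tlv d = tlv d' \<Longrightarrow> \<exists>n. (sg ^^ n) d = d'"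
  using cmap unfolding comb_map_def bij_betw_def by auto

lemma DK_iff: "d \<in> DK \<longleftrightarrow> d \<in> D \<and> tlv d \<in> K"
  unfolding comp_darts_def by simp

lemma adj_sym: "adj x y \<Longrightarrow> adj y x"
  unfolding map_adj_def using cm(4,5) by metis

lemma adj_dart: "d \<in> D \<Longrightarrow> adj (tlv d) (tlv (al d))"
  unfolding map_adj_def by auto

lemma K_adj: "x \<in> K \<Longrightarrow> adj x y \<Longrightarrow> y \<in> K"
proof -
  assume x: "x \<in> K" and a: "adj x y"
  have "y \<in> V" using a cm(3,4) unfolding map_adj_def by auto
  then show "y \<in> K" using x a unfolding map_comp_def by (auto intro: rtranclp.rtrancl_into_rtrancl)
qed

lemma K_reach: "x \<in> K \<Longrightarrow> y \<in> K \<Longrightarrow> adj\<^sup>*\<^sup>* x y"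
proof -
  have "symp adj" using adj_sym by (auto intro: sympI)
  then have "adj\<^sup>*\<^sup>* u x \<Longrightarrow> adj\<^sup>*\<^sup>* x u" for x by (metis symp_rtranclp sympD)
  then show "x \<in> K \<Longrightarrow> y \<in> K \<Longrightarrow> adj\<^sup>*\<^sup>* x y"
    unfolding map_comp_def by (auto intro: rtranclp_trans)
qed

lemma DK_closed: "d \<in> DK \<Longrightarrow> al d \<in> DK" "d \<in> DK \<Longrightarrow> sg d \<in> DK"
  using K_adj[OF _ adj_dart] cm(4,8,9) unfolding DK_iff by auto

lemma finite_DK: "finite DK"
  using cm(2) unfolding comp_darts_def by simp

lemma rot: "rot permutes DK"
proof (rule bij_imp_permutes)
  have "inj_on sg DK" using cm(7) by (rule inj_on_subset) (auto simp: DK_iff)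
  then have "inj_on rot DK" unfolding rot_def by (auto simp: inj_on_def)
  moreover have "rot ` DK \<subseteq> DK" using DK_closed unfolding rot_def by auto
  ultimately show "bij_betw rot DK DK" using finite_DK by (simp add: bij_betw_def endo_inj_surj)
qed (simp add: rot_def)

lemma rev_rev: "d \<in> DK \<Longrightarrow> rev (rev d) = d" "d \<in> DK \<Longrightarrow> rev d \<noteq> d" "d \<in> DK \<Longrightarrow> rev d \<in> DK"
  using DK_closed cm(5,6) unfolding rev_def by (auto simp: DK_iff)

lemma rev: "rev permutes DK"
proof (rule bij_imp_permutes)
  show "bij_betw rev DK DK"
    by (rule bij_betw_byWitness[where f' = rev]) (use rev_rev in auto)
qed (simp add: rev_def)

lemma cyc_rot:
  assumes "d \<in> DK"
  shows "cyc rot d = {d' \<in> DK. tlv d' = tlv d}"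
proof
  show "cyc rot d \<subseteq> {d' \<in> DK. tlv d' = tlv d}"
    by (rule cyc_least) (use assms DK_closed cm(9) in \<open>auto simp: rot_def DK_iff\<close>)
  have "cyc rot d = cyc sg d"
    by (rule cyc_cong_on[of _ DK]) (use assms DK_closed in \<open>auto simp: rot_def\<close>)
  then show "{d' \<in> DK. tlv d' = tlv d} \<subseteq> cyc rot d"
    using cm(10) assms unfolding cyc_def DK_iff by force
qed

lemma cyc_rev:
  assumes "d \<in> DK"
  shows "cyc rev d = {d, rev d}"
proof
  show "cyc rev d \<subseteq> {d, rev d}"
    by (rule cyc_least) (use assms rev_rev in auto)
  show "{d, rev d} \<subseteq> cyc rev d" using cyc_step[OF cyc_self] by auto
qed

lemma K_dart:
  assumes "v \<in> K"
  shows "\<exists>d\<in>DK. tlv d = v"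
proof -
  obtain d0 where d0: "d0 \<in> DK" using ne by blast
  then have "adj\<^sup>*\<^sup>* v (tlv d0)" using K_reach assms DK_iff by blast
  then show ?thesis
  proof (cases rule: converse_rtranclpE)
    case base
    then show ?thesis using d0 by blast
  next
    case (step y)
    then obtain d where "d \<in> D" "tlv d = v" unfolding map_adj_def by blast
    then show ?thesis using assms DK_iff by blast
  qed
qed

lemma tlv_DK: "tlv ` DK = K"
  using K_dart by (auto simp: DK_iff image_iff)

lemma connected:
  assumes d: "d \<in> DK"
  shows "gen_orbit rot rev d = DK"
proof
  show "gen_orbit rot rev d \<subseteq> DK" using gen_orbit_subset[OF rot rev d] .
  let ?C = "gen_orbit rot rev d"
  have same: "d' \<in> ?C" if "e \<in> ?C" "d' \<in> DK" "e \<in> DK" "tlv d' = tlv e" for d' e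
  proof -
    have "d' \<in> cyc rot e" using cyc_rot[OF that(3)] that by simp
    then have "d' \<in> gen_orbit rot rev e" using cyc_subset_gen_orbit by fast
    then show ?thesis using gen_orbit_trans[OF that(1)] by blast
  qed
  have "adj\<^sup>*\<^sup>* (tlv d) v \<Longrightarrow> \<forall>d'\<in>DK. tlv d' = v \<longrightarrow> d' \<in> ?C" for v
  proof (induction rule: rtranclp_induct)
    case base
    then show ?case using same[of d] d by auto
  next
    case (step v w)
    then obtain e where e: "e \<in> D" "tlv e = v" "tlv (al e) = w" unfolding map_adj_def by auto
    have "v \<in> K" using step(1) d K_adj unfolding DK_iff by (induction) auto
    then have eD: "e \<in> DK" using e DK_iff by simp
    then have "e \<in> ?C" using step e by blast
    then have "rev e \<in> ?C" by (rule gen_orbit_step2)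
    moreover have "tlv (rev e) = w" "rev e \<in> DK" using e eD rev_rev unfolding rev_def by auto
    ultimately show ?case using same[of "rev e"] by auto
  qed
  moreover have "adj\<^sup>*\<^sup>* (tlv d) (tlv d')" if "d' \<in> DK" for d' using K_reach d that DK_iff by blast
  ultimately show "DK \<subseteq> ?C" by blast
qed

lemma cyc_face: "d \<in> DK \<Longrightarrow> cyc (rot \<circ> rev) d = face_of al sg d"
proof -
  assume "d \<in> DK"
  then have "cyc (rot \<circ> rev) d = cyc (sg \<circ> al) d"
    by (intro cyc_cong_on[of _ DK]) (use DK_closed in \<open>auto simp: rot_def rev_def\<close>)
  then show ?thesis unfolding cyc_def face_of_def .
qed

text \<open>Vertices, edges and faces of the component are the cycles of \<open>rot\<close>,
  \<open>rev\<close> and \<open>rot \<circ> rev\<close>, and every edge has two darts; Euler's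
  formula then reads defect 0.\<close>

lemma spherical: "defect DK rot rev = 0"
proof -
  have "card K = card (tlv ` DK)" using tlv_DK by simp
  also have "\<dots> = norb rot DK" unfolding norb_def
    by (rule card_image_eq_of_iff[OF finite_DK]) (use cyc_rot cyc_eq_iff[OF finite_DK rot] in auto)
  finally have 1: "card K = norb rot DK" .
  have "2 * card (cyc rev ` DK) = card (\<Union> (cyc rev ` DK))"
  proof (rule card_partition)
    show "card c = 2" if c: "c \<in> cyc rev ` DK" for c
    proof -
      obtain d where "d \<in> DK" "c = {d, rev d}" using c cyc_rev by auto
      then show ?thesis using rev_rev(2)[of d] by (metis card_2_iff)
    qed
    show "c1 \<inter> c2 = {}" if "c1 \<in> cyc rev ` DK" "c2 \<in> cyc rev ` DK" "c1 \<noteq> c2" for c1 c2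
      using that cyc_eq[OF finite_DK rev] by blast
    show "finite (\<Union> (cyc rev ` DK))" using finite_DK cyc_rev by auto
  qed (use finite_DK in simp)
  moreover have "\<Union> (cyc rev ` DK) = DK" using cyc_subset[OF rev] by blast
  ultimately have 2: "card DK = 2 * norb rev DK" unfolding norb_def by simp
  have "map_faces DK al sg = cyc (rot \<circ> rev) ` DK"
    unfolding map_faces_def using cyc_face by auto
  then have 3: "card (map_faces DK al sg) = norb (rot \<circ> rev) DK" unfolding norb_def by simp
  have "gen_orbit rot rev ` DK = {DK}" using connected ne by auto
  then have "ncomp rot rev DK = 1" unfolding ncomp_def by simp
  moreover have "norb rot DK + norb (rot \<circ> rev) DK = norb rev DK + 2"
    using genus0 1 2 3 unfolding genus0_on_def by simp
  ultimately show ?thesis unfolding defect_def using 2 by simp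
qed

sublocale connected_hypermap DK rot rev
  using finite_DK ne rot rev connected by unfold_locales

end

section \<open>Colouring one component of a plane map\<close>

context plane_component
begin

text \<open>The outer face may visit a vertex several times; any one visit serves as its position.
  If the neighbour sets of \<open>w\<close> and \<open>w'\<close> crossed, the edges to the four
  neighbours would be the two paths excluded by \<open>no_crossing\<close>. As \<open>w\<close> and
  \<open>w'\<close> lie outside \<open>A\<close>, they differ from those four vertices.\<close>

lemma outer_coloring:
  assumes face: "F \<in> map_faces DK al sg" "tlv ` F = K"
  obtains c :: "'v \<Rightarrow> nat" where "\<And>v. v \<in> K \<Longrightarrow> c v < 5"
    "\<And>w. w \<in> K \<Longrightarrow> w \<notin> A \<Longrightarrow> odd_on c {v \<in> A. adj w v}"
proof -
  obtain d where d: "d \<in> DK" "F = cyc (rot \<circ> rev) d"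
    using face(1) cyc_face unfolding map_faces_def by auto
  define s where "s n = (q ^^ n) d" for n
  have F: "F = cyc q d" unfolding d(2) q_def cyc_inv[OF finite_DK rt] ..
  obtain n0 where n0: "n0 > 0" "(q ^^ n0) d = d" using pow_period[OF finite_DK q] by metis
  define L where "L = (LEAST n. n > 0 \<and> s n = d)"
  have L: "L > 0" "s L = d" unfolding L_def using LeastI[of "\<lambda>n. n > 0 \<and> s n = d" n0] n0 by (auto simp: s_def)
  have Ll: "s n \<noteq> d" if "n > 0" "n < L" for n
    using not_less_Least[of n "\<lambda>n. n > 0 \<and> s n = d"] that unfolding L_def by auto
  have inj_s: "inj_on s {..<L}"
  proof (rule linorder_inj_onI)
    fix i j assume ij: "i < j" "i \<in> {..<L}" "j \<in> {..<L}"
    show "s i \<noteq> s j"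
    proof
      assume "s i = s j"
      then have "(q ^^ i) ((q ^^ (j - i)) d) = (q ^^ i) d"
        using ij(1) unfolding s_def by (metis comp_apply funpow_add le_add_diff_inverse less_imp_le)
      then have "s (j - i) = d" unfolding s_def using inj_fn[OF permutes_inj[OF q]] by (metis injD)
      then show False using Ll[of "j - i"] ij(1,3) by (simp add: less_imp_diff_less)
    qed
  qed auto
  have ex: "\<exists>n<L. tlv (s n) = v" if "v \<in> K" for v
  proof -
    have "v \<in> tlv ` cyc q d" using face(2) F \<open>v \<in> K\<close> by simp
    then obtain n where "tlv (s n) = v" unfolding cyc_def s_def by auto
    moreover have "s (n mod L) = s n" using L(2) unfolding s_def by (rule funpow_mod_eq)
    ultimately show ?thesis using L(1) by (intro exI[of _ "n mod L"]) auto
  qed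
  define pos where "pos v = (SOME n. n < L \<and> tlv (s n) = v)" for v
  have pos: "pos v < L" "tlv (s (pos v)) = v" if "v \<in> K" for v
    using someI_ex[OF ex[OF that, simplified]] unfolding pos_def by auto
  have inj_pos: "inj_on pos K" using pos(2) by (rule inj_on_inverseI)
  define N where "N w = {v \<in> A. adj w v}" for w
  have NK: "N w \<subseteq> K" if "w \<in> K" for w using K_adj[OF that] unfolding N_def by auto
  define Fm where "Fm = (\<lambda>w. pos ` N w) ` (K - A)"
  have "False"
    if S: "S \<in> Fm" "S' \<in> Fm" "S \<noteq> S'" and m: "na \<in> S" "nc \<in> S" "nb \<in> S'" "nd \<in> S'"
      and less: "na < nb" "nb < nc" "nc < nd" for S S' na nb nc nd
  proof -
    obtain w where w: "w \<in> K" "w \<notin> A" "S = pos ` N w" using S unfolding Fm_def by auto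
    obtain w' where w': "w' \<in> K" "w' \<notin> A" "S' = pos ` N w'" using S unfolding Fm_def by auto
    have ww: "w \<noteq> w'" using S w w' by auto
    have dart: "\<exists>v e. v \<in> A \<and> e \<in> DK \<and> tlv e = x \<and> tlv (rev e) = v \<and> n < L \<and> tlv (s n) = v"
      if n: "n \<in> pos ` N x" and x: "x \<in> K" for n x
    proof -
      obtain v where v: "v \<in> A" "adj x v" "n = pos v" using n unfolding N_def by auto
      then obtain e where e: "e \<in> D" "tlv e = x" "tlv (al e) = v" unfolding map_adj_def by auto
      then have eD: "e \<in> DK" using x DK_iff by simp
      have "v \<in> K" using K_adj x v by blast
      then show ?thesis using v e eD pos unfolding rev_def by auto
    qed
    obtain a e1 where 1: "a \<in> A" "e1 \<in> DK" "tlv e1 = w" "tlv (rev e1) = a" "tlv (s na) = a"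
      using dart[of na w] m w by auto
    obtain c e2 where 2: "c \<in> A" "e2 \<in> DK" "tlv e2 = w" "tlv (rev e2) = c" "tlv (s nc) = c"
      using dart[of nc w] m w by auto
    obtain b e3 where 3: "b \<in> A" "e3 \<in> DK" "tlv e3 = w'" "tlv (rev e3) = b" "tlv (s nb) = b"
      using dart[of nb w'] m w' by auto
    obtain dd e4 where 4: "dd \<in> A" "e4 \<in> DK" "tlv e4 = w'" "tlv (rev e4) = dd" "tlv (s nd) = dd" "nd < L"
      using dart[of nd w'] m w' by auto
    have posK: "pos (tlv (s n)) = n" if n: "n \<in> pos ` N x" "x \<in> K" for n x
    proof -
      obtain v where "v \<in> K" "n = pos v" using n NK by blast
      then show ?thesis using pos by simp
    qed
    have "pos a = na" "pos c = nc" "pos b = nb" "pos dd = nd"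
      using posK[of na w] posK[of nc w] posK[of nb w'] posK[of nd w'] m w w' 1 2 3 4 by auto
    then have "distinct [a, b, c, dd]" using less by auto
    then have dist: "distinct [tlv (s na), tlv (s nb), tlv (s nc), tlv (s nd), tlv e2, tlv e4]"
      using 1 2 3 4 w w' ww by auto
    show False
    proof (rule no_crossing[of tlv d L na nb nc nd "rev e1" e2 "rev e3" e4, folded s_def])
      show "defect DK rot rev \<le> 0" using spherical by simp
      show "(tlv x = tlv y) = (y \<in> cyc rot x)" if "x \<in> DK" "y \<in> DK" for x y
        unfolding cyc_rot[OF that(1)] using that(2) by auto
      show "rev (rev x) = x" if "x \<in> DK" for x using rev_rev that by simp
      show "inj_on s {..<L}" by (rule inj_s)
    qed (use d L less 1 2 3 4 rev_rev dist in auto)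
  qed
  moreover have "S \<subseteq> {..<L}" if "S \<in> Fm" for S using that pos(1) NK unfolding Fm_def by auto
  ultimately obtain c where c: "\<And>x. x < L \<Longrightarrow> c x < (5::nat)" "\<And>S. S \<in> Fm \<Longrightarrow> odd_on c S"
    using noncrossing_coloring[of Fm L] by metis
  show ?thesis
  proof (rule that[of "c \<circ> pos"])
    show "(c \<circ> pos) v < 5" if "v \<in> K" for v using c(1) pos(1) that by simp
    fix w assume w: "w \<in> K" "w \<notin> A"
    have "bij_betw pos (N w) (pos ` N w)"
      using inj_on_subset[OF inj_pos NK[OF w(1)]] by (rule inj_on_imp_bij_betw)
    moreover have "odd_on c (pos ` N w)" using c(2) w unfolding Fm_def by blast
    ultimately show "odd_on (c \<circ> pos) {v \<in> A. adj w v}" using odd_on_bij_betw unfolding N_def by blast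
  qed
qed

text \<open>\<open>X\<close> stands for the darts leading from the colour class to outside vertices.
  Turning each outside vertex into a hyperedge gives two permutations of \<open>X\<close> itself:
  \<open>r\<close> rotates at the tails, and \<open>t\<close> at the heads, carried back by
  \<open>rev\<close>. Premise \<open>two\<close> excludes fixed points of \<open>t\<close>, which
  would become loops.\<close>

lemma bipartite_coloring:
  assumes X: "X \<subseteq> DK" "X \<noteq> {}"
    and sep: "\<And>x y. x \<in> X \<Longrightarrow> y \<in> X \<Longrightarrow> tlv x \<noteq> tlv (al y)"
    and simple: "\<And>x y. x \<in> X \<Longrightarrow> y \<in> X \<Longrightarrow> tlv x = tlv y \<Longrightarrow> tlv (al x) = tlv (al y) \<Longrightarrow> x = y"
    and two: "\<And>x. x \<in> X \<Longrightarrow> \<exists>y\<in>X. y \<noteq> x \<and> tlv (al y) = tlv (al x)"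
    and con: "\<And>S. S \<subseteq> X \<Longrightarrow> S \<noteq> {} \<Longrightarrow>
      (\<And>x y. x \<in> S \<Longrightarrow> y \<in> X \<Longrightarrow> tlv x = tlv y \<or> tlv (al x) = tlv (al y) \<Longrightarrow> y \<in> S) \<Longrightarrow> S = X"
    and k: "chi_pfo_P = enat k"
  obtains c :: "'d \<Rightarrow> nat" where "\<And>x. x \<in> X \<Longrightarrow> c x < k"
    "\<And>x y. x \<in> X \<Longrightarrow> y \<in> X \<Longrightarrow> tlv x = tlv y \<Longrightarrow> c x = c y"
    "\<And>x. x \<in> X \<Longrightarrow> odd_on c {y \<in> X. tlv (al y) = tlv (al x)}"
proof -
  define Y where "Y = X \<union> rev ` X"
  have finX: "finite X" using X(1) finite_DK finite_subset by blast
  have finY: "finite Y" unfolding Y_def using finX by simp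
  have YD: "Y \<subseteq> DK" unfolding Y_def using X(1) rev_rev by auto
  have revX: "rev x = al x" "rev (rev x) = x" if "x \<in> X" for x
  proof -
    have "x \<in> DK" using that X(1) by blast
    then show "rev x = al x" "rev (rev x) = x" using rev_rev(1) by (simp_all add: rev_def)
  qed
  have revY: "rev y \<in> Y" if "y \<in> Y" for y using that revX unfolding Y_def by auto
  have disj: "X \<inter> rev ` X = {}" using sep revX by fastforce
  obtain r' t' where r't': "first_return rot Y r'" "first_return rev Y t'" "defect Y r' t' \<le> 0"
    using defect_restrict[OF finite_DK rot rev YD] spherical by metis
  have r': "r' permutes Y" and t': "t' permutes Y" using r't' unfolding first_return_def by auto
  have cr: "cyc r' y = {d \<in> Y. tlv d = tlv y}" if "y \<in> Y" for y
  proof -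
    have "cyc r' y = cyc rot y \<inter> Y" using first_return_cyc[OF finite_DK rot YD r't'(1) that] .
    then show ?thesis using cyc_rot[of y] that YD by auto
  qed
  have t'_eq: "t' y = rev y" if "y \<in> Y" for y
  proof -
    have "y \<in> DK" using that YD by blast
    then have "cyc rev y \<inter> Y = {y, rev y}" "rev y \<noteq> y" using cyc_rev that revY rev_rev by auto
    then show ?thesis using first_return_pair(1)[OF finite_DK rev YD r't'(2) that] by blast
  qed
  have r'X: "r' x \<in> X" if "x \<in> X" for x
  proof -
    have "r' x \<in> {d \<in> Y. tlv d = tlv x}" using cr[of x] that cyc_step[OF cyc_self[of x r']] unfolding Y_def by auto
    then show ?thesis using sep[OF that] revX unfolding Y_def by fastforce
  qed
  have r'revX: "r' (rev x) \<in> rev ` X" if "x \<in> X" for x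
  proof -
    have "r' (rev x) \<in> {d \<in> Y. tlv d = tlv (rev x)}"
      using cr[of "rev x"] that cyc_step[OF cyc_self[of "rev x" r']] unfolding Y_def by auto
    then show ?thesis using sep[OF _ that] revX that unfolding Y_def by fastforce
  qed
  define r where "r x = (if x \<in> X then r' x else x)" for x
  define t where "t x = (if x \<in> X then rev (r' (rev x)) else x)" for x
  have tX: "t x \<in> X" "rev (t x) = r' (rev x)" if "x \<in> X" for x
    using r'revX[OF that] revX that unfolding t_def by auto
  have rp: "r permutes X"
  proof (rule bij_imp_permutes)
    have "inj_on r X" using permutes_inj[OF r'] unfolding r_def by (auto simp: inj_on_def dest: injD)
    moreover have "r ` X \<subseteq> X" using r'X unfolding r_def by auto
    ultimately show "bij_betw r X X" using finX by (simp add: bij_betw_def endo_inj_surj)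
  qed (simp add: r_def)
  have tp: "t permutes X"
  proof (rule bij_imp_permutes)
    have "inj_on t X"
    proof (rule inj_onI)
      fix x y assume xy: "x \<in> X" "y \<in> X" "t x = t y"
      then have "r' (rev x) = r' (rev y)" using tX(2) by metis
      then have "rev x = rev y" using permutes_inj[OF r'] by (auto dest: injD)
      then show "x = y" using revX xy by metis
    qed
    moreover have "t ` X \<subseteq> X" using tX by auto
    ultimately show "bij_betw t X X" using finX by (simp add: bij_betw_def endo_inj_surj)
  qed (simp add: t_def)
  have cyc_r: "cyc r x = {y \<in> X. tlv y = tlv x}" if x: "x \<in> X" for x
  proof -
    have "cyc r x = cyc r' x"
      by (rule cyc_cong_on[of _ X]) (use x r'X in \<open>auto simp: r_def\<close>)
    also have "\<dots> = {y \<in> X. tlv y = tlv x}"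
      using cr[of x] x sep[OF x] revX unfolding Y_def by fastforce
    finally show ?thesis .
  qed
  have cyc_t: "cyc t x = {y \<in> X. tlv (al y) = tlv (al x)}"
    and cyc_t_rev: "cyc r' (rev x) = rev ` cyc t x" if x: "x \<in> X" for x
  proof -
    show e: "cyc r' (rev x) = rev ` cyc t x"
      using cyc_transport[OF tp _ x, of r' rev] tX(2) by auto
    have "cyc r' (rev x) = {d \<in> Y. tlv d = tlv (al x)}" using cr[of "rev x"] x revX unfolding Y_def by auto
    also have "\<dots> = rev ` {y \<in> X. tlv (al y) = tlv (al x)}"
      using sep[OF _ x] revX unfolding Y_def by (auto simp: image_iff)
    finally have "rev ` cyc t x = rev ` {y \<in> X. tlv (al y) = tlv (al x)}" using e by simp
    then show "cyc t x = {y \<in> X. tlv (al y) = tlv (al x)}"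
      by (simp add: inj_image_eq_iff[OF permutes_inj[OF rev]])
  qed
  have comp_X: "gen_orbit r t x = X" if x: "x \<in> X" for x
  proof (rule con)
    show "gen_orbit r t x \<subseteq> X" using gen_orbit_subset[OF rp tp x] .
    fix y z assume y: "y \<in> gen_orbit r t x" and z: "z \<in> X" "tlv y = tlv z \<or> tlv (al y) = tlv (al z)"
    have yX: "y \<in> X" using y gen_orbit_subset[OF rp tp x] by blast
    then have "z \<in> cyc r y \<or> z \<in> cyc t y" using z cyc_r cyc_t by auto
    then have "z \<in> gen_orbit r t y" using cyc_subset_gen_orbit[of r y t] cyc_subset_gen_orbit[of t y r] gen_orbit_commute[of r t] by auto
    then show "z \<in> gen_orbit r t x" using gen_orbit_trans[OF y] by blast
  qed auto
  \<comment> \<open>\<open>Y\<close> has twice as many elements as \<open>X\<close>, and at most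
    \<open>card X\<close> edges use up the surplus. The vertices of \<open>Y\<close> are the cycles
    of \<open>r\<close> together with the reversed cycles of \<open>t\<close>. For the faces, every
    \<open>r' \<circ> t'\<close>-cycle meets \<open>X\<close>, and two steps of
    \<open>r' \<circ> t'\<close> make one step of \<open>r \<circ> t\<close>.\<close>
  have "defect X r t \<le> defect Y r' t'"
  proof -
    have "card Y = 2 * card X"
      unfolding Y_def using disj finX permutes_inj[OF rev]
      by (simp add: card_Un_disjoint card_image inj_on_subset)
    moreover have "norb r' Y \<le> norb r X + norb t X"
    proof -
      have "cyc r' ` X = cyc r ` X"
      proof (rule image_cong)
        fix x assume "x \<in> X"
        then show "cyc r' x = cyc r x"
          by (intro cyc_cong_on[of _ X, symmetric]) (use r'X in \<open>auto simp: r_def\<close>)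
      qed simp
      moreover have "cyc r' ` rev ` X = (\<lambda>C. rev ` C) ` cyc t ` X"
        using cyc_t_rev by (auto simp: image_image)
      ultimately have "cyc r' ` Y = cyc r ` X \<union> (\<lambda>C. rev ` C) ` cyc t ` X"
        unfolding Y_def by (simp add: image_Un)
      then have "norb r' Y \<le> card (cyc r ` X) + card ((\<lambda>C. rev ` C) ` cyc t ` X)"
        unfolding norb_def by (simp add: card_Un_le)
      also have "\<dots> \<le> norb r X + norb t X"
        unfolding norb_def using finX by (simp add: card_image_le)
      finally show ?thesis .
    qed
    moreover have "norb t' Y \<le> card X"
    proof -
      have "cyc t' (rev x) = cyc t' x" if "x \<in> X" for x
        using cyc_apply[OF finY t', of x] t'_eq[of x] that unfolding Y_def by simp
      then have "cyc t' ` Y = cyc t' ` X" unfolding Y_def by (auto simp: image_iff)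
      then show ?thesis unfolding norb_def using finX by (simp add: card_image_le)
    qed
    moreover have "norb (r' \<circ> t') Y \<le> norb (r \<circ> t) X"
    proof -
      let ?c = "cyc (r' \<circ> t')"
      note p = permutes_compose[OF t' r']
      have "?c (rev x) \<in> ?c ` X" if x: "x \<in> X" for x
      proof -
        have "(r' \<circ> t') (rev x) = r' x" using t'_eq[of "rev x"] revX x unfolding Y_def by auto
        then have "?c (rev x) = ?c (r' x)" using cyc_apply[OF finY p, of "rev x"] by simp
        then show ?thesis using r'X[OF x] by auto
      qed
      then have "?c ` Y = ?c ` X" unfolding Y_def by auto
      moreover have "card (?c ` X) \<le> card (cyc (r \<circ> t) ` X)"
      proof (rule card_image_le_of_factor[OF finX])
        fix x y assume xy: "x \<in> X" "y \<in> X" "cyc (r \<circ> t) x = cyc (r \<circ> t) y"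
        have "cyc (r \<circ> t) x \<subseteq> {z \<in> X. z \<in> ?c x}"
        proof (rule cyc_least)
          fix z assume z: "z \<in> {z \<in> X. z \<in> ?c x}"
          then have "z \<in> ?c x" by blast
          then have "(r' \<circ> t') ((r' \<circ> t') z) \<in> ?c x" by (intro cyc_step)
          moreover have "(r' \<circ> t') ((r' \<circ> t') z) = (r \<circ> t) z"
          proof -
            have 1: "(r' \<circ> t') z = rev (t z)" using z t'_eq[of z] tX(2)[of z] unfolding Y_def by simp
            have "t z \<in> X" using tX z by simp
            then have "t' (rev (t z)) = t z" using t'_eq[of "rev (t z)"] revX unfolding Y_def by simp
            then show ?thesis unfolding 1 using \<open>t z \<in> X\<close> by (simp add: r_def)
          qed
          moreover have "(r \<circ> t) z \<in> X" using z permutes_in_image[OF permutes_compose[OF tp rp]] by simp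
          ultimately show "(r \<circ> t) z \<in> {z \<in> X. z \<in> ?c x}" by simp
        qed (use xy in simp)
        then have "y \<in> ?c x" using xy(3) cyc_self by fastforce
        then show "?c x = ?c y" using cyc_eq[OF finY p] by simp
      qed
      ultimately show ?thesis unfolding norb_def by simp
    qed
    moreover have "gen_orbit r t ` X = {X}" using comp_X X(2) by auto
    then have "ncomp r t X = 1" unfolding ncomp_def by simp
    moreover have "ncomp r' t' Y \<ge> 1"
      unfolding ncomp_def using finY X(2) by (auto simp: Suc_le_eq card_gt_0_iff Y_def)
    ultimately show ?thesis unfolding defect_def by linarith
  qed
  then have sph: "defect X r t = 0" using r't'(3) defect_nonneg[OF finX rp tp] by simp
  have simp': "y \<notin> cyc r x" if "x \<in> X" "y \<in> cyc t x" "y \<noteq> x" for x y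
    using simple that cyc_r cyc_t by auto
  have nontriv: "t x \<noteq> x" if x: "x \<in> X" for x
  proof
    assume "t x = x"
    then have "cyc t x = {x}" by (rule cyc_fixed)
    then show False using two[OF x] cyc_t[OF x] by auto
  qed
  have "\<exists>c. (\<forall>x\<in>X. c x < k) \<and> (\<forall>x\<in>X. \<forall>y\<in>cyc r x. c y = c x) \<and> (\<forall>x\<in>X. odd_on c (cyc t x))"
  proof (rule spherical_coloring[OF finX X(2) rp tp comp_X sph simp' nontriv k])
    fix c :: "'d \<Rightarrow> nat"
    assume "\<And>x. x \<in> X \<Longrightarrow> c x < k" "\<And>x y. x \<in> X \<Longrightarrow> y \<in> cyc r x \<Longrightarrow> c y = c x"
      "\<And>x. x \<in> X \<Longrightarrow> odd_on c (cyc t x)"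
    then show ?thesis by blast
  qed
  then obtain c where c: "\<And>x. x \<in> X \<Longrightarrow> c x < k"
    "\<And>x y. x \<in> X \<Longrightarrow> y \<in> cyc r x \<Longrightarrow> c y = c x" "\<And>x. x \<in> X \<Longrightarrow> odd_on c (cyc t x)"
    by blast
  show ?thesis
  proof (rule that[of c])
    show "c x < k" if "x \<in> X" for x using c(1) that .
    show "c x = c y" if "x \<in> X" "y \<in> X" "tlv x = tlv y" for x y
      using c(2)[of x y] cyc_r[of x] that by simp
    show "odd_on c {y \<in> X. tlv (al y) = tlv (al x)}" if "x \<in> X" for x
      using c(3) cyc_t that by metis
  qed
qed

end

section \<open>Colorings of planar and outerplanar graphs\<close>

lemma map_adj_graph_darts: "map_adj (graph_darts E) fst prod.swap x y \<longleftrightarrow> {x, y} \<in> E"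
  unfolding map_adj_def graph_darts_def by force

lemma rtranclp_class_eq:
  assumes "symp R" "R x y"
  shows "R\<^sup>*\<^sup>* x = R\<^sup>*\<^sup>* y"
proof
  fix z
  have "R y x" using assms by (auto dest: sympD)
  then show "R\<^sup>*\<^sup>* x z = R\<^sup>*\<^sup>* y z" using assms(2) by (meson converse_rtranclp_into_rtranclp)
qed

lemma outerplanar_class_coloring:
  assumes "outerplanar_graph V E"
  shows "\<exists>c :: 'a \<Rightarrow> nat. (\<forall>v\<in>V. c v < 5) \<and> (\<forall>w\<in>V - A. odd_on c {v \<in> A. {v, w} \<in> E})"
proof -
  let ?D = "graph_darts E"
  let ?adj = "map_adj ?D fst prod.swap"
  let ?K = "map_comp V ?D fst prod.swap"
  let ?DK = "comp_darts V ?D fst prod.swap"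
  obtain sg where cm: "comb_map V ?D fst prod.swap sg"
    and g: "\<And>u. u \<in> V \<Longrightarrow> ?DK u \<noteq> {} \<Longrightarrow> genus0_on (?K u) (?DK u) prod.swap sg"
    and o: "\<And>u. u \<in> V \<Longrightarrow> ?DK u \<noteq> {} \<Longrightarrow> \<exists>f\<in>map_faces (?DK u) prod.swap sg. fst ` f = ?K u"
    using assms unfolding outerplanar_graph_def by blast
  define P where "P S c \<longleftrightarrow> (\<forall>v\<in>S. c v < 5) \<and> (\<forall>w\<in>S - A. odd_on c {v \<in> A. {v, w} \<in> E})"
    for S and c :: "'a \<Rightarrow> nat"
  have "\<exists>c. P (?K u) c" if u: "u \<in> V" for u
  proof (cases "?DK u = {}")
    case True
    have e: "{v \<in> A. {v, w} \<in> E} = {}" if w: "w \<in> ?K u" for w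
    proof (rule ccontr)
      assume "{v \<in> A. {v, w} \<in> E} \<noteq> {}"
      then obtain v where "{v, w} \<in> E" by blast
      then have "(w, v) \<in> ?DK u" using w unfolding comp_darts_def graph_darts_def by (simp add: insert_commute)
      then show False using True by simp
    qed
    have "odd_on (\<lambda>_. 0) {v \<in> A. {v, w} \<in> E}" if "w \<in> ?K u" for w
      unfolding e[OF that] by (rule odd_on_inj) simp
    then have "P (?K u) (\<lambda>_. 0)" unfolding P_def by simp
    then show ?thesis by blast
  next
    case False
    interpret plane_component V ?D fst prod.swap sg u
      using cm g[OF u False] False by unfold_locales
    obtain F where F: "F \<in> map_faces (?DK u) prod.swap sg" "fst ` F = ?K u" using o[OF u False] by blast
    obtain c :: "'a \<Rightarrow> nat" where "\<And>v. v \<in> ?K u \<Longrightarrow> c v < 5"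
      "\<And>w. w \<in> ?K u \<Longrightarrow> w \<notin> A \<Longrightarrow> odd_on c {v \<in> A. ?adj w v}"
      using outer_coloring[OF F, of A] by metis
    then have "P (?K u) c" unfolding P_def map_adj_graph_darts by (simp add: insert_commute)
    then show ?thesis by blast
  qed
  then have P: "P (?K u) (SOME c. P (?K u) c)" if "u \<in> V" for u using someI_ex that by metis
  \<comment> \<open>The choice depends on the component as a set only, and adjacent vertices have
    the same component; so near any \<open>w\<close> a single colouring is in use.\<close>
  define c where "c v = (SOME c. P (?K v) c) v" for v
  have self: "v \<in> ?K v" if "v \<in> V" for v using that unfolding map_comp_def by simp
  have sym: "symp ?adj" by (rule sympI) (simp add: map_adj_graph_darts insert_commute)
  have "c v < 5" if "v \<in> V" for v using P[OF that] self[OF that] unfolding c_def P_def by blast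
  moreover have "odd_on c {v \<in> A. {v, w} \<in> E}" if w: "w \<in> V - A" for w
  proof -
    have "odd_on (SOME c. P (?K w) c) {v \<in> A. {v, w} \<in> E}"
      using P[of w] self[of w] w unfolding P_def by blast
    moreover have "c v = (SOME c. P (?K w) c) v" if "{v, w} \<in> E" for v
    proof -
      have "?adj v w" using that by (simp add: map_adj_graph_darts)
      then have "?K v = ?K w" unfolding map_comp_def using rtranclp_class_eq[OF sym] by simp
      then show ?thesis unfolding c_def by simp
    qed
    ultimately show ?thesis using odd_on_cong[of "{v \<in> A. {v, w} \<in> E}" c "SOME c. P (?K w) c"] by simp
  qed
  ultimately show ?thesis by blast
qed

lemma planar_class_coloring:
  assumes V: "simple_graph V E" and pl: "planar_graph V E" and k: "chi_pfo_P = enat k" "k > 0"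
  shows "\<exists>c :: 'a \<Rightarrow> nat. (\<forall>v\<in>V. c v < k) \<and> (\<forall>w\<in>V - A. odd_on c {v \<in> A. {v, w} \<in> E})"
proof -
  let ?D = "graph_darts E"
  let ?K = "map_comp V ?D fst prod.swap"
  let ?DK = "comp_darts V ?D fst prod.swap"
  obtain sg where cm: "comb_map V ?D fst prod.swap sg"
    and g: "\<And>u. u \<in> V \<Longrightarrow> ?DK u \<noteq> {} \<Longrightarrow> genus0_on (?K u) (?DK u) prod.swap sg"
    using pl unfolding planar_graph_def by blast
  \<comment> \<open>Only outside vertices with two neighbours in \<open>A\<close> are kept. The
    remaining ones see at most one vertex of \<open>A\<close>, and there every colouring is odd. The
    classes of \<open>R\<close> below are the components of the resulting bipartite graph, coloured
    separately.\<close>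
  define Q where "Q = {(u, w). {u, w} \<in> E \<and> u \<in> A \<and> w \<notin> A \<and> (\<exists>u'\<in>A. u' \<noteq> u \<and> {u', w} \<in> E)}"
  define R where "R x y \<longleftrightarrow> x \<in> Q \<and> y \<in> Q \<and> (fst x = fst y \<or> snd x = snd y)" for x y
  define cl where "cl x = {y. R\<^sup>*\<^sup>* x y}" for x
  have symR: "symp R" unfolding R_def by (auto intro: sympI)
  have cl_eq: "cl x = cl y" if "R x y" for x y
    using rtranclp_class_eq[OF symR that] unfolding cl_def by simp
  have cl_self: "x \<in> cl x" for x unfolding cl_def by simp
  have cl_step: "z \<in> cl x" if "y \<in> cl x" "R y z" for x y z
    using that unfolding cl_def by (auto intro: rtranclp.rtrancl_into_rtrancl)
  have cl_Q: "cl x \<subseteq> Q" if "x \<in> Q" for x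
  proof
    fix y assume "y \<in> cl x"
    then have "R\<^sup>*\<^sup>* x y" unfolding cl_def by simp
    then show "y \<in> Q" by (cases rule: rtranclp.cases) (use that R_def in auto)
  qed
  have cl_cl: "cl y = cl x" if "y \<in> cl x" for x y
  proof -
    have "R\<^sup>*\<^sup>* x y" using that unfolding cl_def by simp
    then show ?thesis by induction (use cl_eq in auto)
  qed
  define P where "P S c \<longleftrightarrow> (\<forall>y\<in>S. c y < k) \<and> (\<forall>y\<in>S. \<forall>z\<in>S. fst y = fst z \<longrightarrow> c y = c z) \<and>
      (\<forall>y\<in>S. odd_on c {z \<in> S. snd z = snd y})" for S and c :: "'a \<times> 'a \<Rightarrow> nat"
  have "\<exists>c. P (cl x) c" if x: "x \<in> Q" for x
  proof -
    have xE: "{fst x, snd x} \<in> E" using x unfolding Q_def by auto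
    then have xV: "fst x \<in> V" using V unfolding simple_graph_def by (metis doubleton_eq_iff)
    then have xD: "x \<in> ?DK (fst x)"
      using xE unfolding comp_darts_def map_comp_def graph_darts_def by (cases x) simp
    then have neD: "?DK (fst x) \<noteq> {}" by blast
    interpret plane_component V ?D fst prod.swap sg "fst x"
      using cm g[OF xV neD] neD by unfold_locales
    have clD: "cl x \<subseteq> ?DK (fst x)"
    proof
      fix y assume "y \<in> cl x"
      then have "R\<^sup>*\<^sup>* x y" unfolding cl_def by simp
      then show "y \<in> ?DK (fst x)"
      proof induction
        case (step y z)
        have yz: "{fst y, snd y} \<in> E" "{fst z, snd z} \<in> E" using step(2) unfolding R_def Q_def by auto
        have y: "fst y \<in> ?K (fst x)" using step(3) DK_iff by blast
        have "fst z \<in> ?K (fst x)"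
        proof (cases "fst y = fst z")
          case False
          then have s: "snd y = snd z" using step(2) unfolding R_def by auto
          have "snd y \<in> ?K (fst x)" using K_adj[OF y] yz by (simp add: map_adj_graph_darts)
          then show ?thesis using K_adj[of "snd y" "fst z"] yz s by (simp add: map_adj_graph_darts insert_commute)
        qed (use y in simp)
        moreover have "z \<in> ?D" using yz unfolding graph_darts_def by (cases z) simp
        ultimately show ?case unfolding DK_iff by blast
      qed (rule xD)
    qed
    show ?thesis
    proof (rule bipartite_coloring[OF clD _ _ _ _ _ k(1)])
      show "cl x \<noteq> {}" using cl_self by blast
      show "fst y \<noteq> fst (prod.swap z)" if "y \<in> cl x" "z \<in> cl x" for y z
      proof -
        have "y \<in> Q" "z \<in> Q" using that cl_Q[OF x] by auto
        then show ?thesis unfolding Q_def by (cases y; cases z) auto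
      qed
      show "y = z" if "fst y = fst z" "fst (prod.swap y) = fst (prod.swap z)" for y z :: "'a \<times> 'a"
        using that by (simp add: prod_eq_iff)
      show "\<exists>z\<in>cl x. z \<noteq> y \<and> fst (prod.swap z) = fst (prod.swap y)" if y: "y \<in> cl x" for y
      proof -
        have yQ: "y \<in> Q" using y cl_Q[OF x] by blast
        then obtain u' where u': "u' \<in> A" "u' \<noteq> fst y" "{u', snd y} \<in> E" unfolding Q_def by auto
        have "(u', snd y) \<in> Q" using u' yQ unfolding Q_def by auto
        then have "R y (u', snd y)" using yQ unfolding R_def by simp
        then have "(u', snd y) \<in> cl x" using cl_step[OF y] by blast
        moreover have "(u', snd y) \<noteq> y" using u'(2) by (cases y) simp
        ultimately show ?thesis by (intro bexI[of _ "(u', snd y)"]) simp_all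
      qed
      show "S = cl x" if S: "S \<subseteq> cl x" "S \<noteq> {}"
        "\<And>y z. y \<in> S \<Longrightarrow> z \<in> cl x \<Longrightarrow> fst y = fst z \<or> fst (prod.swap y) = fst (prod.swap z) \<Longrightarrow> z \<in> S" for S
      proof
        obtain s where s: "s \<in> S" using S by blast
        then have e: "cl s = cl x" using S(1) cl_cl by blast
        show "cl x \<subseteq> S"
        proof
          fix y assume "y \<in> cl x"
          then have "R\<^sup>*\<^sup>* s y" using e unfolding cl_def by auto
          then show "y \<in> S"
          proof induction
            case (step y z)
            have "z \<in> cl x" using cl_step[of y x z] step S(1) by blast
            then show ?case using S(3)[OF step(3)] step(2) unfolding R_def by auto
          qed (rule s)
        qed
      qed (rule S(1))
      fix c :: "'a \<times> 'a \<Rightarrow> nat"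
      assume a: "\<And>y. y \<in> cl x \<Longrightarrow> c y < k" "\<And>y z. y \<in> cl x \<Longrightarrow> z \<in> cl x \<Longrightarrow> fst y = fst z \<Longrightarrow> c y = c z"
        "\<And>y. y \<in> cl x \<Longrightarrow> odd_on c {z \<in> cl x. fst (prod.swap z) = fst (prod.swap y)}"
      have "odd_on c {z \<in> cl x. snd z = snd y}" if "y \<in> cl x" for y
        using a(3)[OF that] by simp
      with a(1,2) have "P (cl x) c" unfolding P_def by blast
      then show ?thesis by blast
    qed
  qed
  then have P: "P (cl x) (SOME c. P (cl x) c)" if "x \<in> Q" for x using someI_ex that by metis
  define cc where "cc x = (SOME c. P (cl x) c) x" for x
  have cc_eq: "cc x = cc y" if "x \<in> Q" "y \<in> Q" "fst x = fst y" for x y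
  proof -
    have R: "R x y" using that unfolding R_def by simp
    then have "y \<in> cl x" using cl_step[OF cl_self] by blast
    then have "(SOME c. P (cl x) c) x = (SOME c. P (cl x) c) y"
      using P[OF that(1)] cl_self that(3) unfolding P_def by blast
    then show ?thesis unfolding cc_def using cl_eq[OF R] by simp
  qed
  \<comment> \<open>Darts of \<open>Q\<close> with a common tail lie in one class and are coloured
    alike, so any of them determines the colour of the tail. Vertices that are no tail get 0, a
    legal colour because \<open>k > 0\<close>.\<close>
  define c where "c v = (if \<exists>x\<in>Q. fst x = v then cc (SOME x. x \<in> Q \<and> fst x = v) else 0)" for v
  have c_fst: "c (fst y) = cc y" if "y \<in> Q" for y
  proof -
    define x where "x = (SOME x. x \<in> Q \<and> fst x = fst y)"
    have x: "x \<in> Q \<and> fst x = fst y"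
      unfolding x_def by (rule someI[of _ y]) (use that in simp)
    have "\<exists>x\<in>Q. fst x = fst y" using that by blast
    then have "c (fst y) = cc x" unfolding c_def x_def by simp
    also have "\<dots> = cc y" using cc_eq x that by blast
    finally show ?thesis .
  qed
  have cck: "cc y < k" if "y \<in> Q" for y
    using P[OF that] cl_self unfolding cc_def P_def by blast
  have "c v < k" for v
  proof (cases "\<exists>x\<in>Q. fst x = v")
    case True
    then show ?thesis using c_fst cck by auto
  next
    case False
    then show ?thesis unfolding c_def using k(2) by simp
  qed
  moreover have "odd_on c {v \<in> A. {v, w} \<in> E}" if w: "w \<in> V - A" for w
  proof (cases "\<exists>v v'. v \<in> A \<and> {v, w} \<in> E \<and> v' \<in> A \<and> {v', w} \<in> E \<and> v \<noteq> v'")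
    case False
    then show ?thesis by (intro odd_on_inj) (auto simp: inj_on_def)
  next
    case True
    let ?N = "{v \<in> A. {v, w} \<in> E}"
    have NQ: "(v, w) \<in> Q" if "v \<in> ?N" for v
    proof -
      have "\<exists>u'\<in>A. u' \<noteq> v \<and> {u', w} \<in> E" using True by metis
      then show ?thesis using that w unfolding Q_def by blast
    qed
    obtain v0 where v0: "v0 \<in> ?N" using True by blast
    define y where "y = (v0, w)"
    have y: "y \<in> Q" using NQ[OF v0] unfolding y_def .
    let ?c = "SOME c. P (cl y) c"
    have Rv: "R y (v, w)" if "v \<in> ?N" for v using NQ[OF that] y unfolding R_def y_def by simp
    have "odd_on ?c {z \<in> cl y. snd z = snd y}" using P[OF y] cl_self unfolding P_def by blast
    moreover have "bij_betw (\<lambda>v. (v, w)) ?N {z \<in> cl y. snd z = snd y}"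
    proof (rule bij_betwI')
      show "(v, w) \<in> {z \<in> cl y. snd z = snd y}" if "v \<in> ?N" for v
        using cl_step[OF cl_self Rv[OF that]] unfolding y_def by simp
      show "\<exists>v\<in>?N. z = (v, w)" if "z \<in> {z \<in> cl y. snd z = snd y}" for z
      proof -
        have "z \<in> Q" "snd z = w" using that cl_Q[OF y] unfolding y_def by auto
        then show ?thesis unfolding Q_def by auto
      qed
    qed auto
    ultimately have o: "odd_on (?c \<circ> (\<lambda>v. (v, w))) ?N" using odd_on_bij_betw by blast
    have "c v = (?c \<circ> (\<lambda>v. (v, w))) v" if "v \<in> ?N" for v
      using c_fst[OF NQ[OF that]] cl_eq[OF Rv[OF that]] unfolding cc_def by simp
    then have "odd_on c ?N = odd_on (?c \<circ> (\<lambda>v. (v, w))) ?N" by (rule odd_on_cong)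
    then show ?thesis using o by simp
  qed
  ultimately show ?thesis by blast
qed

section \<open>From colour classes to strong odd colourings\<close>

lemma proper_col_exists:
  assumes V: "simple_graph V E"
  shows "\<exists>c. proper_col V E c (chromatic_number V E)"
  unfolding chromatic_number_def
proof (rule LeastI_ex)
  have "finite V" using V unfolding simple_graph_def by simp
  then obtain c and n :: nat where c: "c ` V = {i. i < n}" "inj_on c V"
    using finite_imp_inj_to_nat_seg by metis
  have "u \<noteq> w" if "{u, w} \<in> E" for u w using that V unfolding simple_graph_def by (metis doubleton_eq_iff)
  then have "proper_col V E c n" unfolding proper_col_def using c by (auto simp: inj_on_eq_iff)
  then show "\<exists>k c. proper_col V E c k" by blast
qed

text \<open>A colour \<open>x\<close> of the product encodes the pair of \<open>x div k\<close> and
  \<open>x mod k\<close>, so it can occur near \<open>v\<close> only in the class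
  \<open>A (x div k)\<close>. If \<open>v\<close> is in that class, properness leaves it no
  neighbours there; otherwise \<open>H\<close> supplies the parity.\<close>

lemma strong_odd_bound:
  assumes V: "simple_graph V E" and k: "k > 0"
    and H: "\<And>A. \<exists>c :: 'a \<Rightarrow> nat. (\<forall>v\<in>V. c v < k) \<and> (\<forall>w\<in>V - A. odd_on c {v \<in> A. {v, w} \<in> E})"
  shows "strong_odd_chromatic_number V E \<le> k * chromatic_number V E"
proof -
  let ?X = "chromatic_number V E"
  obtain p where p: "p ` V \<subseteq> {..<?X}" "\<And>u w. u \<in> V \<Longrightarrow> w \<in> V \<Longrightarrow> {u, w} \<in> E \<Longrightarrow> p u \<noteq> p w"
    using proper_col_exists[OF V] unfolding proper_col_def by blast
  have EV: "u \<in> V \<and> w \<in> V" if "{u, w} \<in> E" for u w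
    using that V unfolding simple_graph_def by (metis doubleton_eq_iff)
  define A where "A i = {v \<in> V. p v = i}" for i
  obtain C where C: "\<And>i v. v \<in> V \<Longrightarrow> C i v < k"
    "\<And>i w. w \<in> V - A i \<Longrightarrow> odd_on (C i) {v \<in> A i. {v, w} \<in> E}"
    using H[of "A _"] by metis
  define c where "c v = p v * k + C (p v) v" for v
  have c_eq: "c v = x \<longleftrightarrow> p v = x div k \<and> C (x div k) v = x mod k" if "v \<in> V" for v x
  proof
    assume "c v = x"
    then show "p v = x div k \<and> C (x div k) v = x mod k"
      using C(1)[OF that, of "p v"] unfolding c_def by auto
  next
    assume "p v = x div k \<and> C (x div k) v = x mod k"
    then show "c v = x" unfolding c_def by (metis div_mult_mod_eq)
  qed
  have "strong_odd_col V E c (k * ?X)"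
    unfolding strong_odd_col_def proper_col_def
  proof (intro conjI ballI impI allI)
    show "c ` V \<subseteq> {..<k * ?X}"
    proof
      fix x assume "x \<in> c ` V"
      then obtain v where v: "v \<in> V" "x = c v" by blast
      have "c v < Suc (p v) * k" using C(1)[OF v(1)] unfolding c_def by simp
      also have "\<dots> \<le> ?X * k" using p(1) v(1) by (intro mult_le_mono1) auto
      finally show "x \<in> {..<k * ?X}" using v by (simp add: mult.commute)
    qed
    show "c u \<noteq> c w" if "u \<in> V" "w \<in> V" "{u, w} \<in> E" for u w
      using c_eq[OF that(1), of "c w"] c_eq[OF that(2), of "c w"] p(2)[OF that] by auto
    fix v x assume v: "v \<in> V"
    have e: "{u \<in> nbhd E v. c u = x} = {u \<in> {u \<in> A (x div k). {u, v} \<in> E}. C (x div k) u = x mod k}"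
      using EV c_eq unfolding nbhd_def A_def by auto
    show "card {u \<in> nbhd E v. c u = x} = 0 \<or> odd (card {u \<in> nbhd E v. c u = x})"
    proof (cases "v \<in> A (x div k)")
      case True
      then have "{u \<in> A (x div k). {u, v} \<in> E} = {}" using p(2)[OF _ v] unfolding A_def by force
      then have "{u \<in> nbhd E v. c u = x} = {}" unfolding e by blast
      then have "card {u \<in> nbhd E v. c u = x} = 0" by (simp only: card.empty)
      then show ?thesis by (rule disjI1)
    next
      case False
      then show ?thesis using C(2)[of v "x div k"] v unfolding e odd_on_def by blast
    qed
  qed
  then show ?thesis unfolding strong_odd_chromatic_number_def by (intro Least_le) blast
qed

lemma chi_pfo_Po_le_P: "chi_pfo_Po \<le> chi_pfo_P"
  unfolding chi_pfo_Po_def chi_pfo_P_def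
  by (rule SUP_subset_mono) (auto simp: two_conn_outerplane_graph_def)

theorem theorem3p4:
  fixes V :: "'a set" and E :: "'a set set"
  assumes "simple_graph V E"
  shows "(planar_graph V E \<longrightarrow>
            enat (strong_odd_chromatic_number V E) \<le> chi_pfo_P * enat (chromatic_number V E)) \<and>
         (outerplanar_graph V E \<longrightarrow>
            enat (strong_odd_chromatic_number V E) \<le> chi_pfo_Po * enat (chromatic_number V E))"
proof (intro conjI impI)
  let ?so = "strong_odd_chromatic_number V E" and ?X = "chromatic_number V E"
  assume pl: "planar_graph V E"
  show "enat ?so \<le> chi_pfo_P * enat ?X"
  proof (cases chi_pfo_P)
    case (enat k)
    \<comment> \<open>The 5-cycle is also a plane multigraph; this gives the positivity of
      \<open>k\<close> that the default colour 0 requires.\<close>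
    have "enat 5 \<le> enat k" using chi_pfo_Po_ge_5 chi_pfo_Po_le_P enat by (metis order_trans)
    then have "k > 0" by simp
    then have "?so \<le> k * ?X"
      using strong_odd_bound[OF assms] planar_class_coloring[OF assms pl enat] by blast
    then show ?thesis unfolding enat by simp
  next
    case infinity
    show ?thesis
    \<comment> \<open>In \<open>enat\<close> infinity times 0 is 0, so an infinite maximum does not
      settle the empty graph, which is treated by itself.\<close>
    proof (cases "?X = 0")
      case True
      then have "V = {}" using proper_col_exists[OF assms] unfolding proper_col_def by auto
      then have "?so \<le> 1 * ?X" by (intro strong_odd_bound[OF assms]) auto
      then have "enat ?so = 0" using True by (simp add: zero_enat_def)
      then show ?thesis by simp
    next
      case False
      then show ?thesis unfolding infinity by (simp add: zero_enat_def)
    qed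
  qed
next
  let ?so = "strong_odd_chromatic_number V E" and ?X = "chromatic_number V E"
  assume op: "outerplanar_graph V E"
  \<comment> \<open>The class colourings use five colours whatever \<open>chi_pfo_Po\<close> is, and
    the lower bound from the 5-cycle then covers the infinite case too.\<close>
  have "?so \<le> 5 * ?X"
    by (rule strong_odd_bound[OF assms _ outerplanar_class_coloring[OF op]]) simp
  then have "enat ?so \<le> enat 5 * enat ?X" by simp
  also have "\<dots> \<le> chi_pfo_Po * enat ?X" using chi_pfo_Po_ge_5 by (rule mult_right_mono) simp
  finally show "enat ?so \<le> chi_pfo_Po * enat ?X" .
qed

end
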